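(* Let $\alpha\in(0,1)$, $\lambda>0$, and let $(P^{[0]}_{\ell}(\lambda))\sim\mathbb{P}^{[0]}_{\alpha}(\lambda)$, which corresponds in distribution to the ranked masses of the normalized jumps of a generalized gamma subordinator. Then the joint distribution of $(\tilde{P}_{\ell}(\lambda))$, the size-biased rearrangement of $(P^{[0]}_{\ell}(\lambda))$, can be expressed as $$(\tilde{P}_{1}(\lambda),\tilde{P}_{2}(\lambda),\ldots)=(1-W_{1},(1-W_{2})W_{1},\ldots),$$ that is, $\tilde{P}_{\ell}(\lambda)=(1-W_{\ell})\prod_{i=1}^{\ell-1}W_{i}$, where the $(W_{k})$ are dependent random variables represented as $$W_{k}=1-\beta^{(k)}_{(1-\alpha,\alpha)}\,[1-R_{k}(\lambda)],\qquad k\ge1,$$ for $(\beta^{(k)}_{(1-\alpha,\alpha)})_{k\ge1}$ i.i.d. $\mathrm{Beta}(1-\alpha,\alpha)$ variables independent of the sequence $(R_{k}(\lambda))_{k\ge1}$ given by $$R_{k}(\lambda)=\left(\frac{\tilde{G}_{k-1}+\lambda^{\alpha}}{\tilde{G}_{k}+\lambda^{\alpha}}\right)^{1/\alpha},\qquad \tilde G_k=\sum_{i=1}^k\mathbf{e}_i,\quad \tilde G_0=0,$$ where $(\mathbf{e}_i)$ are i.i.d. exponential$(1)$ random variables.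
   Context: $S_\alpha$ is the positive $\alpha$-stable random variable with $\mathbb{E}[e^{-\lambda S_\alpha}]=e^{-\lambda^\alpha}$ and density $f_\alpha$. Let $(A_k)$ be the ranked jumps on $[0,1]$ of a stable subordinator with L\'evy density $\rho_\alpha(s)=\alpha s^{-\alpha-1}/\Gamma(1-\alpha)$, so $\sum_kA_k=S_\alpha$; $\mathrm{PD}(\alpha,0)$ is the law of $(A_\ell/S_\alpha,\ell\ge1)$ and $\mathrm{PD}(\alpha|t)$ is its conditional law given $S_\alpha=t$. Then $$\mathbb{P}^{[0]}_\alpha(\lambda)=\int_0^\infty \mathrm{PD}(\alpha|t)\,e^{\lambda^\alpha}e^{-\lambda t}f_\alpha(t)\,dt;$$ equivalently it is the law of the ranked normalized jumps of a subordinator on $[0,1]$ with L\'evy density $e^{-\lambda s}\rho_\alpha(s)$ (generalized gamma subordinator), and it is also the conditional law of $(P_\ell)\sim\mathrm{PD}(\alpha,0)$ given $N_{S_\alpha}(\lambda)=0$, where, given $S_\alpha$ and $(P_\ell)$, $N_{S_\alpha}(\lambda)$ is Poisson with mean $\lambda S_\alpha$. The size-biased rearrangement of a random mass partition $(P_\ell)$ is the sequence $(\tilde P_\ell)$ obtained by sampling masses without replacement, successively, with probability proportional to size: $\tilde P_1=P_i$ with conditional probability $P_i$, then $\tilde P_2$ is chosen from the remaining masses with probability proportional to mass, etc. *)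

theory Defs
  imports "HOL-Probability.Probability"
begin

section \<open>Subordinators and their ranked jumps\<close>

text \<open>A driftless subordinator \<open>X\<close> with Levy density \<open>\<rho>\<close>, indexed by time \<open>t \<ge> 0\<close>.\<close>

locale subordinator = prob_space M
  for M :: "'a measure" and X :: "real \<Rightarrow> 'a \<Rightarrow> real" and \<rho> :: "real \<Rightarrow> real" +
  assumes levy_density_measurable: "\<rho> \<in> borel_measurable borel"
    and levy_density_nonneg: "\<And>s. 0 < s \<Longrightarrow> 0 \<le> \<rho> s"
    and levy_density_integrable: "set_integrable lborel {0<..} (\<lambda>s. min 1 s * \<rho> s)"
    and random_variable_X: "\<And>t. 0 \<le> t \<Longrightarrow> X t \<in> borel_measurable M"
    and starts_at_0: "AE \<omega> in M. X 0 \<omega> = 0"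
    and paths: "AE \<omega> in M. mono_on {0..} (\<lambda>t. X t \<omega>) \<and>
                  (\<forall>t\<ge>0. continuous (at_right t) (\<lambda>t. X t \<omega>))"
    and independent_increments: "\<And>n (t :: nat \<Rightarrow> real). 0 \<le> t 0 \<Longrightarrow> mono t \<Longrightarrow>
          indep_vars (\<lambda>_. borel) (\<lambda>i \<omega>. X (t (Suc i)) \<omega> - X (t i) \<omega>) {..<n}"
    and stationary_increments: "\<And>s h. 0 \<le> s \<Longrightarrow> 0 \<le> h \<Longrightarrow>
          distr M borel (\<lambda>\<omega>. X (s + h) \<omega> - X s \<omega>) = distr M borel (X h)"
    and laplace_exponent: "\<And>t \<theta>. 0 \<le> t \<Longrightarrow> 0 \<le> \<theta> \<Longrightarrow>
          expectation (\<lambda>\<omega>. exp (- \<theta> * X t \<omega>)) =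
          exp (- t * (LINT s:{0<..}|lborel. (1 - exp (- \<theta> * s)) * \<rho> s))"

definition jump :: "(real \<Rightarrow> real) \<Rightarrow> real \<Rightarrow> real" where
  "jump x t = x t - Lim (at_left t) x"

text \<open>
  \<open>a\<close> lists the jumps of the path \<open>x\<close> on the time interval \<open>[0,1]\<close> in decreasing order, each
  jump time being counted once, and is padded with zeros if there are only finitely many jumps.
\<close>

definition ranked_jumps :: "(real \<Rightarrow> real) \<Rightarrow> (nat \<Rightarrow> real) \<Rightarrow> bool" where
  "ranked_jumps x a \<longleftrightarrow> decseq a \<and> (\<forall>k. 0 \<le> a k) \<and>
     (\<exists>\<tau>. bij_betw \<tau> {k. 0 < a k} {t \<in> {0<..1}. 0 < jump x t} \<and>
          (\<forall>k. 0 < a k \<longrightarrow> a k = jump x (\<tau> k)))"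

abbreviation seq_space :: "(nat \<Rightarrow> real) measure" where
  "seq_space \<equiv> PiM UNIV (\<lambda>_. borel)"

definition ranked_jumps_of ::
  "'a measure \<Rightarrow> (real \<Rightarrow> 'a \<Rightarrow> real) \<Rightarrow> ('a \<Rightarrow> nat \<Rightarrow> real) \<Rightarrow> bool" where
  "ranked_jumps_of M X A \<longleftrightarrow>
     A \<in> M \<rightarrow>\<^sub>M seq_space \<and> (AE \<omega> in M. ranked_jumps (\<lambda>t. X t \<omega>) (A \<omega>))"

definition total_mass :: "(nat \<Rightarrow> real) \<Rightarrow> real" where
  "total_mass a = (\<Sum>k. a k)"

definition normalized :: "(nat \<Rightarrow> real) \<Rightarrow> nat \<Rightarrow> real" where
  "normalized a k = a k / total_mass a"


section \<open>Poisson--Dirichlet laws and their exponential tilting\<close>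

definition stable_levy_density :: "real \<Rightarrow> real \<Rightarrow> real" where
  "stable_levy_density \<alpha> s = \<alpha> * s powr (- \<alpha> - 1) / Gamma (1 - \<alpha>)"

definition gen_gamma_levy_density :: "real \<Rightarrow> real \<Rightarrow> real \<Rightarrow> real" where
  "gen_gamma_levy_density \<alpha> lam s = exp (- lam * s) * stable_levy_density \<alpha> s"

text \<open>
  \<open>f\<close> is a density of the positive \<open>\<alpha>\<close>-stable variable with Laplace transform
  \<open>exp (- \<theta> powr \<alpha>)\<close>. The case \<open>\<theta> = 0\<close>, where \<open>0 powr \<alpha> = 0\<close>, says that \<open>f\<close> has mass one.
\<close>

definition stable_density :: "real \<Rightarrow> (real \<Rightarrow> real) \<Rightarrow> bool" where
  "stable_density \<alpha> f \<longleftrightarrow>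
     f \<in> borel_measurable borel \<and> (\<forall>t. 0 \<le> f t) \<and> (\<forall>t\<le>0. f t = 0) \<and>
     (\<forall>\<theta>\<ge>0. (\<integral>\<^sup>+t. ennreal (exp (- \<theta> * t) * f t) \<partial>lborel) = ennreal (exp (- (\<theta> powr \<alpha>))))"

text \<open>\<open>K\<close> is a version of the regular conditional law of \<open>Y\<close> (with values in \<open>L\<close>) given \<open>Z\<close>.\<close>

definition conditional_law ::
  "'a measure \<Rightarrow> 'b measure \<Rightarrow> ('a \<Rightarrow> 'b) \<Rightarrow> ('a \<Rightarrow> real) \<Rightarrow> (real \<Rightarrow> 'b measure) \<Rightarrow> bool" where
  "conditional_law M L Y Z K \<longleftrightarrow>
     K \<in> borel \<rightarrow>\<^sub>M prob_algebra L \<and>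
     (\<forall>B\<in>sets L. \<forall>C\<in>sets borel.
        emeasure M {\<omega> \<in> space M. Y \<omega> \<in> B \<and> Z \<omega> \<in> C} =
        (\<integral>\<^sup>+t\<in>C. emeasure (K t) B \<partial>distr M borel Z))"

text \<open>
  With \<open>K t\<close> the law \<open>PD(\<alpha>|t)\<close>, this is the mixture of the \<open>K t\<close> with mixing density
  \<open>exp (lam powr \<alpha>) * exp (- lam * t) * f t\<close> in \<open>t > 0\<close>.
\<close>

definition tilted_PD ::
  "real \<Rightarrow> real \<Rightarrow> (real \<Rightarrow> real) \<Rightarrow> (real \<Rightarrow> (nat \<Rightarrow> real) measure) \<Rightarrow> (nat \<Rightarrow> real) measure" where
  "tilted_PD \<alpha> lam f K =
     density lborel
       (\<lambda>t. ennreal (exp (lam powr \<alpha>) * exp (- lam * t) * f t) * indicator {0<..} t) \<bind> K"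


section \<open>Size-biased rearrangement\<close>

text \<open>
  Probability of picking index \<open>i\<close> once the indices in \<open>J\<close> have been removed; \<open>p\<close> has total
  mass one, so that \<open>1 - (\<Sum>m\<in>J. p m)\<close> is the remaining mass.
\<close>

definition pick_prob :: "(nat \<Rightarrow> real) \<Rightarrow> nat set \<Rightarrow> nat \<Rightarrow> real" where
  "pick_prob p J i = (if i \<in> J then 0 else p i / (1 - (\<Sum>m\<in>J. p m)))"

text \<open>
  \<open>I n\<close> is the index of the mass sampled at step \<open>n\<close> (steps are counted from 0). The last clause
  says that the conditional probability of \<open>I n = i\<close>, given the whole sequence \<open>P\<close> and the
  previous picks \<open>I 0, \<dots>, I (n - 1)\<close>, is \<open>pick_prob P {I 0, \<dots>, I (n - 1)} i\<close>. As picking goes on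
  forever, this presupposes that \<open>P\<close> almost surely has infinitely many nonzero masses.
\<close>

definition size_biased_rearrangement ::
  "'a measure \<Rightarrow> ('a \<Rightarrow> nat \<Rightarrow> real) \<Rightarrow> ('a \<Rightarrow> nat \<Rightarrow> real) \<Rightarrow> bool" where
  "size_biased_rearrangement N P Pt \<longleftrightarrow>
     (\<exists>I :: nat \<Rightarrow> 'a \<Rightarrow> nat.
        (\<forall>n. I n \<in> N \<rightarrow>\<^sub>M count_space UNIV) \<and>
        (\<forall>\<omega>\<in>space N. \<forall>n. Pt \<omega> n = P \<omega> (I n \<omega>)) \<and>
        (\<forall>B\<in>sets seq_space. \<forall>n (j :: nat \<Rightarrow> nat) i.
           emeasure N {\<omega> \<in> space N. (P \<omega> \<in> B \<and> (\<forall>m<n. I m \<omega> = j m)) \<and> I n \<omega> = i} =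
           (\<integral>\<^sup>+\<omega>\<in>{\<omega> \<in> space N. P \<omega> \<in> B \<and> (\<forall>m<n. I m \<omega> = j m)}.
              ennreal (pick_prob (P \<omega>) (j ` {..<n}) i) \<partial>N)))"


section \<open>The stick-breaking representation\<close>

definition beta_density :: "real \<Rightarrow> real \<Rightarrow> real \<Rightarrow> real" where
  "beta_density a b x =
     (if 0 < x \<and> x < 1 then x powr (a - 1) * (1 - x) powr (b - 1) / Beta a b else 0)"

text \<open>
  The sequences \<open>e\<close>, \<open>b\<close>, \<open>r\<close>, \<open>w\<close> below are indexed by \<open>k \<ge> 1\<close>; mass sequences are indexed from 0,
  so that the \<open>l\<close>-th mass, \<open>l \<ge> 1\<close>, is the entry with index \<open>l - 1\<close>.
\<close>

definition gamma_sum :: "(nat \<Rightarrow> real) \<Rightarrow> nat \<Rightarrow> real" where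
  "gamma_sum e k = (\<Sum>i=1..k. e i)"

definition R_seq :: "real \<Rightarrow> real \<Rightarrow> (nat \<Rightarrow> real) \<Rightarrow> nat \<Rightarrow> real" where
  "R_seq \<alpha> lam e k =
     ((gamma_sum e (k - 1) + lam powr \<alpha>) / (gamma_sum e k + lam powr \<alpha>)) powr (1 / \<alpha>)"

definition W_seq :: "(nat \<Rightarrow> real) \<Rightarrow> (nat \<Rightarrow> real) \<Rightarrow> nat \<Rightarrow> real" where
  "W_seq b r k = 1 - b k * (1 - r k)"

definition stick_breaking :: "(nat \<Rightarrow> real) \<Rightarrow> nat \<Rightarrow> real" where
  "stick_breaking w l = (1 - w (Suc l)) * (\<Prod>i=1..l. w i)"

end

theory Submission
  imports Defs
begin

text \<open>
  Let \<open>A\<close> be the ranked stable jumps and \<open>S\<close> their sum. Disintegrating along \<open>S\<close> shows that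
  the law \<open>tilted_PD\<close> is the image under normalization of the law of \<open>A\<close> reweighted by
  \<open>exp (lam powr \<alpha> - lam * S)\<close> (\<open>tilted_PD_eq\<close>), so both claims are about exponentially
  tilted jumps.

  The jumps enter only through their Laplace functional: the expectation of
  \<open>exp (- (\<Sum>k. g (A k)))\<close> is \<open>exp (- \<integral> (1 - exp (- g s)) * \<rho> s ds)\<close>. To see this, let \<open>\<mu>\<close> be
  the Stieltjes measure of a path, and note that summing \<open>g\<close> over the increments on the grid of
  mesh \<open>1/m\<close> amounts to integrating a function of the \<open>\<mu>\<close>-mass of the grid cell of \<open>t\<close> against
  \<open>\<mu>\<close>. As the cells shrink to points only the atoms of \<open>\<mu>\<close>, that is the jumps, survive
  (\<open>sum_of_increments_tendsto_sum_of_jumps\<close>). The increments are independent and identically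
  distributed, and \<open>m\<close> times the law of one of them converges to the Levy measure
  (\<open>small_increment_limit\<close>), which gives the functional (\<open>subordinator.poisson_jumps\<close>). The
  functional determines the law of the ranked jumps (\<open>ranked_law_unique\<close>), and tilting by
  \<open>exp (- lam * S)\<close> adds \<open>lam * s\<close> to \<open>g s\<close>, hence multiplies the Levy density by
  \<open>exp (- lam * s)\<close>: this is the first claim (\<open>exponentially_tilted_jumps\<close>).

  The derivative of the Laplace functional is the Mecke formula: a jump picked with weight equal
  to its size has the density \<open>s * \<rho> s\<close>, and the other jumps form an independent copy of the
  whole sequence (\<open>mecke_formula\<close>). Dividing by the total mass gives a size-biased pick. If the
  picked mass is a fraction \<open>p\<close> of the total and the other masses sum to \<open>S\<close>, the density of
  \<open>p\<close> contains
  \<open>S powr (- \<alpha>) * exp (- lam * S / (1 - p))\<close>. This is a mixture over \<open>x > lam / (1 - p)\<close> of the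
  exponentials \<open>exp (- x * S)\<close> with weight \<open>(x - lam / (1 - p)) powr (\<alpha> - 1)\<close>. Hence, given
  \<open>x\<close>, the remaining masses have the original form with the parameter \<open>x\<close> in place of \<open>lam\<close>,
  and the joint density of \<open>p\<close> and \<open>x\<close> is a constant times
  \<open>p powr (- \<alpha>) * ((1 - p) * x - lam) powr (\<alpha> - 1) * exp (lam powr \<alpha> - x powr \<alpha>)\<close>
  (\<open>tilted_picks_Cons\<close>). This is the density obtained from an exponential variable \<open>y\<close> and an
  independent Beta variable \<open>\<beta>\<close> by \<open>x powr \<alpha> = lam powr \<alpha> + y\<close> and
  \<open>p = \<beta> * (1 - lam / x)\<close>. Since \<open>lam / x\<close> is then \<open>R\<^sub>1\<close> and \<open>x powr \<alpha>\<close> takes the place of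
  \<open>lam powr \<alpha>\<close> in the next step, an induction on the number of picks gives the
  stick-breaking representation (\<open>tilted_picks_eq_sticks\<close>).
\<close>

section \<open>Laplace transforms determine measures\<close>

lemma real_polynomial_approx_unit_interval:
  fixes h :: "real \<Rightarrow> real"
  assumes "continuous_on {0..1} h" "0 < \<epsilon>"
  obtains a :: "nat \<Rightarrow> real" and d where "\<And>u. 0 \<le> u \<Longrightarrow> u \<le> 1 \<Longrightarrow> \<bar>h u - (\<Sum>i\<le>d. a i * u ^ i)\<bar> < \<epsilon>"
proof -
  obtain g where g: "real_polynomial_function g" "\<And>x. x \<in> {0..1} \<Longrightarrow> \<bar>h x - g x\<bar> < \<epsilon>"
    using Stone_Weierstrass_real_polynomial_function[of "{0..1}" h \<epsilon>] assms by auto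
  then obtain a d where "g = (\<lambda>x. \<Sum>i\<le>d. a i * x^i)"
    unfolding real_polynomial_function_iff_sum by auto
  with g that show ?thesis by auto
qed

text \<open>The substitution \<open>u = exp (- x)\<close> turns the integrals into moments of measures on the unit
  interval, where polynomials are uniformly dense. The absolute value keeps \<open>u\<close> in that interval
  also off the support.\<close>

lemma exp_integrals_determine_continuous:
  fixes \<mu> \<nu> :: "real measure" and h :: "real \<Rightarrow> real"
  assumes "finite_measure \<mu>" "finite_measure \<nu>"
    and [measurable_cong]: "sets \<mu> = sets borel" "sets \<nu> = sets borel"
    and pos: "AE x in \<mu>. 0 \<le> x" "AE x in \<nu>. 0 \<le> x"
    and eq: "\<And>n::nat. (\<integral>\<^sup>+x. ennreal (exp (- real n * x)) \<partial>\<mu>) = (\<integral>\<^sup>+x. ennreal (exp (- real n * x)) \<partial>\<nu>)"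
    and h: "continuous_on UNIV h"
  shows "(LINT x|\<mu>. h (exp (- \<bar>x\<bar>))) = (LINT x|\<nu>. h (exp (- \<bar>x\<bar>)))"
proof -
  interpret \<mu>: finite_measure \<mu> by fact
  interpret \<nu>: finite_measure \<nu> by fact
  have [measurable]: "h \<in> borel_measurable borel" using h by (rule borel_measurable_continuous_onI)
  have "bounded (h ` {0..1})" using h by (intro compact_imp_bounded compact_continuous_image) (auto intro: continuous_on_subset)
  then obtain B where B: "\<And>u. 0 \<le> u \<Longrightarrow> u \<le> 1 \<Longrightarrow> \<bar>h u\<bar> \<le> B" by (force simp: bounded_iff)
  have int_pow: "integrable \<mu> (\<lambda>x. exp (- \<bar>x\<bar>) ^ i)" "integrable \<nu> (\<lambda>x. exp (- \<bar>x\<bar>) ^ i)" for i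
    by (auto intro!: \<mu>.integrable_const_bound[of _ 1] \<nu>.integrable_const_bound[of _ 1] AE_I2 power_le_one)
  have int_h: "integrable \<mu> (\<lambda>x. h (exp (- \<bar>x\<bar>)))" "integrable \<nu> (\<lambda>x. h (exp (- \<bar>x\<bar>)))"
    by (auto intro!: \<mu>.integrable_const_bound[of _ B] \<nu>.integrable_const_bound[of _ B] AE_I2 B)
  have eq': "(LINT x|\<mu>. exp (- \<bar>x\<bar>) ^ i) = (LINT x|\<nu>. exp (- \<bar>x\<bar>) ^ i)" for i
  proof -
    have *: "(\<integral>\<^sup>+x. ennreal (exp (- \<bar>x\<bar>) ^ i) \<partial>\<mu>) = (\<integral>\<^sup>+x. ennreal (exp (- real i * x)) \<partial>\<mu>)"
      by (rule nn_integral_cong_AE, rule AE_mp[OF pos(1)]) (auto intro!: AE_I2 simp: exp_of_nat_mult [symmetric])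
    have **: "(\<integral>\<^sup>+x. ennreal (exp (- \<bar>x\<bar>) ^ i) \<partial>\<nu>) = (\<integral>\<^sup>+x. ennreal (exp (- real i * x)) \<partial>\<nu>)"
      by (rule nn_integral_cong_AE, rule AE_mp[OF pos(2)]) (auto intro!: AE_I2 simp: exp_of_nat_mult [symmetric])
    show ?thesis
      using eq[of i] by (subst (1 2) integral_eq_nn_integral) (simp_all add: * **)
  qed
  have "\<bar>(LINT x|\<mu>. h (exp (- \<bar>x\<bar>))) - (LINT x|\<nu>. h (exp (- \<bar>x\<bar>)))\<bar> \<le> 0"
  proof (rule field_le_epsilon)
    fix e :: real assume "0 < e"
    define \<epsilon> where "\<epsilon> = e / (1 + measure \<mu> (space \<mu>) + measure \<nu> (space \<nu>))"
    have "\<epsilon> > 0" using \<open>0 < e\<close> by (auto simp: \<epsilon>_def intro!: divide_pos_pos add_pos_nonneg)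
    obtain a d where a: "\<And>u. 0 \<le> u \<Longrightarrow> u \<le> 1 \<Longrightarrow> \<bar>h u - (\<Sum>i\<le>d. a i * u ^ i)\<bar> < \<epsilon>"
      using real_polynomial_approx_unit_interval[of h \<epsilon>] h \<open>0 < \<epsilon>\<close> continuous_on_subset[OF h] by (metis subset_UNIV)
    let ?p = "\<lambda>x. \<Sum>i\<le>d. a i * exp (- \<bar>x::real\<bar>) ^ i"
    have pe: "(LINT x|\<mu>. ?p x) = (LINT x|\<nu>. ?p x)"
      using int_pow by (simp add: eq')
    have ip: "integrable \<mu> ?p" "integrable \<nu> ?p" using int_pow by auto
    have b: "\<bar>(LINT x|m. h (exp (- \<bar>x\<bar>))) - (LINT x|m. ?p x)\<bar> \<le> \<epsilon> * measure m (space m)"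
      if "finite_measure m" "integrable m (\<lambda>x. h (exp (- \<bar>x\<bar>)))" "integrable m ?p" for m
    proof -
      interpret finite_measure m by fact
      have "\<bar>(LINT x|m. h (exp (- \<bar>x\<bar>))) - (LINT x|m. ?p x)\<bar> = \<bar>LINT x|m. (h (exp (- \<bar>x\<bar>)) - ?p x)\<bar>"
        using that by simp
      also have "\<dots> \<le> (LINT x|m. \<bar>h (exp (- \<bar>x\<bar>)) - ?p x\<bar>)" by (rule integral_abs_bound)
      also have "\<dots> \<le> (LINT x|m. \<epsilon>)"
        using that a by (intro integral_mono) (auto intro!: less_imp_le[OF a])
      finally show ?thesis by (simp add: mult.commute)
    qed
    have "\<bar>(LINT x|\<mu>. h (exp (- \<bar>x\<bar>))) - (LINT x|\<nu>. h (exp (- \<bar>x\<bar>)))\<bar>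
        \<le> \<epsilon> * measure \<mu> (space \<mu>) + \<epsilon> * measure \<nu> (space \<nu>)"
      using b[of \<mu>] b[of \<nu>] ip int_h assms(1,2) pe by linarith
    also have "\<dots> \<le> \<epsilon> * (1 + measure \<mu> (space \<mu>) + measure \<nu> (space \<nu>))"
      using \<open>0 < \<epsilon>\<close> by (simp add: algebra_simps)
    also have "\<dots> = e" unfolding \<epsilon>_def
      by (metis add_nonneg_eq_0_iff add_nonneg_nonneg measure_nonneg nonzero_eq_divide_eq zero_le_one zero_neq_one)
    finally show "\<bar>(LINT x|\<mu>. h (exp (- \<bar>x\<bar>))) - (LINT x|\<nu>. h (exp (- \<bar>x\<bar>)))\<bar> \<le> 0 + e" by simp
  qed
  then show ?thesis by simp
qed

text \<open>Ramps in \<open>exp (- \<bar>x\<bar>)\<close> converge to the indicators of the sets \<open>\<bar>x\<bar> \<le> c\<close>, so the masses of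
  the half-lines agree.\<close>

theorem laplace_transform_unique:
  fixes \<mu> \<nu> :: "real measure"
  assumes "finite_measure \<mu>" "finite_measure \<nu>"
    and S[measurable_cong]: "sets \<mu> = sets borel" "sets \<nu> = sets borel"
    and pos: "AE x in \<mu>. 0 \<le> x" "AE x in \<nu>. 0 \<le> x"
    and eq: "\<And>n::nat. (\<integral>\<^sup>+x. ennreal (exp (- real n * x)) \<partial>\<mu>) = (\<integral>\<^sup>+x. ennreal (exp (- real n * x)) \<partial>\<nu>)"
  shows "\<mu> = \<nu>"
proof -
  interpret \<mu>: finite_measure \<mu> by fact
  interpret \<nu>: finite_measure \<nu> by fact
  have sp: "space \<mu> = UNIV" "space \<nu> = UNIV" using S by (auto dest: sets_eq_imp_space_eq)
  (* 1 for u at least exp (- c), and for n > 0 equal to 0 once u is at most exp (- c) - 1 / n *)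
  define h where "h c n u = max 0 (min 1 (1 - real n * (exp (- c) - u)))" for c :: real and n :: nat and u :: real
  have lim: "(\<lambda>n. h c n (exp (-\<bar>x\<bar>))) \<longlonglongrightarrow> indicator {x. \<bar>x\<bar> \<le> c} x" for c x :: real
  proof (cases "\<bar>x\<bar> \<le> c")
    case True
    then have "h c n (exp (-\<bar>x\<bar>)) = 1" for n
      by (auto simp: h_def min_def max_def mult_nonneg_nonpos)
    with True show ?thesis by simp
  next
    case False
    then have d: "exp (-c) - exp (-\<bar>x\<bar>) > 0" by simp
    obtain n0 where n0: "1 < real n0 * (exp (-c) - exp (-\<bar>x\<bar>))" using ex_less_of_nat_mult[OF d] by auto
    have "h c n (exp (-\<bar>x\<bar>)) = 0" if "n \<ge> n0" for n
    proof -
      have "real n0 * (exp (-c) - exp (-\<bar>x\<bar>)) \<le> real n * (exp (-c) - exp (-\<bar>x\<bar>))"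
        using that d by (intro mult_right_mono) auto
      with n0 show ?thesis by (auto simp: h_def)
    qed
    then have "eventually (\<lambda>n. h c n (exp (-\<bar>x\<bar>)) = 0) sequentially" by (auto simp: eventually_sequentially)
    with False show ?thesis by (simp add: tendsto_eventually)
  qed
  have [measurable]: "h c n \<in> borel_measurable borel" for c n unfolding h_def by measurable
  have L: "(\<lambda>n. LINT x|m. h c n (exp (-\<bar>x\<bar>))) \<longlonglongrightarrow> measure m {x. \<bar>x\<bar> \<le> c}"
    if "finite_measure m" "sets m = sets borel" for c and m :: "real measure"
  proof -
    interpret finite_measure m by fact
    note that(2)[measurable_cong]
    have "(\<lambda>n. LINT x|m. h c n (exp (-\<bar>x\<bar>))) \<longlonglongrightarrow> (LINT x|m. indicator {x. \<bar>x\<bar> \<le> c} x)"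
      by (rule integral_dominated_convergence[where w = "\<lambda>_. 1"]) (auto simp: lim, auto simp: h_def)
    moreover have "space m = UNIV" using that(2) by (auto dest: sets_eq_imp_space_eq)
    ultimately show ?thesis by simp
  qed
  have c: "measure \<mu> {x. \<bar>x\<bar> \<le> c} = measure \<nu> {x. \<bar>x\<bar> \<le> c}" for c
  proof -
    have "(LINT x|\<mu>. h c n (exp (-\<bar>x\<bar>))) = (LINT x|\<nu>. h c n (exp (-\<bar>x\<bar>)))" for n
      by (rule exp_integrals_determine_continuous[OF assms]) (auto simp: h_def intro!: continuous_intros)
    with L[of \<mu> c] L[of \<nu> c] assms show ?thesis by (auto intro: LIMSEQ_unique)
  qed
  have eq: "emeasure \<mu> {..c} = emeasure \<nu> {..c}" for c
  proof -
    have "measure \<mu> {..c} = measure \<mu> {x. \<bar>x\<bar> \<le> c}"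
      using pos(1) by (intro \<mu>.finite_measure_eq_AE) auto
    moreover have "measure \<nu> {..c} = measure \<nu> {x. \<bar>x\<bar> \<le> c}"
      using pos(2) by (intro \<nu>.finite_measure_eq_AE) auto
    ultimately show ?thesis by (simp add: c \<mu>.emeasure_eq_measure \<nu>.emeasure_eq_measure)
  qed
  show ?thesis
  proof (rule measure_eqI_generator_eq[where E = "range (\<lambda>a::real. {..a})" and \<Omega> = UNIV and A = "\<lambda>n. {..real n}"])
    show "Int_stable (range (\<lambda>a::real. {..a}))" by (auto simp: Int_stable_def)
    show "(\<Union>i. {..real i}) = UNIV" by (auto intro: real_arch_simple)
    show "sets \<mu> = sigma_sets UNIV (range atMost)" "sets \<nu> = sigma_sets UNIV (range atMost)"
      using S by (auto simp: borel_eq_atMost)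
  qed (auto simp: eq)
qed

text \<open>One coordinate at a time, the exponential factor is traded for the indicator of a Borel set: the
  other factors are absorbed into a density, and the one-dimensional uniqueness theorem applies to
  the resulting law of that coordinate.\<close>

theorem seq_laplace_transform_unique:
  fixes \<mu> \<nu> :: "(nat \<Rightarrow> real) measure"
  assumes "finite_measure \<mu>" "finite_measure \<nu>"
    and S[measurable_cong]: "sets \<mu> = sets seq_space" "sets \<nu> = sets seq_space"
    and pos: "AE c in \<mu>. \<forall>i. 0 \<le> c i" "AE c in \<nu>. \<forall>i. 0 \<le> c i"
    and eq: "\<And>n (t :: nat \<Rightarrow> nat). (\<integral>\<^sup>+c. ennreal (exp (- (\<Sum>i<n. real (t i) * c i))) \<partial>\<mu>) =
               (\<integral>\<^sup>+c. ennreal (exp (- (\<Sum>i<n. real (t i) * c i))) \<partial>\<nu>)"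
  shows "\<mu> = \<nu>"
proof -
  interpret \<mu>: finite_measure \<mu> by fact
  interpret \<nu>: finite_measure \<nu> by fact
  (* coordinates below k are already tested by indicators, those from k on by exponentials *)
  define w where "w k n B t c = (\<Prod>i<k. indicator (B i) (c i)) * ennreal (exp (- (\<Sum>i\<in>{k..<n}. real (t i) * c i)))"
    for k n :: nat and B :: "nat \<Rightarrow> real set" and t :: "nat \<Rightarrow> nat" and c :: "nat \<Rightarrow> real"
  have key: "(\<integral>\<^sup>+c. w k n B t c \<partial>\<mu>) = (\<integral>\<^sup>+c. w k n B t c \<partial>\<nu>)"
    if "\<And>i. B i \<in> sets borel" "k \<le> n" for k n B t
    using that
  proof (induction k arbitrary: t)
    case 0
    then show ?case using eq[of t n] by (simp add: w_def atLeast0LessThan)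
  next
    case (Suc k)
    note [measurable] = Suc.prems(1)
    define v where "v c = (\<Prod>i<k. indicator (B i) (c i)) * ennreal (exp (- (\<Sum>i\<in>{Suc k..<n}. real (t i) * c i)))"
      for c :: "nat \<Rightarrow> real"
    have [measurable]: "v \<in> borel_measurable seq_space" unfolding v_def by measurable
    define push where "push m = distr (density m v) borel (\<lambda>c. c k)" for m
    have v1: "AE c in m. v c \<le> 1" if "AE c in m. \<forall>i. 0 \<le> c i" for m
      using that
    proof eventually_elim
      case (elim c)
      have "(\<Prod>i<k. indicator (B i) (c i) :: ennreal) \<le> 1"
        by (intro prod_le_1) (auto split: split_indicator)
      moreover have "ennreal (exp (- (\<Sum>i\<in>{Suc k..<n}. real (t i) * c i))) \<le> 1"
        using elim by (auto simp: ennreal_le_1 intro!: sum_nonneg mult_nonneg_nonneg)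
      ultimately show ?case unfolding v_def using mult_mono by fastforce
    qed
    have fin: "finite_measure (push m)" if "finite_measure m" "sets m = sets seq_space" "AE c in m. \<forall>i. 0 \<le> c i" for m
    proof -
      interpret finite_measure m by fact
      note that(2)[measurable_cong]
      have "(\<integral>\<^sup>+c. v c \<partial>m) \<le> (\<integral>\<^sup>+c. 1 \<partial>m)" using v1[OF that(3)] by (intro nn_integral_mono_AE) auto
      also have "\<dots> < \<infinity>" by (simp add: less_top[symmetric])
      finally show ?thesis unfolding push_def
        by (intro finite_measureI) (auto simp: emeasure_distr emeasure_density space_pair_measure  less_top
             intro!: nn_integral_cong split: split_indicator
             dest!: order.strict_trans1[rotated] cong: nn_integral_cong_simp)
    qed
    have val: "(\<integral>\<^sup>+x. f x \<partial>push m) = (\<integral>\<^sup>+c. v c * f (c k) \<partial>m)" if "sets m = sets seq_space" "f \<in> borel_measurable borel" for m f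
    proof -
      note that(1)[measurable_cong] that(2)[measurable]
      show ?thesis unfolding push_def by (simp add: nn_integral_distr nn_integral_density)
    qed
    have "push \<mu> = push \<nu>"
    proof (rule laplace_transform_unique)
      show "AE x in push \<mu>. 0 \<le> x" "AE x in push \<nu>. 0 \<le> x"
        using pos unfolding push_def by (auto simp: AE_distr_iff AE_density)
      fix m :: nat
      have *: "w k n B (t(k := m)) c = v c * ennreal (exp (- real m * c k))" for c
      proof -
        have "{k..<n} = insert k {Suc k..<n}" using Suc.prems by auto
        moreover have "(\<Sum>i\<in>{Suc k..<n}. real (if i = k then m else t i) * c i) = (\<Sum>i\<in>{Suc k..<n}. real (t i) * c i)"
          by (intro sum.cong) auto
        ultimately show ?thesis
          by (simp add: w_def v_def mult.assoc ennreal_mult[symmetric] exp_add[symmetric] add.commute)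
      qed
      show "(\<integral>\<^sup>+x. ennreal (exp (- real m * x)) \<partial>push \<mu>) = (\<integral>\<^sup>+x. ennreal (exp (- real m * x)) \<partial>push \<nu>)"
        using Suc.IH[of "t(k := m)"] Suc.prems(2) S unfolding * by (simp add: val Suc.prems(1))
    qed (use S fin assms in \<open>auto simp: push_def\<close>)
    then have "(\<integral>\<^sup>+x. indicator (B k) x \<partial>push \<mu>) = (\<integral>\<^sup>+x. indicator (B k) x \<partial>push \<nu>)" by simp
    then have "(\<integral>\<^sup>+c. v c * indicator (B k) (c k) \<partial>\<mu>) = (\<integral>\<^sup>+c. v c * indicator (B k) (c k) \<partial>\<nu>)"
      using S Suc.prems by (subst (asm) (1 2) val) auto
    moreover have "w (Suc k) n B t c = v c * indicator (B k) (c k)" for c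
      by (simp add: w_def v_def ac_simps)
    ultimately show ?case by simp
  qed
  show ?thesis
  proof (rule measure_eqI_PiM_infinite)
    show "sets \<mu> = sets seq_space" "sets \<nu> = sets seq_space" by fact+
    fix A :: "nat \<Rightarrow> real set" and J :: "nat set"
    assume J: "finite J" and A: "\<And>i. i \<in> J \<Longrightarrow> A i \<in> sets borel"
    define B where "B i = (if i \<in> J then A i else UNIV)" for i
    have B: "B i \<in> sets borel" for i using A by (auto simp: B_def)
    obtain n where n: "J \<subseteq> {..<n}" using finite_nat_bounded[OF J] by auto
    have ind: "w n n B (\<lambda>_. 0) c = indicator (prod_emb UNIV (\<lambda>_. borel) J (Pi\<^sub>E J A)) c" for c
    proof -
      have "w n n B (\<lambda>_. 0) c = (\<Prod>i<n. indicator (B i) (c i))" by (simp add: w_def)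
      also have "\<dots> = (if \<forall>i<n. c i \<in> B i then 1 else 0)"
        by (auto simp: indicator_def)
      also have "(\<forall>i<n. c i \<in> B i) \<longleftrightarrow> c \<in> prod_emb UNIV (\<lambda>_. borel) J (Pi\<^sub>E J A)"
        using n by (auto simp: B_def prod_emb_def PiE_iff space_PiM)
      finally show ?thesis by (auto simp: indicator_def)
    qed
    have [measurable]: "prod_emb UNIV (\<lambda>_. borel) J (Pi\<^sub>E J A) \<in> sets seq_space"
      using J A by (intro sets_PiM_I) auto
    show "emeasure \<mu> (prod_emb UNIV (\<lambda>_. borel) J (Pi\<^sub>E J A)) = emeasure \<nu> (prod_emb UNIV (\<lambda>_. borel) J (Pi\<^sub>E J A))"
      using key[of B n n "\<lambda>_. 0"] B by (simp add: ind)
  qed fact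
qed

section \<open>Increments and jumps of an increasing path\<close>

text \<open>The measure is the Stieltjes measure of the path stopped at time 1 and constant before time 0,
  whose atoms are the jumps.\<close>

lemma increasing_path_measure:
  fixes x :: "real \<Rightarrow> real"
  assumes mono: "mono_on {0..} x" and rc: "\<And>t. 0 \<le> t \<Longrightarrow> continuous (at_right t) x"
  obtains \<mu> where "finite_borel_measure \<mu>"
    "\<And>u v. 0 \<le> u \<Longrightarrow> u \<le> v \<Longrightarrow> v \<le> 1 \<Longrightarrow> measure \<mu> {u<..v} = x v - x u"
    "\<And>t. 0 < t \<Longrightarrow> t \<le> 1 \<Longrightarrow> jump x t = measure \<mu> {t}"
proof -
  define F where "F t = x (max 0 (min 1 t)) - x 0" for t
  have mF: "F s \<le> F t" if "s \<le> t" for s t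
    using that mono unfolding F_def by (auto intro!: mono_onD[OF mono])
  have rF: "continuous (at_right a) F" for a
  proof -
    consider "a < 0" | "0 \<le> a" "a < 1" | "1 \<le> a" by linarith
    then have "(F \<longlongrightarrow> F a) (at_right a)"
    proof cases
      case 1
      have "eventually (\<lambda>t. F t = F a) (at_right a)"
        using eventually_at_right_real[OF 1] by eventually_elim (use 1 in \<open>auto simp: F_def\<close>)
      then show ?thesis by (rule tendsto_eventually)
    next
      case 2
      have "((\<lambda>t. x t - x 0) \<longlongrightarrow> x a - x 0) (at_right a)"
        using rc[of a] 2 by (intro tendsto_intros) (auto simp: continuous_within)
      moreover have "eventually (\<lambda>t. x t - x 0 = F t) (at_right a)"
        using eventually_at_right_real[OF 2(2)] by eventually_elim (use 2 in \<open>auto simp: F_def\<close>)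
      ultimately show ?thesis using 2 by (auto simp: F_def intro: Lim_transform_eventually)
    next
      case 3
      have "eventually (\<lambda>t. F t = F a) (at_right a)"
        using eventually_at_right_real[of a "a + 1"] by (rule eventually_mono) (use 3 in \<open>auto simp: F_def\<close>)
      then show ?thesis by (rule tendsto_eventually)
    qed
    then show ?thesis by (simp add: continuous_within)
  qed
  have Fbot: "(F \<longlongrightarrow> 0) at_bot"
    by (rule tendsto_eventually) (auto simp: eventually_at_bot_linorder F_def intro!: exI[of _ 0])
  have Ftop: "(F \<longlongrightarrow> x 1 - x 0) at_top"
    by (rule tendsto_eventually) (auto simp: eventually_at_top_linorder F_def intro!: exI[of _ 1])
  have le: "0 \<le> x 1 - x 0" using mono_onD[OF mono, of 0 1] by simp
  let ?\<mu> = "interval_measure F"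
  interpret finite_borel_measure ?\<mu>
    by (rule finite_borel_measure_interval_measure[OF mF rF Fbot Ftop le])
  have cdf: "cdf ?\<mu> t = F t" for t
    unfolding cdf_def by (rule measure_interval_measure_Iic[OF mF rF Fbot])
  show thesis
  proof (rule that[of ?\<mu>])
    show "finite_borel_measure ?\<mu>" ..
    show "measure ?\<mu> {u<..v} = x v - x u" if "0 \<le> u" "u \<le> v" "v \<le> 1" for u v
      using that by (subst measure_interval_measure_Ioc[OF that(2) mF rF]) (auto simp: F_def)
    show "jump x t = measure ?\<mu> {t}" if t: "0 < t" "t \<le> 1" for t
    proof -
      have "((\<lambda>s. cdf ?\<mu> s + x 0) \<longlongrightarrow> measure ?\<mu> {..<t} + x 0) (at_left t)"
        by (intro tendsto_intros cdf_at_left)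
      moreover have "eventually (\<lambda>s. cdf ?\<mu> s + x 0 = x s) (at_left t)"
        using eventually_at_left_real[OF t(1)] by eventually_elim (use t in \<open>auto simp: cdf F_def\<close>)
      ultimately have "(x \<longlongrightarrow> measure ?\<mu> {..<t} + x 0) (at_left t)"
        by (rule Lim_transform_eventually)
      then have "Lim (at_left t) x = measure ?\<mu> {..<t} + x 0"
        by (intro tendsto_Lim) auto
      moreover have "x t = measure ?\<mu> {..t} + x 0" using cdf[of t] t by (simp add: cdf_def F_def)
      moreover have "measure ?\<mu> {..t} = measure ?\<mu> {..<t} + measure ?\<mu> {t}"
        unfolding ivl_disj_un(2)[symmetric] by (subst finite_measure_Union) auto
      ultimately show ?thesis by (simp add: jump_def)
    qed
  qed
qed

text \<open>Open on the left, since a right-continuous distribution function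
  measures half-open intervals of this kind.\<close>

definition cell :: "nat \<Rightarrow> nat \<Rightarrow> real set" where
  "cell m i = {real i / real m <.. real (Suc i) / real m}"

lemma cell_borel [measurable]: "cell m i \<in> sets borel"
  by (simp add: cell_def)

lemma cell_index: "t \<in> cell m i \<Longrightarrow> int i = \<lceil>real m * t\<rceil> - 1"
proof -
  assume t: "t \<in> cell m i"
  then have "m > 0" by (cases m) (auto simp: cell_def)
  with t have "real i < real m * t" "real m * t \<le> real i + 1"
    by (auto simp: cell_def field_simps)
  then show ?thesis by linarith
qed

lemma cell_unique: "t \<in> cell m i \<Longrightarrow> t \<in> cell m j \<Longrightarrow> i = j"
  by (metis cell_index of_nat_eq_iff)

lemma cell_exists:
  assumes "m > 0" "0 < t" "t \<le> 1"
  obtains i where "i < m" "t \<in> cell m i"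
proof -
  define i where "i = nat (\<lceil>real m * t\<rceil> - 1)"
  have "0 < real m * t" "real m * t \<le> real m" using assms by auto
  then have *: "real i < real m * t" "real m * t \<le> real i + 1" "i < m"
    unfolding i_def by linarith+
  then show ?thesis using that[of i] assms by (auto simp: cell_def field_simps)
qed

lemma cell_subset:
  assumes "i < m" shows "cell m i \<subseteq> {0<..1}"
proof -
  have "real (Suc i) / real m \<le> 1" "0 \<le> real i / real m" using assms by (auto simp: field_simps)
  then show ?thesis 
    unfolding cell_def by (metis greaterThanAtMost_iff le_less_trans order_trans subsetI)
qed

lemma sum_over_cells:
  fixes f :: "nat \<Rightarrow> 'b :: {semiring_1}"
  assumes "t \<in> cell m i" "i < m"
  shows "(\<Sum>j<m. f j * indicator (cell m j) t) = f i"
proof -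
  have "(\<Sum>j<m. f j * indicator (cell m j) t) = (\<Sum>j<m. if j = i then f j else 0)"
  proof (rule sum.cong[OF refl])
    fix j
    show "f j * indicator (cell m j) t = (if j = i then f j else 0)"
      using assms(1) cell_unique[OF assms(1), of j] by (cases "t \<in> cell m j") auto
  qed
  with assms show ?thesis by simp
qed

text \<open>Let \<open>\<mu>\<close> be the measure of the path. A grid increment is the mass of a cell, so the sum is
  the \<open>\<mu>\<close>-integral of \<open>\<phi>\<close> evaluated at the mass of the cell that contains \<open>t\<close>. That cell
  shrinks to \<open>t\<close>, so by dominated convergence the limit is the integral of \<open>\<phi>\<close> at the mass of
  the point \<open>t\<close>. As \<open>\<phi> 0 = 0\<close>, only the atoms contribute, and each atom contributes its mass
  times the value of \<open>\<phi>\<close> there.\<close>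

lemma sum_of_increments_tendsto_sum_of_jumps:
  fixes x \<phi> :: "real \<Rightarrow> real"
  assumes mono: "mono_on {0..} x" and rc: "\<And>t. 0 \<le> t \<Longrightarrow> continuous (at_right t) x"
    and a: "ranked_jumps x a"
    and \<phi>: "continuous_on UNIV \<phi>" "\<And>s. 0 \<le> \<phi> s" "\<And>s. \<phi> s \<le> C" "\<phi> 0 = 0"
  shows "summable a"
    and "(\<lambda>m. \<Sum>i<m. (x (real (Suc i) / real m) - x (real i / real m)) * \<phi> (x (real (Suc i) / real m) - x (real i / real m)))
          \<longlonglongrightarrow> (\<Sum>k. a k * \<phi> (a k))"
proof -
  obtain \<mu> where fb: "finite_borel_measure \<mu>"
    and Ioc: "\<And>u v. 0 \<le> u \<Longrightarrow> u \<le> v \<Longrightarrow> v \<le> 1 \<Longrightarrow> measure \<mu> {u<..v} = x v - x u"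
    and jump: "\<And>t. 0 < t \<Longrightarrow> t \<le> 1 \<Longrightarrow> jump x t = measure \<mu> {t}"
    using increasing_path_measure[OF mono rc] by blast
  interpret finite_borel_measure \<mu> by fact
  note M_is_borel[measurable_cong]
  have spU: "space \<mu> = UNIV" by (rule borel_UNIV)
  have [measurable]: "\<phi> \<in> borel_measurable borel" using \<phi>(1) by (rule borel_measurable_continuous_onI)
  obtain \<tau> where bij: "bij_betw \<tau> {k. 0 < a k} {t \<in> {0<..1}. 0 < jump x t}"
    and \<tau>: "\<And>k. 0 < a k \<Longrightarrow> a k = jump x (\<tau> k)" and a0: "\<And>k. 0 \<le> a k"
    using a unfolding ranked_jumps_def by auto
  have \<tau>01: "0 < \<tau> k" "\<tau> k \<le> 1" if "0 < a k" for k using bij that by (auto simp: bij_betw_def)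
  have inj: "k = l" if "0 < a k" "0 < a l" "\<tau> k = \<tau> l" for k l
    using bij_betw_imp_inj_on[OF bij] that by (auto dest: inj_onD)
  define A where "A k = (if 0 < a k then {\<tau> k} else {})" for k
  have mA: "measure \<mu> (A k) = a k" for k
    using a0[of k] \<tau>[of k] jump[of "\<tau> k"] \<tau>01[of k] by (auto simp: A_def)
  have disj: "disjoint_family A"
    using bij by (auto simp: disjoint_family_on_def A_def bij_betw_def inj_on_def)
  have [measurable]: "A k \<in> sets borel" for k by (simp add: A_def)
  show sum: "summable a"
  proof -
    have "(\<lambda>k. measure \<mu> (A k)) sums measure \<mu> (\<Union>k. A k)"
      using disj by (intro finite_measure_UNION) auto
    then show ?thesis by (simp add: mA sums_iff)
  qed
  have sum_g: "summable (\<lambda>k. a k * \<phi> (a k))"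
  proof (rule summable_comparison_test')
    show "summable (\<lambda>k. a k * C)" using sum by (rule summable_mult2)
    show "norm (a k * \<phi> (a k)) \<le> a k * C" for k
      using a0[of k] \<phi>(2,3)[of "a k"] by (simp add: abs_mult mult_left_mono)
  qed
  define \<Delta> where "\<Delta> m i = x (real (Suc i) / real m) - x (real i / real m)" for m i
  have \<Delta>: "measure \<mu> (cell m i) = \<Delta> m i" if "i < m" for m i
    unfolding cell_def \<Delta>_def using that by (intro Ioc) (simp_all add: divide_right_mono)
  have \<Delta>0: "0 \<le> \<Delta> m i" if "i < m" for m i using \<Delta>[OF that] by (metis measure_nonneg)
  (* the mass of the cell around t; below, E m is the indicator of that cell *)
  define D where "D m t = (\<Sum>i<m. \<Delta> m i * indicator (cell m i) t)" for m t
  have [measurable]: "D m \<in> borel_measurable borel" for m unfolding D_def by measurable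
  have D_lim: "(\<lambda>m. D m t) \<longlonglongrightarrow> measure \<mu> {t}" if t: "0 < t" "t \<le> 1" for t
  proof -
    define E :: "nat \<Rightarrow> real \<Rightarrow> real" where "E m s = (\<Sum>i<m. indicator (cell m i) s * indicator (cell m i) t)" for m s
    have DE: "D m t = (LINT s|\<mu>. E m s)" for m
    proof -
      have "(LINT s|\<mu>. E m s) = (\<Sum>i<m. LINT s|\<mu>. indicator (cell m i) s * indicator (cell m i) t)"
        unfolding E_def by (intro Bochner_Integration.integral_sum integrable_mult_left integrable_real_indicator)
          (simp_all add: emeasure_eq_measure)
      also have "\<dots> = D m t"
        unfolding D_def using \<Delta> by (intro sum.cong) (simp_all add: spU)
      finally show ?thesis ..
    qed
    have Elim: "(\<lambda>m. E m s) \<longlonglongrightarrow> indicator {t} s" for s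
    proof (cases "s = t")
      case True
      have "E m s = 1" if m: "m > 0" for m
      proof -
        obtain i where i: "i < m" "t \<in> cell m i" using cell_exists[OF m t] .
        show ?thesis unfolding E_def sum_over_cells[OF i(2,1)] using i True by simp
      qed
      then have "eventually (\<lambda>m. E m s = 1) sequentially" by (rule eventually_mono[OF eventually_gt_at_top[of 0]])
      with True show ?thesis by (simp add: tendsto_eventually)
    next
      case False
      then have "0 < \<bar>s - t\<bar>" by simp
      from ex_less_of_nat_mult[OF this, of 1] obtain m0 where m0: "1 < real m0 * \<bar>s - t\<bar>" ..
      have "E m s = 0" if m: "m > m0" for m
      proof -
        have "indicator (cell m i) s * indicator (cell m i) t = (0::real)" for i
        proof (rule ccontr)
          assume "indicator (cell m i) s * indicator (cell m i) t \<noteq> (0::real)"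
          then have "s \<in> cell m i" "t \<in> cell m i" by (auto simp: indicator_def split: if_splits)
          then have "\<bar>s - t\<bar> \<le> 1 / real m"
            unfolding cell_def greaterThanAtMost_iff of_nat_Suc add_divide_distrib by linarith
          then have "real m * \<bar>s - t\<bar> \<le> 1" using m
            by (simp add: pos_le_divide_eq mult.commute)
          moreover have "real m0 * \<bar>s - t\<bar> \<le> real m * \<bar>s - t\<bar>" using m by (intro mult_right_mono) auto
          ultimately show False using m0 by linarith
        qed
        then show ?thesis unfolding E_def by (intro sum.neutral ballI)
      qed
      then have "eventually (\<lambda>m. E m s = 0) sequentially" by (rule eventually_mono[OF eventually_gt_at_top[of m0]])
      with False show ?thesis by (simp add: tendsto_eventually)
    qed
    have Ebd: "\<bar>E m s\<bar> \<le> 1" for m s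
    proof (cases "\<exists>i<m. t \<in> cell m i")
      case True
      then obtain i where i: "i < m" "t \<in> cell m i" by auto
      have "E m s = indicator (cell m i) s"
        unfolding E_def by (rule sum_over_cells[OF i(2,1)])
      then show ?thesis by simp
    next
      case False
      then have "E m s = 0" unfolding E_def by (intro sum.neutral) auto
      then show ?thesis by simp
    qed
    have [measurable]: "E m \<in> borel_measurable borel" for m unfolding E_def by measurable
    have "(\<lambda>m. LINT s|\<mu>. E m s) \<longlonglongrightarrow> (LINT s|\<mu>. indicator {t} s)"
      by (rule integral_dominated_convergence[where w = "\<lambda>_. 1"]) (auto simp: Elim Ebd)
    then show ?thesis by (simp add: DE spU)
  qed
  have S1: "ennreal (\<Sum>i<m. \<Delta> m i * \<phi> (\<Delta> m i)) = (\<integral>\<^sup>+t. ennreal (\<phi> (D m t)) * indicator {0<..1} t \<partial>\<mu>)" if m: "m > 0" for m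
  proof -
    have "(\<integral>\<^sup>+t. ennreal (\<phi> (D m t)) * indicator {0<..1} t \<partial>\<mu>)
        = (\<integral>\<^sup>+t. (\<Sum>i<m. ennreal (\<phi> (\<Delta> m i)) * indicator (cell m i) t) \<partial>\<mu>)"
    proof (intro nn_integral_cong)
      fix t
      show "ennreal (\<phi> (D m t)) * indicator {0<..1} t = (\<Sum>i<m. ennreal (\<phi> (\<Delta> m i)) * indicator (cell m i) t)"
      proof (cases "0 < t \<and> t \<le> 1")
        case True
        then obtain i where i: "i < m" "t \<in> cell m i" using cell_exists[OF m] by blast
        show ?thesis unfolding D_def using True
          by (simp only: sum_over_cells[OF i(2,1)]) simp
      next
        case False
        then have "t \<notin> cell m i" if "i < m" for i using cell_subset[OF that] by auto
        with False show ?thesis by auto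
      qed
    qed
    also have "\<dots> = (\<Sum>i<m. ennreal (\<phi> (\<Delta> m i)) * emeasure \<mu> (cell m i))"
      by (subst nn_integral_sum) (auto simp: nn_integral_cmult)
    also have "\<dots> = (\<Sum>i<m. ennreal (\<Delta> m i * \<phi> (\<Delta> m i)))"
      by (intro sum.cong) (auto simp: emeasure_eq_measure \<Delta> ennreal_mult[symmetric] \<phi> \<Delta>0 mult.commute)
    also have "\<dots> = ennreal (\<Sum>i<m. \<Delta> m i * \<phi> (\<Delta> m i))"
      by (intro sum_ennreal) (auto simp: \<phi> \<Delta>0)
    finally show ?thesis by simp
  qed
  have lim_ind: "(\<lambda>m. ennreal (\<phi> (D m t)) * indicator {0<..1} t) \<longlonglongrightarrow> ennreal (\<phi> (measure \<mu> {t})) * indicator {0<..1} t" for t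
  proof (cases "0 < t \<and> t \<le> 1")
    case True
    then have "(\<lambda>m. \<phi> (D m t)) \<longlonglongrightarrow> \<phi> (measure \<mu> {t})"
      using \<phi>(1) by (intro continuous_on_tendsto_compose[OF \<phi>(1) D_lim]) auto
    with True show ?thesis by auto
  qed auto
  have S2: "ennreal (\<phi> (measure \<mu> {t})) * indicator {0<..1} t = (\<Sum>k. ennreal (\<phi> (a k)) * indicator (A k) t)" for t
  proof (cases "0 < t \<and> t \<le> 1 \<and> 0 < measure \<mu> {t}")
    case True
    then have "t \<in> {t \<in> {0<..1}. 0 < jump x t}" using jump by auto
    then have "t \<in> \<tau> ` {k. 0 < a k}" using bij_betw_imp_surj_on[OF bij] by simp
    then obtain k where k: "0 < a k" "\<tau> k = t" by auto
    have "(\<Sum>k. ennreal (\<phi> (a k)) * indicator (A k) t) = (\<Sum>k\<in>{k}. ennreal (\<phi> (a k)) * indicator (A k) t)"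
    proof (intro suminf_finite)
      fix l assume "l \<notin> {k}"
      then have "t \<notin> A l" using inj[of l k] k by (auto simp: A_def)
      then show "ennreal (\<phi> (a l)) * indicator (A l) t = 0" by simp
    qed simp
    then show ?thesis using True k \<tau>[of k] jump[of t] by (simp add: A_def)
  next
    case False
    have "t \<notin> A k" for k
    proof
      assume "t \<in> A k"
      then have "0 < a k" "t = \<tau> k" by (auto simp: A_def split: if_splits)
      then show False using False \<tau>[of k] \<tau>01[of k] jump[of t] by auto
    qed
    moreover have "ennreal (\<phi> (measure \<mu> {t})) * indicator {0<..1} t = 0"
      using False \<phi>(4) by (cases "measure \<mu> {t} = 0") (auto simp: less_le split: split_indicator)
    ultimately show ?thesis by simp
  qed
  have "(\<lambda>m. \<integral>\<^sup>+t. ennreal (\<phi> (D m t)) * indicator {0<..1} t \<partial>\<mu>) \<longlonglongrightarrow> (\<integral>\<^sup>+t. ennreal (\<phi> (measure \<mu> {t})) * indicator {0<..1} t \<partial>\<mu>)"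
  proof (rule nn_integral_dominated_convergence[where w = "\<lambda>_. ennreal C"])
    show "(\<lambda>t. ennreal (\<phi> (measure \<mu> {t})) * indicator {0<..1} t) \<in> borel_measurable \<mu>"
      unfolding S2 by measurable
    show "(\<integral>\<^sup>+ x. ennreal C \<partial>\<mu>) < \<infinity>" by (simp add: ennreal_mult_less_top emeasure_eq_measure)
  qed (auto simp: lim_ind \<phi> ennreal_leI split: split_indicator)
  also have "(\<integral>\<^sup>+t. ennreal (\<phi> (measure \<mu> {t})) * indicator {0<..1} t \<partial>\<mu>) = (\<Sum>k. ennreal (\<phi> (a k)) * emeasure \<mu> (A k))"
    unfolding S2 by (subst nn_integral_suminf) (auto simp: nn_integral_cmult)
  also have "\<dots> = (\<Sum>k. ennreal (a k * \<phi> (a k)))"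
    by (intro suminf_cong) (auto simp: emeasure_eq_measure mA ennreal_mult[symmetric] \<phi> a0 mult.commute)
  also have "\<dots> = ennreal (\<Sum>k. a k * \<phi> (a k))"
    using a0 \<phi> by (intro suminf_ennreal2 sum_g) simp_all
  finally have "(\<lambda>m. \<integral>\<^sup>+t. ennreal (\<phi> (D m t)) * indicator {0<..1} t \<partial>\<mu>) \<longlonglongrightarrow> ennreal (\<Sum>k. a k * \<phi> (a k))" .
  moreover have "eventually (\<lambda>m. (\<integral>\<^sup>+t. ennreal (\<phi> (D m t)) * indicator {0<..1} t \<partial>\<mu>) = ennreal (\<Sum>i<m. \<Delta> m i * \<phi> (\<Delta> m i))) sequentially"
    using eventually_gt_at_top[of 0] by eventually_elim (simp add: S1)
  ultimately have "(\<lambda>m. ennreal (\<Sum>i<m. \<Delta> m i * \<phi> (\<Delta> m i))) \<longlonglongrightarrow> ennreal (\<Sum>k. a k * \<phi> (a k))"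
    by (rule Lim_transform_eventually)
  moreover have "eventually (\<lambda>m. 0 \<le> (\<Sum>i<m. \<Delta> m i * \<phi> (\<Delta> m i))) sequentially"
    using \<phi> \<Delta>0 by (intro always_eventually allI sum_nonneg) simp
  moreover have "0 \<le> (\<Sum>k. a k * \<phi> (a k))"
    using a0 \<phi> by (intro suminf_nonneg sum_g) simp
  ultimately have "(\<lambda>m. \<Sum>i<m. \<Delta> m i * \<phi> (\<Delta> m i)) \<longlonglongrightarrow> (\<Sum>k. a k * \<phi> (a k))"
    by (simp add: tendsto_ennreal_iff)
  then show "(\<lambda>m. \<Sum>i<m. (x (real (Suc i) / real m) - x (real i / real m)) * \<phi> (x (real (Suc i) / real m) - x (real i / real m)))
          \<longlonglongrightarrow> (\<Sum>k. a k * \<phi> (a k))"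
    by (simp add: \<Delta>_def)
qed

section \<open>Small increments of a subordinator\<close>

lemma tendsto_one_minus_power_exp:
  fixes c :: "nat \<Rightarrow> real"
  assumes c: "c \<longlonglongrightarrow> l"
  shows "(\<lambda>m. (1 - c m / real m) ^ m) \<longlonglongrightarrow> exp (- l)"
proof (rule tendsto_sandwich)
  have y: "(\<lambda>m. c m / real m) \<longlonglongrightarrow> 0"
    using tendsto_mult[OF c lim_inverse_n] by (simp add: divide_inverse)
  then have ev: "eventually (\<lambda>m. c m / real m < 1 \<and> 0 < m) sequentially"
    using eventually_gt_at_top[of 0] by (intro eventually_conj order_tendstoD(2)) auto
  show "eventually (\<lambda>m. exp (- (c m / (1 - c m / real m))) \<le> (1 - c m / real m) ^ m) sequentially"
    using ev
  proof eventually_elim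
    case (elim m)
    define z where "z = c m / real m"
    have z: "z < 1" using elim by (simp add: z_def)
    have "inverse (1 - z) = 1 + z / (1 - z)" using z by (simp add: field_simps)
    also have "\<dots> \<le> exp (z / (1 - z))" by (rule exp_ge_add_one_self)
    finally have "inverse (exp (z / (1 - z))) \<le> 1 - z"
      using z by (metis diff_gt_0_iff_gt inverse_inverse_eq inverse_positive_iff_positive le_imp_inverse_le)
    then have "inverse (exp (z / (1 - z))) ^ m \<le> (1 - z) ^ m" by (intro power_mono) auto
    moreover have "inverse (exp (z / (1 - z))) ^ m = exp (- (c m / (1 - z)))"
    proof -
      have "inverse (exp (z / (1 - z))) ^ m = exp (real m * (- (z / (1 - z))))"
        by (simp only: exp_of_nat_mult exp_minus)
      also have "real m * (- (z / (1 - z))) = - (c m / (1 - z))" using elim by (simp add: z_def)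
      finally show ?thesis .
    qed
    ultimately show ?case by (simp add: z_def)
  qed
  show "eventually (\<lambda>m. (1 - c m / real m) ^ m \<le> exp (- c m)) sequentially"
    using ev
  proof eventually_elim
    case (elim m)
    have "(1 - c m / real m) ^ m \<le> exp (- (c m / real m)) ^ m"
      using elim exp_ge_add_one_self[of "- (c m / real m)"] by (intro power_mono) auto
    also have "\<dots> = exp (- c m)" using elim by (simp add: exp_of_nat_mult[symmetric])
    finally show ?case .
  qed
  show "(\<lambda>m. exp (- (c m / (1 - c m / real m)))) \<longlonglongrightarrow> exp (- l)"
  proof -
    have "(\<lambda>m. exp (- (c m / (1 - c m / real m)))) \<longlonglongrightarrow> exp (- (l / (1 - 0)))"
      by (intro tendsto_intros c y) simp
    then show ?thesis by simp
  qed
  show "(\<lambda>m. exp (- c m)) \<longlonglongrightarrow> exp (- l)" by (intro tendsto_intros c)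
qed

text \<open>First order asymptotics of \<open>1 - exp (- y)\<close> at \<open>y = 0\<close>, in the form in which it differentiates
  a Laplace transform along a sequence.\<close>

lemma tendsto_times_one_minus_exp:
  fixes r y :: "nat \<Rightarrow> real"
  assumes r: "\<And>n. 0 \<le> r n" and y: "\<And>n. 0 \<le> y n" "y \<longlonglongrightarrow> 0" and ry: "(\<lambda>n. r n * y n) \<longlonglongrightarrow> l"
  shows "(\<lambda>n. r n * (1 - exp (- y n))) \<longlonglongrightarrow> l"
proof (rule tendsto_sandwich)
  have "y n / (1 + y n) \<le> 1 - exp (- y n)" for n
  proof -
    have "inverse (exp (y n)) \<le> inverse (1 + y n)"
      using y(1)[of n] by (intro le_imp_inverse_le exp_ge_add_one_self) auto
    also have "inverse (1 + y n) = 1 - y n / (1 + y n)" using y(1)[of n] by (simp add: field_simps)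
    finally show ?thesis by (simp add: exp_minus)
  qed
  then show "eventually (\<lambda>n. r n * (y n / (1 + y n)) \<le> r n * (1 - exp (- y n))) sequentially"
    using r by (intro always_eventually allI mult_left_mono) auto
  show "eventually (\<lambda>n. r n * (1 - exp (- y n)) \<le> r n * y n) sequentially"
    using r exp_ge_add_one_self[of "- y _"] by (intro always_eventually allI mult_left_mono) (auto simp: algebra_simps)
  have "(\<lambda>n. r n * y n / (1 + y n)) \<longlonglongrightarrow> l / (1 + 0)"
    by (intro tendsto_intros ry y) simp
  then show "(\<lambda>n. r n * (y n / (1 + y n))) \<longlonglongrightarrow> l" by simp
qed fact

lemma one_minus_exp_bounds:
  fixes s :: real assumes "0 \<le> s" shows "0 \<le> 1 - exp (- s)" "1 - exp (- s) \<le> s" "1 - exp (- s) \<le> min 1 s"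
  using assms exp_ge_add_one_self[of "- s"] by auto

lemma one_minus_exp_le_min:
  fixes s x C :: real
  assumes "0 \<le> s" "0 \<le> x" "x \<le> C * s"
  shows "\<bar>1 - exp (- x)\<bar> \<le> max 1 C * min 1 s"
proof -
  have "min 1 x \<le> max 1 C * min 1 s"
  proof (cases "s \<le> 1")
    case True
    have "C * s \<le> max 1 C * min 1 s" using True assms(1) by (simp add: min_def mult_right_mono)
    with assms(3) show ?thesis by (intro min.coboundedI2) (rule order_trans)
  next
    case False
    then show ?thesis by (intro min.coboundedI1) auto
  qed
  with one_minus_exp_bounds[OF assms(2)] show ?thesis by linarith
qed

locale levy_density =
  fixes \<rho> :: "real \<Rightarrow> real"
  assumes density_measurable [measurable]: "\<rho> \<in> borel_measurable borel"
    and density_nonneg: "\<And>s. 0 < s \<Longrightarrow> 0 \<le> \<rho> s"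
    and density_integrable: "set_integrable lborel {0<..} (\<lambda>s. min 1 s * \<rho> s)"
begin

lemma integrable_dominated:
  fixes k :: "real \<Rightarrow> real"
  assumes [measurable]: "k \<in> borel_measurable borel" and bd: "\<And>s. 0 < s \<Longrightarrow> \<bar>k s\<bar> \<le> C * min 1 s"
  shows "set_integrable lborel {0<..} (\<lambda>s. k s * \<rho> s)"
proof -
  have "set_integrable lborel {0<..} (\<lambda>s. C * (min 1 s * \<rho> s))"
    using density_integrable by (rule set_integrable_mult_right)
  then show ?thesis unfolding set_integrable_def
  proof (rule Bochner_Integration.integrable_bound)
    show "AE s in lborel. norm (indicat_real {0<..} s *\<^sub>R (k s * \<rho> s)) \<le> norm (indicat_real {0<..} s *\<^sub>R (C * (min 1 s * \<rho> s)))"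
    proof (rule AE_I2)
      fix s :: real
      show "norm (indicat_real {0<..} s *\<^sub>R (k s * \<rho> s)) \<le> norm (indicat_real {0<..} s *\<^sub>R (C * (min 1 s * \<rho> s)))"
      proof (cases "0 < s")
        case True
        then have "\<bar>k s\<bar> * \<bar>\<rho> s\<bar> \<le> \<bar>C * min 1 s\<bar> * \<bar>\<rho> s\<bar>"
          using bd[OF True] by (intro mult_right_mono) auto
        then show ?thesis using True by (simp add: abs_mult)
      qed simp
    qed
  qed simp
qed

definition levy_integral :: "(real \<Rightarrow> real) \<Rightarrow> real" where
  "levy_integral k = (LINT s:{0<..}|lborel. k s * \<rho> s)"

lemma levy_integral_diff:
  assumes "set_integrable lborel {0<..} (\<lambda>s. k s * \<rho> s)" "set_integrable lborel {0<..} (\<lambda>s. l s * \<rho> s)"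
  shows "levy_integral (\<lambda>s. k s - l s) = levy_integral k - levy_integral l"
  unfolding levy_integral_def left_diff_distrib using assms by (rule set_integral_diff)

lemma levy_integral_cong: "(\<And>s. 0 < s \<Longrightarrow> k s = l s) \<Longrightarrow> levy_integral k = levy_integral l"
  unfolding levy_integral_def by (intro set_lebesgue_integral_cong) auto

lemma levy_integral_nonneg: "(\<And>s. 0 < s \<Longrightarrow> 0 \<le> k s) \<Longrightarrow> 0 \<le> levy_integral k"
  unfolding levy_integral_def set_lebesgue_integral_def
  by (intro integral_nonneg_AE AE_I2) (auto simp: density_nonneg split: split_indicator)

lemma levy_integral_mono_abs:
  assumes "set_integrable lborel {0<..} (\<lambda>s. k s * \<rho> s)" "set_integrable lborel {0<..} (\<lambda>s. l s * \<rho> s)"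
    and "\<And>s. 0 < s \<Longrightarrow> \<bar>k s\<bar> \<le> l s"
  shows "\<bar>levy_integral k\<bar> \<le> levy_integral l"
proof -
  have "\<bar>levy_integral k\<bar> \<le> (LINT s|lborel. \<bar>indicat_real {0<..} s *\<^sub>R (k s * \<rho> s)\<bar>)"
    unfolding levy_integral_def set_lebesgue_integral_def by (rule integral_abs_bound)
  also have "\<dots> \<le> levy_integral l"
    unfolding levy_integral_def set_lebesgue_integral_def
  proof (intro integral_mono)
    fix s :: real
    show "\<bar>indicat_real {0<..} s *\<^sub>R (k s * \<rho> s)\<bar> \<le> indicat_real {0<..} s *\<^sub>R (l s * \<rho> s)"
      using assms(3)[of s] density_nonneg[of s]
      by (auto simp: abs_mult mult_right_mono split: split_indicator)
  qed (use assms in \<open>auto simp: set_integrable_def\<close>)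
  finally show ?thesis .
qed

lemma levy_integral_tendsto:
  assumes [measurable]: "\<And>n. k n \<in> borel_measurable borel" "l \<in> borel_measurable borel"
    and bd: "\<And>n s. 0 < s \<Longrightarrow> \<bar>k n s\<bar> \<le> C * min 1 s"
    and lim: "\<And>s. 0 < s \<Longrightarrow> (\<lambda>n. k n s) \<longlonglongrightarrow> l s"
  shows "(\<lambda>n. levy_integral (k n)) \<longlonglongrightarrow> levy_integral l"
  unfolding levy_integral_def set_lebesgue_integral_def
proof (rule integral_dominated_convergence)
  have C: "0 \<le> C" using bd[of 1 0] by auto
  show "integrable lborel (\<lambda>s. indicat_real {0<..} s *\<^sub>R ((C * min 1 s) * \<rho> s))"
    using integrable_dominated[of "\<lambda>s. C * min 1 s" C] C by (auto simp: set_integrable_def abs_mult)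
  show "AE s in lborel. (\<lambda>n. indicat_real {0<..} s *\<^sub>R (k n s * \<rho> s)) \<longlonglongrightarrow> indicat_real {0<..} s *\<^sub>R (l s * \<rho> s)"
    by (intro AE_I2) (auto intro!: tendsto_intros lim split: split_indicator)
  show "AE s in lborel. norm (indicat_real {0<..} s *\<^sub>R (k n s * \<rho> s)) \<le> indicat_real {0<..} s *\<^sub>R (C * min 1 s * \<rho> s)" for n
    using bd density_nonneg by (intro AE_I2) (auto simp: abs_mult intro!: mult_right_mono split: split_indicator)
qed measurable

end

text \<open>By its Laplace functional, \<open>A\<close> enumerates the points of a Poisson process with intensity \<open>\<rho>\<close>.
  The functional is required only for continuous test functions that vanish near 0 and near
  infinity, because these are the ones that the increments of a subordinator reach directly; it
  extends to the functions needed later by dominated convergence.\<close>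

locale poisson_jumps = prob_space M + levy_density \<rho>
  for M :: "'a measure" and A :: "'a \<Rightarrow> nat \<Rightarrow> real" and \<rho> :: "real \<Rightarrow> real" +
  assumes jumps_measurable [measurable]: "A \<in> M \<rightarrow>\<^sub>M seq_space"
    and jumps_ranked: "AE \<omega> in M. decseq (A \<omega>) \<and> (\<forall>k. 0 \<le> A \<omega> k) \<and> summable (A \<omega>)"
    and laplace_functional_compact: "\<And>g \<delta> K. continuous_on UNIV g \<Longrightarrow> (\<And>s. 0 \<le> g s) \<Longrightarrow> 0 < \<delta> \<Longrightarrow>
       (\<And>s. s \<le> \<delta> \<Longrightarrow> g s = 0) \<Longrightarrow> (\<And>s. K \<le> s \<Longrightarrow> g s = 0) \<Longrightarrow>
       expectation (\<lambda>\<omega>. exp (- (\<Sum>k. g (A \<omega> k)))) = exp (- levy_integral (\<lambda>s. 1 - exp (- g s)))"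

context subordinator
begin

interpretation levy_density \<rho>
  using levy_density_measurable levy_density_nonneg levy_density_integrable by unfold_locales

definition \<Phi> :: "real \<Rightarrow> real" where "\<Phi> \<theta> = levy_integral (\<lambda>s. 1 - exp (- \<theta> * s))"

lemma \<Phi>_integrable: "0 \<le> \<theta> \<Longrightarrow> set_integrable lborel {0<..} (\<lambda>s. (1 - exp (- \<theta> * s)) * \<rho> s)"
proof (rule integrable_dominated[where C = "max 1 \<theta>"])
  fix s :: real assume "0 \<le> \<theta>" "0 < s"
  then show "\<bar>1 - exp (- \<theta> * s)\<bar> \<le> max 1 \<theta> * min 1 s"
    using one_minus_exp_le_min[of s "\<theta> * s" \<theta>] by simp
qed simp

lemma \<Phi>_nonneg: "0 \<le> \<theta> \<Longrightarrow> 0 \<le> \<Phi> \<theta>"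
  unfolding \<Phi>_def by (rule levy_integral_nonneg) simp

lemma laplace_X: "0 \<le> t \<Longrightarrow> 0 \<le> \<theta> \<Longrightarrow> expectation (\<lambda>\<omega>. exp (- \<theta> * X t \<omega>)) = exp (- t * \<Phi> \<theta>)"
  using laplace_exponent unfolding \<Phi>_def levy_integral_def by simp

lemma X_nonneg: "0 \<le> t \<Longrightarrow> AE \<omega> in M. 0 \<le> X t \<omega>"
  using starts_at_0 paths by eventually_elim (auto dest: mono_onD[of _ _ 0 t])

text \<open>For \<open>h u = u ^ i\<close> the expectation is a difference of two values of the Laplace transform of the
  increment, so the limit is a difference of two Laplace exponents. Since the weights
  \<open>m * E (1 - exp (- X (1 / m)))\<close> are at most \<open>\<Phi> 1\<close>, uniform approximation of \<open>h\<close> by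
  polynomials carries the limit over to continuous functions.\<close>

lemma small_increment_limit:
  fixes h :: "real \<Rightarrow> real"
  assumes h: "continuous_on UNIV h"
  shows "(\<lambda>m. real m * expectation (\<lambda>\<omega>. (1 - exp (- X (1 / real m) \<omega>)) * h (exp (- X (1 / real m) \<omega>))))
      \<longlonglongrightarrow> levy_integral (\<lambda>s. (1 - exp (- s)) * h (exp (- s)))"
proof -
  have [measurable]: "h \<in> borel_measurable borel" using h by (rule borel_measurable_continuous_onI)
  have [measurable]: "X (1 / real m) \<in> borel_measurable M" for m by (rule random_variable_X) simp
  define I where "I f m = expectation (\<lambda>\<omega>. (1 - exp (- X (1 / real m) \<omega>)) * f (exp (- X (1 / real m) \<omega>)))" for f m
  define J where "J f = levy_integral (\<lambda>s. (1 - exp (- s)) * f (exp (- s)))" for f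
  have intI: "integrable M (\<lambda>\<omega>. (1 - exp (- X (1 / real m) \<omega>)) * f (exp (- X (1 / real m) \<omega>)))"
    if [measurable]: "f \<in> borel_measurable borel" and f: "\<And>u. 0 \<le> u \<Longrightarrow> u \<le> 1 \<Longrightarrow> \<bar>f u\<bar> \<le> B" for f B m
  proof (rule integrable_const_bound[where B = B])
    show "AE \<omega> in M. norm ((1 - exp (- X (1 / real m) \<omega>)) * f (exp (- X (1 / real m) \<omega>))) \<le> B"
    proof (rule AE_mp[OF X_nonneg[of "1 / real m"]], simp, intro AE_I2 impI)
      fix \<omega> assume elim: "0 \<le> X (1 / real m) \<omega>"
      then have "\<bar>1 - exp (- X (1 / real m) \<omega>)\<bar> * \<bar>f (exp (- X (1 / real m) \<omega>))\<bar> \<le> 1 * B"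
        by (intro mult_mono f) auto
      then show "norm ((1 - exp (- X (1 / real m) \<omega>)) * f (exp (- X (1 / real m) \<omega>))) \<le> B" by (simp add: abs_mult)
    qed
  qed simp
  have intJ: "set_integrable lborel {0<..} (\<lambda>s. (1 - exp (- s)) * f (exp (- s)) * \<rho> s)"
    if [measurable]: "f \<in> borel_measurable borel" and f: "\<And>u. 0 \<le> u \<Longrightarrow> u \<le> 1 \<Longrightarrow> \<bar>f u\<bar> \<le> B" for f B
  proof (rule integrable_dominated[where C = B])
    fix s :: real assume s: "0 < s"
    have "\<bar>1 - exp (- s)\<bar> * \<bar>f (exp (- s))\<bar> \<le> min 1 s * B"
      using s one_minus_exp_bounds[of s] by (intro mult_mono f) auto
    then show "\<bar>(1 - exp (- s)) * f (exp (- s))\<bar> \<le> B * min 1 s" by (simp add: abs_mult mult.commute)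
  qed simp
  have pow: "(\<lambda>m. real m * I (\<lambda>u. u ^ i) m) \<longlonglongrightarrow> J (\<lambda>u. u ^ i)" for i
  proof -
    have intp: "integrable M (\<lambda>\<omega>. exp (- real i * X (1 / real m) \<omega>))" for m i
    proof (rule integrable_const_bound[where B = 1])
      show "AE \<omega> in M. norm (exp (- real i * X (1 / real m) \<omega>)) \<le> 1"
        by (rule AE_mp[OF X_nonneg[of "1 / real m"]]) (auto intro!: AE_I2)
    qed simp
    have split: "(1 - exp (- x)) * exp (- x) ^ i = exp (- real i * x) - exp (- real (Suc i) * x)" for x :: real
      unfolding exp_of_nat_mult[symmetric] by (simp add: algebra_simps exp_add[symmetric])
    have I: "I (\<lambda>u. u ^ i) m = exp (- (\<Phi> (real i) / real m)) - exp (- (\<Phi> (real (Suc i)) / real m))" for m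
    proof -
      have "I (\<lambda>u. u ^ i) m = expectation (\<lambda>\<omega>. exp (- real i * X (1 / real m) \<omega>) - exp (- real (Suc i) * X (1 / real m) \<omega>))"
        unfolding I_def split ..
      also have "\<dots> = expectation (\<lambda>\<omega>. exp (- real i * X (1 / real m) \<omega>)) - expectation (\<lambda>\<omega>. exp (- real (Suc i) * X (1 / real m) \<omega>))"
        by (rule Bochner_Integration.integral_diff) (rule intp)+
      also have "\<dots> = exp (- (\<Phi> (real i) / real m)) - exp (- (\<Phi> (real (Suc i)) / real m))"
        by (subst (1 2) laplace_X) auto
      finally show ?thesis .
    qed
    have lin: "(\<lambda>m. real m * (1 - exp (- (a / real m)))) \<longlonglongrightarrow> a" if "0 \<le> a" for a
    proof (rule tendsto_times_one_minus_exp)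
      show "(\<lambda>m. a / real m) \<longlonglongrightarrow> 0" by (rule lim_const_over_n)
      have "eventually (\<lambda>m. a = real m * (a / real m)) sequentially"
        by (rule eventually_mono[OF eventually_gt_at_top[of 0]]) simp
      then show "(\<lambda>m. real m * (a / real m)) \<longlonglongrightarrow> a"
        by (rule Lim_transform_eventually[OF tendsto_const])
    qed (use that in auto)
    have "(\<lambda>m. real m * (1 - exp (- (\<Phi> (real (Suc i)) / real m))) - real m * (1 - exp (- (\<Phi> (real i) / real m))))
        \<longlonglongrightarrow> \<Phi> (real (Suc i)) - \<Phi> (real i)"
      by (intro tendsto_diff lin \<Phi>_nonneg) auto
    moreover have "\<Phi> (real (Suc i)) - \<Phi> (real i) = J (\<lambda>u. u ^ i)"
      unfolding \<Phi>_def J_def split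
      by (subst levy_integral_diff[symmetric, OF \<Phi>_integrable \<Phi>_integrable]) auto
    ultimately show ?thesis by (simp add: I algebra_simps)
  qed
  have I_le: "real m * I (\<lambda>_. 1) m \<le> \<Phi> 1" if "m > 0" for m
  proof -
    have "I (\<lambda>_. 1) m = 1 - exp (- (\<Phi> 1 / real m))"
    proof -
      have "integrable M (\<lambda>\<omega>. 1 - exp (- X (1 / real m) \<omega>))" using intI[of "\<lambda>_. 1" 1 m] by simp
      then have "expectation (\<lambda>\<omega>. 1 - (1 - exp (- X (1 / real m) \<omega>))) = 1 - I (\<lambda>_. 1) m"
        unfolding I_def by (subst Bochner_Integration.integral_diff) (auto simp: prob_space)
      then show ?thesis using laplace_X[of "1 / real m" 1] by simp
    qed
    then have "I (\<lambda>_. 1) m \<le> \<Phi> 1 / real m"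
      using one_minus_exp_bounds[of "\<Phi> 1 / real m"] \<Phi>_nonneg[of 1] by simp
    then show ?thesis using that by (simp add: field_simps)
  qed
  have J1: "J (\<lambda>_. 1) = \<Phi> 1" by (simp add: J_def \<Phi>_def)
  obtain B where B: "\<And>u. 0 \<le> u \<Longrightarrow> u \<le> 1 \<Longrightarrow> \<bar>h u\<bar> \<le> B"
  proof -
    have "bounded (h ` {0..1})" using h by (intro compact_imp_bounded compact_continuous_image) (auto intro: continuous_on_subset)
    then show ?thesis using that by (force simp: bounded_iff)
  qed
  have "(\<lambda>m. real m * I h m) \<longlonglongrightarrow> J h"
  proof (rule LIMSEQ_I)
    fix r :: real assume "0 < r"
    define \<epsilon> where "\<epsilon> = r / (3 * (\<Phi> 1 + 1))"
    have \<epsilon>: "0 < \<epsilon>" using \<open>0 < r\<close> \<Phi>_nonneg[of 1] by (simp add: \<epsilon>_def)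
    have \<epsilon>\<Phi>: "\<epsilon> * \<Phi> 1 < r / 3"
    proof -
      have "\<epsilon> * \<Phi> 1 < \<epsilon> * (\<Phi> 1 + 1)" using \<epsilon> by simp
      also have "\<dots> = r / 3" using \<Phi>_nonneg[of 1] by (simp add: \<epsilon>_def field_simps)
      finally show ?thesis .
    qed
    obtain a d where p: "\<And>u. 0 \<le> u \<Longrightarrow> u \<le> 1 \<Longrightarrow> \<bar>h u - (\<Sum>i\<le>d. a i * u ^ i)\<bar> < \<epsilon>"
      using real_polynomial_approx_unit_interval[of h \<epsilon>] h \<epsilon> continuous_on_subset[OF h] by (metis subset_UNIV)
    define p where "p u = (\<Sum>i\<le>d. a i * u ^ i)" for u :: real
    have pb: "\<bar>h u - p u\<bar> \<le> \<epsilon>" if "0 \<le> u" "u \<le> 1" for u using p[OF that] by (simp add: p_def)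
    have [measurable]: "p \<in> borel_measurable borel" unfolding p_def by measurable
    have pB: "\<bar>p u\<bar> \<le> B + \<epsilon>" if "0 \<le> u" "u \<le> 1" for u using pb[OF that] B[OF that] by linarith
    have powb: "\<bar>u ^ i\<bar> \<le> 1" if "0 \<le> u" "u \<le> 1" for u :: real and i
      using that by (simp add: power_le_one)
    have Ip: "I p m = (\<Sum>i\<le>d. a i * I (\<lambda>u. u ^ i) m)" for m
    proof -
      have "I p m = expectation (\<lambda>\<omega>. \<Sum>i\<le>d. a i * ((1 - exp (- X (1 / real m) \<omega>)) * exp (- X (1 / real m) \<omega>) ^ i))"
        unfolding I_def p_def sum_distrib_left by (intro Bochner_Integration.integral_cong refl sum.cong) simp
      also have "\<dots> = (\<Sum>i\<le>d. expectation (\<lambda>\<omega>. a i * ((1 - exp (- X (1 / real m) \<omega>)) * exp (- X (1 / real m) \<omega>) ^ i)))"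
        by (intro Bochner_Integration.integral_sum integrable_mult_right intI[of "\<lambda>u. u ^ _" 1 m] powb) measurable
      finally show ?thesis unfolding I_def by simp
    qed
    have Jp: "J p = (\<Sum>i\<le>d. a i * J (\<lambda>u. u ^ i))"
    proof -
      have "J p = (LINT s|lborel. (\<Sum>i\<le>d. a i * (indicat_real {0<..} s *\<^sub>R ((1 - exp (- s)) * exp (- s) ^ i * \<rho> s))))"
        unfolding J_def levy_integral_def set_lebesgue_integral_def p_def sum_distrib_left sum_distrib_right scaleR_sum_right
        by (intro Bochner_Integration.integral_cong refl sum.cong) simp
      also have "\<dots> = (\<Sum>i\<le>d. (LINT s|lborel. a i * (indicat_real {0<..} s *\<^sub>R ((1 - exp (- s)) * exp (- s) ^ i * \<rho> s))))"
        by (intro Bochner_Integration.integral_sum integrable_mult_right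
            intJ[of "\<lambda>u. u ^ _" 1, unfolded set_integrable_def] powb) measurable
      finally show ?thesis unfolding J_def levy_integral_def set_lebesgue_integral_def by simp
    qed
    have "(\<lambda>m. \<Sum>i\<le>d. a i * (real m * I (\<lambda>u. u ^ i) m)) \<longlonglongrightarrow> (\<Sum>i\<le>d. a i * J (\<lambda>u. u ^ i))"
      by (intro tendsto_sum tendsto_mult tendsto_const pow)
    then have "(\<lambda>m. real m * I p m) \<longlonglongrightarrow> J p"
      by (simp add: Ip Jp sum_distrib_left mult.left_commute)
    from LIMSEQ_D[OF this, of "r / 3"] \<open>0 < r\<close> obtain m0 where m0: "\<And>m. m \<ge> m0 \<Longrightarrow> \<bar>real m * I p m - J p\<bar> < r / 3" by auto
    have d1: "\<bar>real m * I h m - real m * I p m\<bar> \<le> \<epsilon> * \<Phi> 1" if "m > 0" for m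
    proof -
      have "\<bar>I h m - I p m\<bar> = \<bar>expectation (\<lambda>\<omega>. (1 - exp (- X (1 / real m) \<omega>)) * (h (exp (- X (1 / real m) \<omega>)) - p (exp (- X (1 / real m) \<omega>))))\<bar>"
        unfolding I_def right_diff_distrib
        by (subst Bochner_Integration.integral_diff[OF intI intI]) (auto intro: B pB)
      also have "\<dots> \<le> expectation (\<lambda>\<omega>. \<bar>(1 - exp (- X (1 / real m) \<omega>)) * (h (exp (- X (1 / real m) \<omega>)) - p (exp (- X (1 / real m) \<omega>)))\<bar>)"
        by (rule integral_abs_bound)
      also have "\<dots> \<le> expectation (\<lambda>\<omega>. (1 - exp (- X (1 / real m) \<omega>)) * \<epsilon>)"
      proof (rule integral_mono_AE)
        show "integrable M (\<lambda>\<omega>. \<bar>(1 - exp (- X (1 / real m) \<omega>)) * (h (exp (- X (1 / real m) \<omega>)) - p (exp (- X (1 / real m) \<omega>)))\<bar>)"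
          by (intro integrable_abs intI[of "\<lambda>u. h u - p u" \<epsilon> m] pb) measurable
        show "integrable M (\<lambda>\<omega>. (1 - exp (- X (1 / real m) \<omega>)) * \<epsilon>)"
          using \<epsilon> by (intro intI[of "\<lambda>_. \<epsilon>" \<epsilon> m]) auto
        show "AE \<omega> in M. \<bar>(1 - exp (- X (1 / real m) \<omega>)) * (h (exp (- X (1 / real m) \<omega>)) - p (exp (- X (1 / real m) \<omega>)))\<bar> \<le> (1 - exp (- X (1 / real m) \<omega>)) * \<epsilon>"
        proof (rule AE_mp[OF X_nonneg[of "1 / real m"]], simp, intro AE_I2 impI)
          fix \<omega> assume "0 \<le> X (1 / real m) \<omega>"
          then show "\<bar>(1 - exp (- X (1 / real m) \<omega>)) * (h (exp (- X (1 / real m) \<omega>)) - p (exp (- X (1 / real m) \<omega>)))\<bar> \<le> (1 - exp (- X (1 / real m) \<omega>)) * \<epsilon>"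
            by (simp add: abs_mult pb mult_left_mono)
        qed
      qed
      also have "\<dots> = \<epsilon> * I (\<lambda>_. 1) m" by (simp add: I_def mult.commute)
      finally have "real m * \<bar>I h m - I p m\<bar> \<le> real m * (\<epsilon> * I (\<lambda>_. 1) m)" by (intro mult_left_mono) auto
      also have "\<dots> \<le> \<epsilon> * \<Phi> 1" using I_le[OF that] \<epsilon> by (simp add: mult.left_commute)
      finally show ?thesis by (simp add: right_diff_distrib[symmetric] abs_mult)
    qed
    have d2: "\<bar>J h - J p\<bar> \<le> \<epsilon> * \<Phi> 1"
    proof -
      have "J h - J p = levy_integral (\<lambda>s. (1 - exp (- s)) * (h (exp (- s)) - p (exp (- s))))"
        unfolding J_def right_diff_distrib
        by (subst levy_integral_diff[OF intJ intJ]) (auto intro: B pB)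
      also have "\<bar>\<dots>\<bar> \<le> levy_integral (\<lambda>s. (1 - exp (- s)) * \<epsilon>)"
      proof (rule levy_integral_mono_abs)
        show "set_integrable lborel {0<..} (\<lambda>s. (1 - exp (- s)) * (h (exp (- s)) - p (exp (- s))) * \<rho> s)"
          by (rule intJ[of "\<lambda>u. h u - p u" \<epsilon>]) (auto intro: pb)
        show "set_integrable lborel {0<..} (\<lambda>s. (1 - exp (- s)) * \<epsilon> * \<rho> s)"
          using \<epsilon> by (intro intJ[of "\<lambda>_. \<epsilon>" \<epsilon>]) auto
        show "\<bar>(1 - exp (- s)) * (h (exp (- s)) - p (exp (- s)))\<bar> \<le> (1 - exp (- s)) * \<epsilon>" if "0 < s" for s
          using that by (simp add: abs_mult pb mult_left_mono)
      qed
      also have "\<dots> = \<epsilon> * \<Phi> 1"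
        unfolding J1[symmetric] J_def levy_integral_def by (simp add: mult_ac)
      finally show ?thesis .
    qed
    show "\<exists>no. \<forall>m\<ge>no. norm (real m * I h m - J h) < r"
    proof (intro exI[of _ "max 1 m0"] allI impI)
      fix m assume m: "m \<ge> max 1 m0"
      then have "m > 0" "m \<ge> m0" by auto
      show "norm (real m * I h m - J h) < r"
        using d1[OF \<open>m > 0\<close>] d2 m0[OF \<open>m \<ge> m0\<close>] \<epsilon>\<Phi> unfolding real_norm_def by linarith
    qed
  qed
  then show ?thesis by (simp add: I_def J_def)
qed

text \<open>The sum of \<open>g\<close> over the jumps is the limit of the sums over the increments on grids of mesh
  \<open>1 / m\<close>. Independence and stationarity turn the expectation for the grid into
  \<open>(1 - c m / m) ^ m\<close>, where \<open>c m\<close> is \<open>m\<close> times the expectation of \<open>1 - exp (- g)\<close> at one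
  increment and converges to the integral of \<open>1 - exp (- g)\<close> against the Levy density.\<close>

theorem poisson_jumps:
  assumes A: "ranked_jumps_of M X A"
  shows "poisson_jumps M A \<rho>"
proof
  show [measurable]: "A \<in> M \<rightarrow>\<^sub>M seq_space" using A by (simp add: ranked_jumps_of_def)
  have AE_path: "AE \<omega> in M. mono_on {0..} (\<lambda>t. X t \<omega>) \<and> (\<forall>t\<ge>0. continuous (at_right t) (\<lambda>t. X t \<omega>)) \<and> ranked_jumps (\<lambda>t. X t \<omega>) (A \<omega>)"
    using paths A unfolding ranked_jumps_of_def by auto
  then show "AE \<omega> in M. decseq (A \<omega>) \<and> (\<forall>k. 0 \<le> A \<omega> k) \<and> summable (A \<omega>)"
  proof eventually_elim
    case (elim \<omega>)
    then have "summable (A \<omega>)"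
      by (intro sum_of_increments_tendsto_sum_of_jumps(1)[where \<phi> = "\<lambda>_. 0" and C = 0 and x = "\<lambda>t. X t \<omega>"]) auto
    with elim show ?case by (auto simp: ranked_jumps_def)
  qed
  fix g :: "real \<Rightarrow> real" and \<delta> K
  assume g: "continuous_on UNIV g" and g0: "\<And>s. 0 \<le> g s" and \<delta>: "0 < \<delta>"
    and g\<delta>: "\<And>s. s \<le> \<delta> \<Longrightarrow> g s = 0" and gK: "\<And>s. K \<le> s \<Longrightarrow> g s = 0"
  have [measurable]: "g \<in> borel_measurable borel" using g by (rule borel_measurable_continuous_onI)
  have X_meas: "X (real i / real m) \<in> borel_measurable M" for i m by (rule random_variable_X) simp
  have X_meas1 [measurable]: "X (1 / real m) \<in> borel_measurable M" for m by (rule random_variable_X) simp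
  define \<xi> where "\<xi> m i \<omega> = X (real (Suc i) / real m) \<omega> - X (real i / real m) \<omega>" for m i \<omega>
  have [measurable]: "\<xi> m i \<in> borel_measurable M" for m i
    unfolding \<xi>_def using X_meas by measurable
  obtain B where B: "\<And>s. g s \<le> B"
  proof -
    have "bounded (g ` {\<delta>..K})" using g by (intro compact_imp_bounded compact_continuous_image) (auto intro: continuous_on_subset)
    then obtain B where "\<And>s. s \<in> {\<delta>..K} \<Longrightarrow> \<bar>g s\<bar> \<le> B" by (force simp: bounded_iff)
    then have "g s \<le> max B 0" for s
      using g\<delta>[of s] gK[of s] by (cases "s \<in> {\<delta>..K}") (fastforce simp: not_le)+
    then show ?thesis using that by blast
  qed
  (* g s / s: the bound below on the denominator is harmless as g vanishes up to \<delta> *)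
  define \<phi> where "\<phi> s = g s / max s \<delta>" for s
  have \<phi>g: "s * \<phi> s = g s" for s using \<delta> g\<delta>[of s] by (cases "s \<le> \<delta>") (auto simp: \<phi>_def max_def)
  have conv: "AE \<omega> in M. (\<lambda>m. \<Sum>i<m. g (\<xi> m i \<omega>)) \<longlonglongrightarrow> (\<Sum>k. g (A \<omega> k))"
    using AE_path
  proof eventually_elim
    case (elim \<omega>)
    have "(\<lambda>m. \<Sum>i<m. (X (real (Suc i) / real m) \<omega> - X (real i / real m) \<omega>) * \<phi> (X (real (Suc i) / real m) \<omega> - X (real i / real m) \<omega>))
        \<longlonglongrightarrow> (\<Sum>k. A \<omega> k * \<phi> (A \<omega> k))"
    proof (rule sum_of_increments_tendsto_sum_of_jumps(2)[where C = "B / \<delta>"])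
      show "continuous_on UNIV \<phi>" unfolding \<phi>_def using \<delta> by (intro continuous_intros g) (auto simp: max_def)
      show "0 \<le> \<phi> s" for s using g0[of s] \<delta> by (simp add: \<phi>_def)
      show "\<phi> s \<le> B / \<delta>" for s unfolding \<phi>_def using B[of s] g0[of s] \<delta> by (intro frac_le) auto
      show "\<phi> 0 = 0" using g\<delta>[of 0] \<delta> by (simp add: \<phi>_def)
    qed (use elim in auto)
    then show ?case by (simp add: \<phi>g \<xi>_def)
  qed
  have lim1: "(\<lambda>m. expectation (\<lambda>\<omega>. exp (- (\<Sum>i<m. g (\<xi> m i \<omega>))))) \<longlonglongrightarrow> expectation (\<lambda>\<omega>. exp (- (\<Sum>k. g (A \<omega> k))))"
  proof (rule integral_dominated_convergence[where w = "\<lambda>_. 1"])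
    show "AE \<omega> in M. (\<lambda>m. exp (- (\<Sum>i<m. g (\<xi> m i \<omega>)))) \<longlonglongrightarrow> exp (- (\<Sum>k. g (A \<omega> k)))"
      using conv by eventually_elim (intro tendsto_intros)
  qed (auto simp: g0 sum_nonneg)
  (* (1 - exp (- g s)) / (1 - exp (- s)) as a function of u = exp (- s); as g vanishes outside
     the interval from \<delta> to K, the truncations make h continuous on the whole line *)
  define h where "h u = (1 - exp (- g (- ln (max u (exp (- K)))))) / (1 - min u (exp (- \<delta>)))" for u
  have hc: "continuous_on UNIV h"
  proof -
    have "continuous_on UNIV (\<lambda>u. g (- ln (max u (exp (- K)))))"
    proof (rule continuous_on_compose2[OF g])
      have "max u (exp (- K)) \<noteq> 0" for u using exp_gt_zero[of "- K"] by linarith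
      then show "continuous_on UNIV (\<lambda>u. - ln (max u (exp (- K))))"
        by (intro continuous_intros) auto
    qed simp
    then show ?thesis unfolding h_def using \<delta> by (intro continuous_intros) (auto simp: min_def)
  qed
  have h: "(1 - exp (- s)) * h (exp (- s)) = 1 - exp (- g s)" if "0 \<le> s" for s
  proof -
    consider "s \<le> \<delta>" "s \<le> K" | "K < s" | "\<delta> < s" "s \<le> K" by linarith
    then show ?thesis
    proof cases
      case 1 then show ?thesis using g\<delta>[of s] by (simp add: h_def max_def)
    next
      case 2 then show ?thesis using gK[of s] gK[of K] by (simp add: h_def max_def)
    next
      case 3
      then show ?thesis using \<delta> by (simp add: h_def max_def min_def)
    qed
  qed
  define c where "c m = real m * expectation (\<lambda>\<omega>. (1 - exp (- X (1 / real m) \<omega>)) * h (exp (- X (1 / real m) \<omega>)))" for m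
  have c_lim: "c \<longlonglongrightarrow> levy_integral (\<lambda>s. 1 - exp (- g s))"
  proof -
    have "levy_integral (\<lambda>s. (1 - exp (- s)) * h (exp (- s))) = levy_integral (\<lambda>s. 1 - exp (- g s))"
      by (intro levy_integral_cong h) simp
    then show ?thesis using small_increment_limit[OF hc] unfolding c_def by simp
  qed
  have prod: "expectation (\<lambda>\<omega>. exp (- (\<Sum>i<m. g (\<xi> m i \<omega>)))) = (1 - c m / real m) ^ m" if m: "m > 0" for m
  proof -
    have intg: "integrable M (\<lambda>\<omega>. exp (- g (Y \<omega>)))" if "Y \<in> borel_measurable M" for Y
      using that g0 by (intro integrable_const_bound[where B = 1]) (auto intro!: AE_I2)
    have one: "expectation (\<lambda>\<omega>. exp (- g (\<xi> m i \<omega>))) = 1 - c m / real m" for i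
    proof -
      have eq: "distr M borel (\<xi> m i) = distr M borel (X (1 / real m))"
        using stationary_increments[of "real i / real m" "1 / real m"] unfolding \<xi>_def
        by (simp add: add_divide_distrib add.commute)
      have "expectation (\<lambda>\<omega>. exp (- g (\<xi> m i \<omega>))) = (LINT x|distr M borel (\<xi> m i). exp (- g x))"
        by (subst integral_distr) auto
      also have "\<dots> = expectation (\<lambda>\<omega>. exp (- g (X (1 / real m) \<omega>)))"
        unfolding eq by (subst integral_distr) auto
      also have "\<dots> = 1 - expectation (\<lambda>\<omega>. 1 - exp (- g (X (1 / real m) \<omega>)))"
        using intg[OF X_meas1] by (subst Bochner_Integration.integral_diff) (auto simp: prob_space)
      also have "expectation (\<lambda>\<omega>. 1 - exp (- g (X (1 / real m) \<omega>)))
          = expectation (\<lambda>\<omega>. (1 - exp (- X (1 / real m) \<omega>)) * h (exp (- X (1 / real m) \<omega>)))"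
      proof (rule integral_cong_AE)
        show "AE \<omega> in M. 1 - exp (- g (X (1 / real m) \<omega>)) = (1 - exp (- X (1 / real m) \<omega>)) * h (exp (- X (1 / real m) \<omega>))"
          by (rule AE_mp[OF X_nonneg[of "1 / real m"]], simp, intro AE_I2 impI h[symmetric])
        have [measurable]: "h \<in> borel_measurable borel" using hc by (rule borel_measurable_continuous_onI)
        show "(\<lambda>\<omega>. (1 - exp (- X (1 / real m) \<omega>)) * h (exp (- X (1 / real m) \<omega>))) \<in> borel_measurable M" by measurable
      qed simp
      also have "1 - \<dots> = 1 - c m / real m" using m by (simp add: c_def)
      finally show ?thesis .
    qed
    have ind: "indep_vars (\<lambda>_. borel) (\<xi> m) {..<m}"
      unfolding \<xi>_def using independent_increments[of "\<lambda>i. real i / real m" m]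
      by (auto simp: mono_def divide_right_mono)
    have ind': "indep_vars (\<lambda>_. borel) (\<lambda>i \<omega>. exp (- g (\<xi> m i \<omega>))) {..<m}"
      using indep_vars_compose2[OF ind, of "\<lambda>_ x. exp (- g x)" "\<lambda>_. borel"] by simp
    have "expectation (\<lambda>\<omega>. \<Prod>i<m. exp (- g (\<xi> m i \<omega>))) = (\<Prod>i<m. expectation (\<lambda>\<omega>. exp (- g (\<xi> m i \<omega>))))"
      by (rule indep_vars_lebesgue_integral[OF _ ind']) (auto intro: intg)
    also have "\<dots> = (1 - c m / real m) ^ m" by (simp add: one)
    also have "(\<lambda>\<omega>. \<Prod>i<m. exp (- g (\<xi> m i \<omega>))) = (\<lambda>\<omega>. exp (- (\<Sum>i<m. g (\<xi> m i \<omega>))))"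
      by (simp add: exp_sum sum_negf[symmetric])
    finally show ?thesis .
  qed
  have "(\<lambda>m. expectation (\<lambda>\<omega>. exp (- (\<Sum>i<m. g (\<xi> m i \<omega>))))) \<longlonglongrightarrow> exp (- levy_integral (\<lambda>s. 1 - exp (- g s)))"
  proof (rule Lim_transform_eventually)
    show "(\<lambda>m. (1 - c m / real m) ^ m) \<longlonglongrightarrow> exp (- levy_integral (\<lambda>s. 1 - exp (- g s)))"
      by (rule tendsto_one_minus_power_exp[OF c_lim])
    show "eventually (\<lambda>m. (1 - c m / real m) ^ m = expectation (\<lambda>\<omega>. exp (- (\<Sum>i<m. g (\<xi> m i \<omega>))))) sequentially"
      by (rule eventually_mono[OF eventually_gt_at_top[of 0]]) (simp add: prod)
  qed
  then show "expectation (\<lambda>\<omega>. exp (- (\<Sum>k. g (A \<omega> k)))) = exp (- levy_integral (\<lambda>s. 1 - exp (- g s)))"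
    using lim1 LIMSEQ_unique by blast
qed

end

section \<open>The Laplace functional of the jumps\<close>

definition ranked :: "(nat \<Rightarrow> real) \<Rightarrow> bool" where
  "ranked a \<longleftrightarrow> decseq a \<and> (\<forall>k. 0 \<le> a k) \<and> summable a"

lemma ranked_nonneg: "ranked a \<Longrightarrow> 0 \<le> a k" and ranked_summable: "ranked a \<Longrightarrow> summable a"
  by (auto simp: ranked_def)

lemma summable_le_linear:
  assumes a: "ranked a" and g: "\<And>s. 0 \<le> s \<Longrightarrow> \<bar>g s\<bar> \<le> C * s"
  shows "summable (\<lambda>k. g (a k))" "\<bar>\<Sum>k. g (a k)\<bar> \<le> C * suminf a"
proof -
  have s: "summable (\<lambda>k. C * a k)" using a by (intro summable_mult ranked_summable)
  have s': "summable (\<lambda>k. \<bar>g (a k)\<bar>)"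
    by (rule summable_comparison_test'[OF s]) (use g ranked_nonneg[OF a] in auto)
  show "summable (\<lambda>k. g (a k))" using s' by (rule summable_rabs_cancel)
  have "\<bar>\<Sum>k. g (a k)\<bar> \<le> (\<Sum>k. \<bar>g (a k)\<bar>)" by (rule summable_rabs[OF s'])
  also have "\<dots> \<le> (\<Sum>k. C * a k)" by (intro suminf_le s s' g ranked_nonneg[OF a])
  also have "\<dots> = C * suminf a" by (rule suminf_mult) (rule ranked_summable[OF a])
  finally show "\<bar>\<Sum>k. g (a k)\<bar> \<le> C * suminf a" .
qed

lemma suminf_tendsto_dominated:
  assumes a: "ranked a" and g: "\<And>n s. 0 \<le> s \<Longrightarrow> \<bar>g n s\<bar> \<le> C * s" and lim: "\<And>s. 0 \<le> s \<Longrightarrow> (\<lambda>n. g n s) \<longlonglongrightarrow> h s"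
  shows "(\<lambda>n. \<Sum>k. g n (a k)) \<longlonglongrightarrow> (\<Sum>k. h (a k))"
proof -
  have "eventually (\<lambda>(k,n). norm (g n (a k)) \<le> C * a k) (at_top \<times>\<^sub>F sequentially)"
    using g ranked_nonneg[OF a] by (intro always_eventually) auto
  moreover have "summable (\<lambda>k. C * a k)" using a by (intro summable_mult ranked_summable)
  ultimately show ?thesis
    using tannerys_theorem[of "\<lambda>k n. g n (a k)" "\<lambda>k. h (a k)" sequentially "\<lambda>k. C * a k"] lim ranked_nonneg[OF a] by simp
qed

lemma exp_minus_add: "exp (- (a + b)) = exp (- a) * exp (- b :: real)"
  by (simp add: exp_add[symmetric])

lemma mult_exp_minus_le_min: "0 \<le> s \<Longrightarrow> s * exp (- s) \<le> min 1 (s::real)"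
proof -
  assume s: "0 \<le> s"
  have "s \<le> exp s" using exp_ge_add_one_self[of s] by linarith
  then have "s * exp (- s) \<le> 1" by (simp add: exp_minus field_simps)
  moreover have "s * exp (- s) \<le> s" using s by (simp add: mult_left_le)
  ultimately show ?thesis by simp
qed

text \<open>Pointwise limits of continuous functions under a common linear bound. The bound makes sums over
  summable sequences and integrals against a Levy density dominated, and the class contains the
  indicators of the half-lines \<open>{x..}\<close> with \<open>x > 0\<close>, which count the jumps of size at least \<open>x\<close>.\<close>

definition tame :: "(real \<Rightarrow> real) \<Rightarrow> bool" where
  "tame g \<longleftrightarrow> g \<in> borel_measurable borel \<and> (\<exists>C gn. (\<forall>n. continuous_on UNIV (gn n) \<and> (\<forall>s. 0 \<le> gn n s) \<and>
     (\<forall>s\<ge>0. gn n s \<le> C * s)) \<and> (\<forall>s\<ge>0. (\<lambda>n. gn n s) \<longlonglongrightarrow> g s))"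

lemma tame_bounds:
  assumes "tame g"
  obtains C where "0 \<le> C" "\<And>s. 0 \<le> s \<Longrightarrow> 0 \<le> g s" "\<And>s. 0 \<le> s \<Longrightarrow> g s \<le> C * s"
proof -
  obtain C gn where gn: "\<And>n s. 0 \<le> gn n s" "\<And>n s. 0 \<le> s \<Longrightarrow> gn n s \<le> C * s" "\<And>s. 0 \<le> s \<Longrightarrow> (\<lambda>n. gn n s) \<longlonglongrightarrow> g s"
    using assms unfolding tame_def by blast
  have "0 \<le> C" using gn(1)[of 0 1] gn(2)[of 1 0] by simp
  moreover have "0 \<le> g s" if "0 \<le> s" for s using gn(3)[OF that] gn(1) by (intro LIMSEQ_le_const) auto
  moreover have "g s \<le> C * s" if "0 \<le> s" for s using gn(3)[OF that] gn(2)[OF that] by (intro LIMSEQ_le_const2) auto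
  ultimately show ?thesis using that by blast
qed

lemma tame_measurable: "tame g \<Longrightarrow> g \<in> borel_measurable borel" by (simp add: tame_def)

lemma tame_add:
  assumes "tame g" "tame h" shows "tame (\<lambda>s. g s + h s)"
proof -
  obtain C gn where gn: "\<And>n. continuous_on UNIV (gn n)" "\<And>n s. 0 \<le> gn n s" "\<And>n s. 0 \<le> s \<Longrightarrow> gn n s \<le> C * s" "\<And>s. 0 \<le> s \<Longrightarrow> (\<lambda>n. gn n s) \<longlonglongrightarrow> g s"
    using assms(1) unfolding tame_def by blast
  obtain D hn where hn: "\<And>n. continuous_on UNIV (hn n)" "\<And>n s. 0 \<le> hn n s" "\<And>n s. 0 \<le> s \<Longrightarrow> hn n s \<le> D * s" "\<And>s. 0 \<le> s \<Longrightarrow> (\<lambda>n. hn n s) \<longlonglongrightarrow> h s"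
    using assms(2) unfolding tame_def by blast
  show ?thesis unfolding tame_def
  proof (intro conjI exI[of _ "C + D"] exI[of _ "\<lambda>n s. gn n s + hn n s"] allI impI)
    show "(\<lambda>s. g s + h s) \<in> borel_measurable borel"
      using assms by (intro borel_measurable_add tame_measurable)
    show "continuous_on UNIV (\<lambda>s. gn n s + hn n s)" for n by (intro continuous_on_add gn hn)
    show "0 \<le> gn n s + hn n s" for n s by (intro add_nonneg_nonneg gn hn)
    fix s :: real assume s: "0 \<le> s"
    show "gn n s + hn n s \<le> (C + D) * s" for n
      using gn(3)[OF s, of n] hn(3)[OF s, of n] by (simp add: distrib_right)
    show "(\<lambda>n. gn n s + hn n s) \<longlonglongrightarrow> g s + h s" by (intro tendsto_add gn hn s)
  qed
qed

lemma tame_cmult: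
  assumes "tame g" "0 \<le> c" shows "tame (\<lambda>s. c * g s)"
proof -
  obtain C gn where gn: "\<And>n. continuous_on UNIV (gn n)" "\<And>n s. 0 \<le> gn n s" "\<And>n s. 0 \<le> s \<Longrightarrow> gn n s \<le> C * s" "\<And>s. 0 \<le> s \<Longrightarrow> (\<lambda>n. gn n s) \<longlonglongrightarrow> g s"
    using assms(1) unfolding tame_def by blast
  show ?thesis unfolding tame_def
  proof (intro conjI exI[of _ "c * C"] exI[of _ "\<lambda>n s. c * gn n s"] allI impI)
    show "(\<lambda>s. c * g s) \<in> borel_measurable borel"
      using assms by (intro borel_measurable_times borel_measurable_const tame_measurable)
    show "continuous_on UNIV (\<lambda>s. c * gn n s)" for n by (intro continuous_intros gn)
    show "0 \<le> c * gn n s" for n s by (intro mult_nonneg_nonneg gn assms)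
    fix s :: real assume s: "0 \<le> s"
    show "c * gn n s \<le> c * C * s" for n
      using gn(3)[OF s, of n] assms(2) by (simp add: mult.assoc mult_left_mono)
    show "(\<lambda>n. c * gn n s) \<longlonglongrightarrow> c * g s" by (intro tendsto_mult tendsto_const gn s)
  qed
qed

lemma tame_zero: "tame (\<lambda>_. 0)"
  unfolding tame_def by (intro conjI exI[of _ "0"] exI[of _ "\<lambda>n s. 0"]) auto

lemma tame_sum: "(\<And>i. i \<in> I \<Longrightarrow> tame (g i)) \<Longrightarrow> tame (\<lambda>s. \<Sum>i\<in>I. g i s)"
  by (induction I rule: infinite_finite_induct) (simp_all add: tame_zero tame_add)

lemma tame_continuous:
  assumes "continuous_on UNIV g" "\<And>s. 0 \<le> g s" "\<And>s. 0 \<le> s \<Longrightarrow> g s \<le> C * s" shows "tame g"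
  unfolding tame_def using assms
  by (intro conjI exI[of _ C] exI[of _ "\<lambda>n. g"]) (auto intro: borel_measurable_continuous_onI)

text \<open>Continuous approximations of the indicator of \<open>{x..}\<close>. All of them vanish up to \<open>x / 2\<close>,
  hence the common linear bound \<open>2 / x * s\<close>.\<close>

definition ramp :: "real \<Rightarrow> nat \<Rightarrow> real \<Rightarrow> real" where
  "ramp x n s = max 0 (min 1 (1 - 2 * real (Suc n) * (x - s) / x))"

lemma ramp_properties:
  assumes x: "0 < x"
  shows "continuous_on UNIV (ramp x n)" "0 \<le> ramp x n s" "ramp x n s \<le> 1" "0 \<le> s \<Longrightarrow> ramp x n s \<le> 2 / x * s"
    "(\<lambda>n. ramp x n s) \<longlonglongrightarrow> indicator {x..} s"
proof -
  show "continuous_on UNIV (ramp x n)" unfolding ramp_def[abs_def] using x by (intro continuous_intros) auto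
  show "0 \<le> ramp x n s" "ramp x n s \<le> 1" by (auto simp: ramp_def)
  show "ramp x n s \<le> 2 / x * s" if s: "0 \<le> s"
  proof (cases "s \<le> x / 2")
    case True
    then have "x \<le> 2 * 1 * (x - s)" by simp
    also have "\<dots> \<le> 2 * real (Suc n) * (x - s)" using True x by (intro mult_right_mono) auto
    finally have "ramp x n s = 0" using x by (simp add: ramp_def pos_le_divide_eq)
    then show ?thesis using s x by simp
  next
    case False
    then have "1 \<le> 2 / x * s" using x by (simp add: field_simps)
    then show ?thesis using \<open>ramp x n s \<le> 1\<close> by linarith
  qed
  show "(\<lambda>n. ramp x n s) \<longlonglongrightarrow> indicator {x..} s"
  proof (cases "x \<le> s")
    case True
    then have "2 * real (Suc n) * (x - s) / x \<le> 0" for n using x by (intro divide_nonpos_pos mult_nonneg_nonpos) auto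
    then have "ramp x n s = 1" for n unfolding ramp_def by (smt (verit))
    then show ?thesis using True by simp
  next
    case False
    then have d: "0 < (x - s) / x" using x by simp
    obtain n0 where n0: "1 < real n0 * ((x - s) / x)" using ex_less_of_nat_mult[OF d] by blast
    have "ramp x n s = 0" if "n \<ge> n0" for n
    proof -
      have "real n0 * ((x - s) / x) \<le> 2 * real (Suc n) * ((x - s) / x)" using that d by (intro mult_right_mono) auto
      then show ?thesis using n0 by (simp add: ramp_def)
    qed
    then have "eventually (\<lambda>n. ramp x n s = 0) sequentially" by (auto simp: eventually_sequentially)
    then show ?thesis using False by (simp add: tendsto_eventually)
  qed
qed

lemma tame_step: "0 < x \<Longrightarrow> tame (indicator {x..})"
  unfolding tame_def
  by (intro conjI exI[of _ "2 / x"] exI[of _ "ramp x"] allI impI ramp_properties) auto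

text \<open>Removing a jump \<open>s\<close> from a sum of step functions produces exponentials of step functions, which
  then serve as directions of differentiation. The cut-off at 0 makes the approximants nonnegative
  on the whole line.\<close>

lemma tame_exp_step:
  assumes x: "\<And>i. i < n \<Longrightarrow> 0 < x i" and t: "\<And>i. 0 \<le> t i" "0 \<le> u"
  shows "tame (\<lambda>s. max 0 s * exp (- u * max 0 s + (\<Sum>i<n. t i * indicator {x i..} s)))"
  unfolding tame_def
proof (intro conjI exI[of _ "exp (\<Sum>i<n. t i)"] exI[of _ "\<lambda>m s. max 0 s * exp (- u * max 0 s + (\<Sum>i<n. t i * ramp (x i) m s))"] allI impI)
  show "(\<lambda>s. max 0 s * exp (- u * max 0 s + (\<Sum>i<n. t i * indicator {x i..} s))) \<in> borel_measurable borel" by measurable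
  fix m
  show "continuous_on UNIV (\<lambda>s. max 0 s * exp (- u * max 0 s + (\<Sum>i<n. t i * ramp (x i) m s)))"
    using x by (intro continuous_intros ramp_properties) auto
  fix s :: real
  show "0 \<le> max 0 s * exp (- u * max 0 s + (\<Sum>i<n. t i * ramp (x i) m s))" by simp
  show "max 0 s * exp (- u * max 0 s + (\<Sum>i<n. t i * ramp (x i) m s)) \<le> exp (sum t {..<n}) * s" if s: "0 \<le> s"
  proof -
    have "(\<Sum>i<n. t i * ramp (x i) m s) \<le> (\<Sum>i<n. t i)"
      using x t by (intro sum_mono) (auto intro!: mult_left_le ramp_properties)
    moreover have "- u * s \<le> 0" using t s by simp
    ultimately have "exp (- u * s + (\<Sum>i<n. t i * ramp (x i) m s)) \<le> exp (\<Sum>i<n. t i)"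
      unfolding exp_le_cancel_iff by linarith
    then have "s * exp (- u * s + (\<Sum>i<n. t i * ramp (x i) m s)) \<le> s * exp (\<Sum>i<n. t i)" using s by (rule mult_left_mono)
    then show ?thesis using s by (simp add: mult.commute max_def)
  qed
next
  fix s :: real
  show "(\<lambda>m. max 0 s * exp (- u * max 0 s + (\<Sum>i<n. t i * ramp (x i) m s))) \<longlonglongrightarrow> max 0 s * exp (- u * max 0 s + (\<Sum>i<n. t i * indicator {x i..} s))"
    using x by (intro tendsto_intros ramp_properties) auto
qed

lemma (in levy_density) tame_integrable:
  assumes g: "tame g" shows "set_integrable lborel {0<..} (\<lambda>s. (1 - exp (- g s)) * \<rho> s)"
proof -
  note [measurable] = tame_measurable[OF g]
  obtain D where D: "0 \<le> D" "\<And>s. 0 \<le> s \<Longrightarrow> 0 \<le> g s" "\<And>s. 0 \<le> s \<Longrightarrow> g s \<le> D * s" using tame_bounds[OF g] by blast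
  show ?thesis
  proof (rule integrable_dominated[where C = "max 1 D"])
    show "\<bar>1 - exp (- g s)\<bar> \<le> max 1 D * min 1 s" if "0 < s" for s
      using that D by (intro one_minus_exp_le_min) auto
  qed simp
qed

context poisson_jumps
begin

lemma AE_ranked: "AE \<omega> in M. ranked (A \<omega>)"
  using jumps_ranked by (simp add: ranked_def)

text \<open>Both sides of the identity pass to limits under a common linear bound.\<close>

lemma laplace_functional_limit:
  assumes [measurable]: "\<And>n. gn n \<in> borel_measurable borel" "g \<in> borel_measurable borel"
    and bd: "\<And>n s. 0 \<le> s \<Longrightarrow> 0 \<le> gn n s" "\<And>n s. 0 \<le> s \<Longrightarrow> gn n s \<le> C * s"
    and lim: "\<And>s. 0 \<le> s \<Longrightarrow> (\<lambda>n. gn n s) \<longlonglongrightarrow> g s"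
    and ok: "\<And>n. expectation (\<lambda>\<omega>. exp (- (\<Sum>k. gn n (A \<omega> k)))) = exp (- levy_integral (\<lambda>s. 1 - exp (- gn n s)))"
  shows "expectation (\<lambda>\<omega>. exp (- (\<Sum>k. g (A \<omega> k)))) = exp (- levy_integral (\<lambda>s. 1 - exp (- g s)))"
proof (rule LIMSEQ_unique)
  show "(\<lambda>n. expectation (\<lambda>\<omega>. exp (- (\<Sum>k. gn n (A \<omega> k))))) \<longlonglongrightarrow> expectation (\<lambda>\<omega>. exp (- (\<Sum>k. g (A \<omega> k))))"
  proof (rule integral_dominated_convergence[where w = "\<lambda>_. 1"])
    show "AE \<omega> in M. (\<lambda>n. exp (- (\<Sum>k. gn n (A \<omega> k)))) \<longlonglongrightarrow> exp (- (\<Sum>k. g (A \<omega> k)))"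
      using AE_ranked
    proof eventually_elim
      case (elim \<omega>)
      have "(\<lambda>n. \<Sum>k. gn n (A \<omega> k)) \<longlonglongrightarrow> (\<Sum>k. g (A \<omega> k))"
      proof (rule suminf_tendsto_dominated[OF elim])
        show "\<bar>gn n s\<bar> \<le> C * s" if "0 \<le> s" for n s using bd[OF that] by simp
      qed (rule lim)
      then show ?case by (intro tendsto_intros)
    qed
    fix n
    show "AE \<omega> in M. norm (exp (- (\<Sum>k. gn n (A \<omega> k)))) \<le> 1"
      using AE_ranked
    proof eventually_elim
      case (elim \<omega>)
      have "0 \<le> (\<Sum>k. gn n (A \<omega> k))"
      proof (rule suminf_nonneg)
        show "summable (\<lambda>k. gn n (A \<omega> k))"
          by (rule summable_le_linear(1)[OF elim, where C = C]) (use bd in simp)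
        show "0 \<le> gn n (A \<omega> k)" for k by (intro bd ranked_nonneg[OF elim])
      qed
      then show ?case by simp
    qed
  qed auto
  have "(\<lambda>n. levy_integral (\<lambda>s. 1 - exp (- gn n s))) \<longlonglongrightarrow> levy_integral (\<lambda>s. 1 - exp (- g s))"
  proof (rule levy_integral_tendsto[where C = "max 1 C"])
    fix n and s :: real assume s: "0 < s"
    show "\<bar>1 - exp (- gn n s)\<bar> \<le> max 1 C * min 1 s"
      using s bd[of s n] by (intro one_minus_exp_le_min) auto
    show "(\<lambda>n. 1 - exp (- gn n s)) \<longlonglongrightarrow> 1 - exp (- g s)" using s by (intro tendsto_intros lim) simp
  qed auto
  then show "(\<lambda>n. expectation (\<lambda>\<omega>. exp (- (\<Sum>k. gn n (A \<omega> k))))) \<longlonglongrightarrow> exp (- levy_integral (\<lambda>s. 1 - exp (- g s)))"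
    unfolding ok by (intro tendsto_intros)
qed

lemma laplace_functional_continuous:
  assumes g: "continuous_on UNIV g" "\<And>s. 0 \<le> g s" "\<And>s. 0 \<le> s \<Longrightarrow> g s \<le> C * s"
  shows "expectation (\<lambda>\<omega>. exp (- (\<Sum>k. g (A \<omega> k)))) = exp (- levy_integral (\<lambda>s. 1 - exp (- g s)))"
proof -
  (* vanishes up to 1 / (n + 1) and from n + 1 on, and tends to 1 on the positive half-line *)
  define cut where "cut n s = max 0 (min 1 (real (Suc n) * s - 1)) * max 0 (min 1 (real (Suc n) - s))" for n and s :: real
  have cut: "0 \<le> cut n s" "cut n s \<le> 1" for n s by (auto simp: cut_def intro!: mult_le_one)
  have cutc: "continuous_on UNIV (cut n)" for n unfolding cut_def by (intro continuous_intros)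
  have cutl: "(\<lambda>n. cut n s) \<longlonglongrightarrow> 1" if s: "0 < s" for s
  proof -
    obtain n0 where n0: "2 < real n0 * s" using ex_less_of_nat_mult[OF s] by blast
    obtain n1 where n1: "s + 1 < real n1" using reals_Archimedean2 by blast
    have "cut n s = 1" if n: "n \<ge> max n0 n1" for n
    proof -
      have "real n0 * s \<le> real (Suc n) * s" using n s by (intro mult_right_mono) auto
      then have "2 \<le> real (Suc n) * s" using n0 by linarith
      moreover have "s + 1 \<le> real (Suc n)" using n1 n by simp
      ultimately show ?thesis by (simp add: cut_def del: of_nat_Suc)
    qed
    then show ?thesis by (intro tendsto_eventually) (auto simp: eventually_sequentially simp del: max.bounded_iff)
  qed
  have [measurable]: "g \<in> borel_measurable borel" "\<And>n. cut n \<in> borel_measurable borel"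
    using g(1) cutc by (auto intro: borel_measurable_continuous_onI)
  show ?thesis
  proof (rule laplace_functional_limit[where gn = "\<lambda>n s. cut n s * g s" and C = C])
    show "(\<lambda>n. cut n s * g s) \<longlonglongrightarrow> g s" if "0 \<le> s" for s
    proof (cases "s = 0")
      case True
      then have "g s = 0" using g(2)[of 0] g(3)[of 0] by simp
      then show ?thesis by simp
    next
      case False
      then have "(\<lambda>n. cut n s * g s) \<longlonglongrightarrow> 1 * g s" using that by (intro tendsto_intros cutl) auto
      then show ?thesis by simp
    qed
    show "cut n s * g s \<le> C * s" if "0 \<le> s" for n s
      using mult_right_mono[OF cut(2)[of n s] g(2)[of s]] g(3)[OF that] by simp
    show "expectation (\<lambda>\<omega>. exp (- (\<Sum>k. cut n (A \<omega> k) * g (A \<omega> k)))) = exp (- levy_integral (\<lambda>s. 1 - exp (- (cut n s * g s))))" for n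
    proof (rule laplace_functional_compact[where \<delta> = "1 / real (Suc n)" and K = "real (Suc n)"])
      show "continuous_on UNIV (\<lambda>s. cut n s * g s)" by (intro continuous_intros g cutc)
      show "cut n s * g s = 0" if "s \<le> 1 / real (Suc n)" for s
      proof -
        have "real (Suc n) * s \<le> 1" using that by (simp add: field_simps)
        then show ?thesis by (simp add: cut_def del: of_nat_Suc)
      qed
      show "cut n s * g s = 0" if "real (Suc n) \<le> s" for s using that by (simp add: cut_def del: of_nat_Suc)
    qed (auto simp: cut g)
  qed (auto simp: cut g)
qed

lemma laplace_functional:
  assumes "tame g"
  shows "expectation (\<lambda>\<omega>. exp (- (\<Sum>k. g (A \<omega> k)))) = exp (- levy_integral (\<lambda>s. 1 - exp (- g s)))"
proof -
  obtain C gn where gn: "\<And>n. continuous_on UNIV (gn n)" "\<And>n s. 0 \<le> gn n s" "\<And>n s. 0 \<le> s \<Longrightarrow> gn n s \<le> C * s" "\<And>s. 0 \<le> s \<Longrightarrow> (\<lambda>n. gn n s) \<longlonglongrightarrow> g s"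
    using assms unfolding tame_def by blast
  show ?thesis
  proof (rule laplace_functional_limit[where gn = gn and C = C])
    show "expectation (\<lambda>\<omega>. exp (- (\<Sum>k. gn n (A \<omega> k)))) = exp (- levy_integral (\<lambda>s. 1 - exp (- gn n s)))" for n
      by (rule laplace_functional_continuous[OF gn(1,2,3)])
    show "gn n \<in> borel_measurable borel" for n by (intro borel_measurable_continuous_onI gn)
    show "g \<in> borel_measurable borel" using assms by (rule tame_measurable)
  qed (rule gn, assumption?)+
qed

text \<open>Apply the Laplace functional to \<open>g + \<epsilon> * h\<close> and differentiate at \<open>\<epsilon> = 0\<close>, along
  \<open>\<epsilon> = 1 / (n + 1)\<close>. The condition \<open>s \<le> g s\<close> lets the exponential dominate the linearly growing
  factor: \<open>x * exp (- x)\<close> is at most 1.\<close>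

lemma mecke_laplace:
  assumes g: "tame g" and g_ge: "\<And>s. 0 \<le> s \<Longrightarrow> s \<le> g s" and h: "tame h"
  shows "expectation (\<lambda>\<omega>. exp (- (\<Sum>k. g (A \<omega> k))) * (\<Sum>k. h (A \<omega> k)))
    = exp (- levy_integral (\<lambda>s. 1 - exp (- g s))) * levy_integral (\<lambda>s. exp (- g s) * h s)"
    (is "?L = ?R")
    "integrable M (\<lambda>\<omega>. exp (- (\<Sum>k. g (A \<omega> k))) * (\<Sum>k. h (A \<omega> k)))"
proof -
  note [measurable] = tame_measurable[OF g] tame_measurable[OF h]
  obtain C where C: "0 \<le> C" "\<And>s. 0 \<le> s \<Longrightarrow> 0 \<le> h s" "\<And>s. 0 \<le> s \<Longrightarrow> h s \<le> C * s" using tame_bounds[OF h] by blast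
  obtain D where D: "0 \<le> D" "\<And>s. 0 \<le> s \<Longrightarrow> 0 \<le> g s" "\<And>s. 0 \<le> s \<Longrightarrow> g s \<le> D * s" using tame_bounds[OF g] by blast
  define G where "G \<omega> = (\<Sum>k. g (A \<omega> k))" for \<omega>
  define H where "H \<omega> = (\<Sum>k. h (A \<omega> k))" for \<omega>
  have [measurable]: "G \<in> borel_measurable M" "H \<in> borel_measurable M" unfolding G_def H_def by measurable
  have GH: "AE \<omega> in M. 0 \<le> G \<omega> \<and> 0 \<le> H \<omega> \<and> exp (- G \<omega>) * H \<omega> \<le> C \<and> summable (\<lambda>k. g (A \<omega> k)) \<and> summable (\<lambda>k. h (A \<omega> k))"
    using AE_ranked
  proof eventually_elim
    case (elim \<omega>)
    have sg: "summable (\<lambda>k. g (A \<omega> k))" using D by (intro summable_le_linear[OF elim, where C = D]) auto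
    have sh: "summable (\<lambda>k. h (A \<omega> k))" "H \<omega> \<le> C * suminf (A \<omega>)"
      using summable_le_linear[OF elim, of h C] C by (auto simp: H_def)
    have G: "suminf (A \<omega>) \<le> G \<omega>" unfolding G_def
      by (intro suminf_le sg ranked_summable[OF elim] g_ge ranked_nonneg[OF elim])
    have S: "0 \<le> suminf (A \<omega>)" by (intro suminf_nonneg ranked_summable[OF elim] ranked_nonneg[OF elim])
    have H: "0 \<le> H \<omega>" unfolding H_def by (intro suminf_nonneg sh C ranked_nonneg[OF elim])
    have "exp (- G \<omega>) * H \<omega> \<le> exp (- suminf (A \<omega>)) * (C * suminf (A \<omega>))"
      using G sh H by (intro mult_mono) auto
    also have "\<dots> = C * (suminf (A \<omega>) * exp (- suminf (A \<omega>)))" by simp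
    also have "\<dots> \<le> C * 1" using mult_exp_minus_le_min[OF S] C by (intro mult_left_mono) auto
    finally show ?case using S G H sg sh by simp
  qed
  show "integrable M (\<lambda>\<omega>. exp (- (\<Sum>k. g (A \<omega> k))) * (\<Sum>k. h (A \<omega> k)))"
    unfolding G_def[symmetric] H_def[symmetric]
  proof (rule integrable_const_bound[where B = C])
    show "AE \<omega> in M. norm (exp (- G \<omega>) * H \<omega>) \<le> C" using GH by eventually_elim simp
  qed simp
  define r where "r n = real (Suc n)" for n
  have r: "0 < r n" for n by (simp add: r_def)
  define I where "I = levy_integral (\<lambda>s. 1 - exp (- g s))"
  (* the increment of the exponent when h / r n is added to g *)
  define y where "y n = levy_integral (\<lambda>s. exp (- g s) * (1 - exp (- (h s / r n))))" for n
  have r_lim: "(\<lambda>n. x * (1 / r n)) \<longlonglongrightarrow> 0" for x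
  proof -
    have "(\<lambda>n. x * inverse (real (Suc n))) \<longlonglongrightarrow> x * 0" by (intro tendsto_intros LIMSEQ_inverse_real_of_nat)
    then show ?thesis by (simp add: r_def divide_inverse)
  qed
  have lin: "(\<lambda>n. r n * (1 - exp (- (x / r n)))) \<longlonglongrightarrow> x" if "0 \<le> x" for x
  proof (rule tendsto_times_one_minus_exp)
    show "(\<lambda>n. x / r n) \<longlonglongrightarrow> 0" using r_lim[of x] by simp
    show "(\<lambda>n. r n * (x / r n)) \<longlonglongrightarrow> x" using r by (simp add: less_imp_neq[symmetric])
  qed (use that r in \<open>auto simp: less_imp_le\<close>)
  have hr: "0 \<le> 1 - exp (- (x / r n))" "r n * (1 - exp (- (x / r n))) \<le> x" if "0 \<le> x" for x n
  proof -
    have b: "0 \<le> 1 - exp (- (x / r n))" "1 - exp (- (x / r n)) \<le> x / r n"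
      using one_minus_exp_bounds[of "x / r n"] that r[of n] by auto
    then show "0 \<le> 1 - exp (- (x / r n))" "r n * (1 - exp (- (x / r n))) \<le> x"
      using r[of n] by (auto simp: field_simps)
  qed
  have bound: "exp (- g s) * x \<le> C * min 1 s" if s: "0 < s" "0 \<le> x" "x \<le> C * s" for s x
  proof -
    have "exp (- g s) * x \<le> exp (- s) * (C * s)" using s g_ge[of s] by (intro mult_mono) auto
    also have "\<dots> = C * (s * exp (- s))" by simp
    also have "\<dots> \<le> C * min 1 s" using mult_exp_minus_le_min[of s] C s by (intro mult_left_mono) auto
    finally show ?thesis .
  qed
  have ry: "(\<lambda>n. r n * y n) \<longlonglongrightarrow> levy_integral (\<lambda>s. exp (- g s) * h s)"
  proof -
    have "r n * y n = levy_integral (\<lambda>s. exp (- g s) * (r n * (1 - exp (- (h s / r n)))))" for n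
      unfolding y_def levy_integral_def by (subst set_integral_mult_right[symmetric]) (simp add: mult_ac)
    moreover have "(\<lambda>n. levy_integral (\<lambda>s. exp (- g s) * (r n * (1 - exp (- (h s / r n)))))) \<longlonglongrightarrow> levy_integral (\<lambda>s. exp (- g s) * h s)"
    proof (rule levy_integral_tendsto[where C = C])
      fix n and s :: real assume s: "0 < s"
      have "exp (- g s) * (r n * (1 - exp (- (h s / r n)))) \<le> C * min 1 s"
        using hr[of "h s" n] C(2,3)[of s] s r[of n] by (intro bound) auto
      then show "\<bar>exp (- g s) * (r n * (1 - exp (- (h s / r n))))\<bar> \<le> C * min 1 s"
        using hr(1)[of "h s" n] C(2)[of s] s r[of n] by simp
      show "(\<lambda>n. exp (- g s) * (r n * (1 - exp (- (h s / r n))))) \<longlonglongrightarrow> exp (- g s) * h s"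
        using s C by (intro tendsto_intros lin) auto
    qed auto
    ultimately show ?thesis by simp
  qed
  have y0: "0 \<le> y n" for n unfolding y_def
    using hr(1) C(2) by (intro levy_integral_nonneg mult_nonneg_nonneg) auto
  have y_lim: "y \<longlonglongrightarrow> 0"
  proof -
    have "(\<lambda>n. r n * y n * (1 / r n)) \<longlonglongrightarrow> levy_integral (\<lambda>s. exp (- g s) * h s) * 0"
      using r_lim[of 1] by (intro tendsto_mult ry) simp
    then show ?thesis using r by (simp add: less_imp_neq[symmetric])
  qed
  have L: "expectation (\<lambda>\<omega>. exp (- (G \<omega> + H \<omega> / r n))) = exp (- (I + y n))" for n
  proof -
    have t: "tame (\<lambda>s. g s + (1 / r n) * h s)" using r[of n] by (intro tame_add tame_cmult g h) auto
    have "expectation (\<lambda>\<omega>. exp (- (G \<omega> + H \<omega> / r n))) = expectation (\<lambda>\<omega>. exp (- (\<Sum>k. g (A \<omega> k) + (1 / r n) * h (A \<omega> k))))"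
    proof (rule integral_cong_AE)
      show "AE \<omega> in M. exp (- (G \<omega> + H \<omega> / r n)) = exp (- (\<Sum>k. g (A \<omega> k) + (1 / r n) * h (A \<omega> k)))"
        using GH
      proof eventually_elim
        case (elim \<omega>)
        then have "(\<Sum>k. g (A \<omega> k) + (1 / r n) * h (A \<omega> k)) = G \<omega> + (1 / r n) * H \<omega>"
          unfolding G_def H_def by (subst suminf_add[symmetric]) (auto intro!: summable_mult suminf_mult summable_divide simp: suminf_divide)
        then show ?case by simp
      qed
    qed auto
    also have "\<dots> = exp (- levy_integral (\<lambda>s. 1 - exp (- (g s + (1 / r n) * h s))))"
      by (rule laplace_functional[OF t])
    also have "levy_integral (\<lambda>s. 1 - exp (- (g s + (1 / r n) * h s))) = I + y n"
    proof -
      have i1: "set_integrable lborel {0<..} (\<lambda>s. (1 - exp (- g s)) * \<rho> s)" by (rule tame_integrable[OF g])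
      have i2: "set_integrable lborel {0<..} (\<lambda>s. (- (exp (- g s) * (1 - exp (- (h s / r n))))) * \<rho> s)"
      proof (rule integrable_dominated[where C = "C / r n"])
        fix s :: real assume s: "0 < s"
        have "exp (- g s) * (r n * (1 - exp (- (h s / r n)))) \<le> C * min 1 s"
          using hr[of "h s" n] C(2,3)[of s] s r[of n] by (intro bound) auto
        then show "\<bar>- (exp (- g s) * (1 - exp (- (h s / r n))))\<bar> \<le> C / r n * min 1 s"
          using hr(1)[of "h s" n] C(2)[of s] s r[of n] by (simp add: field_simps)
      qed simp
      have "levy_integral (\<lambda>s. 1 - exp (- (g s + (1 / r n) * h s))) = levy_integral (\<lambda>s. (1 - exp (- g s)) - (- (exp (- g s) * (1 - exp (- (h s / r n))))))"
        by (intro levy_integral_cong) (simp add: right_diff_distrib exp_minus_add del: minus_add_distrib)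
      also have "\<dots> = I - levy_integral (\<lambda>s. - (exp (- g s) * (1 - exp (- (h s / r n)))))"
        unfolding I_def by (rule levy_integral_diff[OF i1 i2])
      also have "levy_integral (\<lambda>s. - (exp (- g s) * (1 - exp (- (h s / r n))))) = - y n"
        unfolding y_def levy_integral_def set_lebesgue_integral_def by simp
      finally show ?thesis by simp
    qed
    finally show ?thesis .
  qed
  have L0: "expectation (\<lambda>\<omega>. exp (- G \<omega>)) = exp (- I)"
    using laplace_functional[OF g] by (simp add: G_def I_def)
  have int: "integrable M (\<lambda>\<omega>. exp (- G \<omega>))" "integrable M (\<lambda>\<omega>. exp (- (G \<omega> + H \<omega> / r n)))" for n
  proof -
    show "integrable M (\<lambda>\<omega>. exp (- G \<omega>))"
    proof (rule integrable_const_bound[where B = 1])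
      show "AE \<omega> in M. norm (exp (- G \<omega>)) \<le> 1" using GH by eventually_elim simp
    qed simp
    show "integrable M (\<lambda>\<omega>. exp (- (G \<omega> + H \<omega> / r n)))"
    proof (rule integrable_const_bound[where B = 1])
      show "AE \<omega> in M. norm (exp (- (G \<omega> + H \<omega> / r n))) \<le> 1"
        using GH
      proof eventually_elim
        case (elim \<omega>)
        then have "0 \<le> H \<omega> / r n" using r[of n] by simp
        with elim have "0 \<le> G \<omega> + H \<omega> / r n" by linarith
        then show ?case by simp
      qed
    qed simp
  qed
  have "(\<lambda>n. r n * (exp (- I) - exp (- (I + y n)))) \<longlonglongrightarrow> ?L"
  proof -
    have "r n * (exp (- I) - exp (- (I + y n))) = expectation (\<lambda>\<omega>. exp (- G \<omega>) * (r n * (1 - exp (- (H \<omega> / r n)))))" for n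
    proof -
      have d: "exp (- I) - exp (- (I + y n)) = expectation (\<lambda>\<omega>. exp (- G \<omega>) - exp (- (G \<omega> + H \<omega> / r n)))"
        using int by (simp add: L L0 del: minus_add_distrib)
      show ?thesis
      proof -
        have e: "exp (- G \<omega>) * (r n * (1 - exp (- (H \<omega> / r n)))) = r n * (exp (- G \<omega>) - exp (- (G \<omega> + H \<omega> / r n)))" for \<omega>
          by (simp add: right_diff_distrib exp_minus_add mult_ac del: minus_add_distrib)
        show ?thesis unfolding d e by (simp only: integral_mult_right_zero)
      qed
    qed
    moreover have "(\<lambda>n. expectation (\<lambda>\<omega>. exp (- G \<omega>) * (r n * (1 - exp (- (H \<omega> / r n)))))) \<longlonglongrightarrow> expectation (\<lambda>\<omega>. exp (- G \<omega>) * H \<omega>)"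
    proof (rule integral_dominated_convergence[where w = "\<lambda>_. C"])
      show "AE \<omega> in M. (\<lambda>n. exp (- G \<omega>) * (r n * (1 - exp (- (H \<omega> / r n))))) \<longlonglongrightarrow> exp (- G \<omega>) * H \<omega>"
        using GH by eventually_elim (intro tendsto_intros lin, simp)
      show "AE \<omega> in M. norm (exp (- G \<omega>) * (r n * (1 - exp (- (H \<omega> / r n))))) \<le> C" for n
        using GH
      proof eventually_elim
        case (elim \<omega>)
        have "exp (- G \<omega>) * (r n * (1 - exp (- (H \<omega> / r n)))) \<le> exp (- G \<omega>) * H \<omega>"
          using hr(2)[of "H \<omega>" n] elim by (intro mult_left_mono) auto
        moreover have "0 \<le> exp (- G \<omega>) * (r n * (1 - exp (- (H \<omega> / r n))))"
          using hr(1)[of "H \<omega>" n] elim r[of n] by simp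
        ultimately show ?case using elim unfolding real_norm_def by linarith
      qed
    qed auto
    ultimately show ?thesis by (simp only: G_def H_def)
  qed
  moreover have "(\<lambda>n. r n * (exp (- I) - exp (- (I + y n)))) \<longlonglongrightarrow> ?R"
  proof -
    have "(\<lambda>n. exp (- I) * (r n * (1 - exp (- y n)))) \<longlonglongrightarrow> exp (- I) * levy_integral (\<lambda>s. exp (- g s) * h s)"
      using r by (intro tendsto_mult tendsto_const tendsto_times_one_minus_exp y0 y_lim ry) (simp add: less_imp_le)
    moreover have "exp (- I) * (r n * (1 - exp (- y n))) = r n * (exp (- I) - exp (- (I + y n)))" for n
      by (simp add: right_diff_distrib exp_minus_add mult_ac del: minus_add_distrib)
    ultimately show ?thesis by (simp only: I_def)
  qed
  ultimately show "?L = ?R" by (rule LIMSEQ_unique)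
qed

end

section \<open>The law of a ranked sequence\<close>

definition count_above :: "real \<Rightarrow> (nat \<Rightarrow> real) \<Rightarrow> real" where
  "count_above x a = (\<Sum>k. indicator {x..} (a k))"

lemma measurable_seq_spaceI:
  "(\<And>i. (\<lambda>x. f x i) \<in> borel_measurable M) \<Longrightarrow> f \<in> M \<rightarrow>\<^sub>M seq_space"
  by (rule measurable_PiM_single') (auto simp: space_PiM)

lemma count_above_measurable [measurable]: "count_above x \<in> borel_measurable seq_space"
  unfolding count_above_def by measurable

lemma count_above_ranked:
  assumes a: "ranked a" and x: "0 < x"
  shows "x \<le> a j \<longleftrightarrow> real j + 1 \<le> count_above x a" "summable (\<lambda>k. indicator {x..} (a k) :: real)" "0 \<le> count_above x a"
proof -
  have "a \<longlonglongrightarrow> 0" using a by (intro summable_LIMSEQ_zero ranked_summable)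
  then have "eventually (\<lambda>k. a k < x) sequentially" using x by (intro order_tendstoD) auto
  then have ex: "\<exists>k. a k < x" by (auto simp: eventually_sequentially)
  define m where "m = (LEAST k. a k < x)"
  have m: "a k < x \<longleftrightarrow> m \<le> k" for k
    using LeastI_ex[OF ex] a Least_le[of "\<lambda>k. a k < x" k] unfolding m_def[symmetric] ranked_def
    by (auto dest: decseqD order_le_less_trans)
  have "(\<lambda>k. indicator {x..} (a k) :: real) = (\<lambda>k. if k \<in> {..<m} then 1 else 0)"
    using m by (auto simp: indicator_def fun_eq_iff not_le not_less[symmetric])
  moreover have "(\<lambda>k. if k \<in> {..<m} then 1 else 0 :: real) sums (\<Sum>k\<in>{..<m}. 1)"
    by (rule sums_If_finite_set) simp
  ultimately have s: "(\<lambda>k. indicator {x..} (a k) :: real) sums real m" by simp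
  then show "summable (\<lambda>k. indicator {x..} (a k) :: real)" by (rule sums_summable)
  have c: "count_above x a = real m" using s by (simp add: count_above_def sums_iff)
  then show "0 \<le> count_above x a" by simp
  have "x \<le> a j \<longleftrightarrow> j < m" using m[of j] by auto
  also have "\<dots> \<longleftrightarrow> real j + 1 \<le> count_above x a" unfolding c by linarith
  finally show "x \<le> a j \<longleftrightarrow> real j + 1 \<le> count_above x a" .
qed

lemma ex_pos_rat_enum: "\<exists>q :: nat \<Rightarrow> real. range q = {x \<in> \<rat>. 0 < x}"
proof -
  have "countable {x \<in> \<rat> :: real set. 0 < x}" by (rule countable_subset[OF _ countable_rat]) auto
  moreover have "{x \<in> \<rat> :: real set. 0 < x} \<noteq> {}" using Rats_1 zero_less_one by blast
  ultimately show ?thesis by (metis range_from_nat_into)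
qed

definition pos_rat :: "nat \<Rightarrow> real" where "pos_rat = (SOME q. range q = {x \<in> \<rat>. 0 < x})"

lemma range_pos_rat: "range pos_rat = {x \<in> \<rat>. 0 < x}"
  unfolding pos_rat_def by (rule someI_ex[OF ex_pos_rat_enum])

lemma pos_rat_pos: "0 < pos_rat i"
  using range_pos_rat by blast

text \<open>A real number and a ranked sequence, encoded as one sequence of reals: the number itself comes
  first, followed by the numbers of entries that reach each positive rational level. Integer
  combinations of these counts are sums of step functions over the ranked sequence, so Laplace
  functionals of step functions are Laplace transforms of the encoding.\<close>

definition profile :: "real \<times> (nat \<Rightarrow> real) \<Rightarrow> nat \<Rightarrow> real" where
  "profile p = case_nat (fst p) (\<lambda>i. count_above (pos_rat i) (snd p))"

text \<open>The entry \<open>a j\<close> of a ranked sequence is the supremum of the levels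
  that at least \<open>j + 1\<close> entries reach. The value 0 stands for levels not reached so often.\<close>

definition unprofile :: "(nat \<Rightarrow> real) \<Rightarrow> real \<times> (nat \<Rightarrow> real)" where
  "unprofile c = (c 0, \<lambda>j. enn2real (SUP i. if real j + 1 \<le> c (Suc i) then ennreal (pos_rat i) else 0))"

lemma profile_measurable [measurable]: "profile \<in> borel \<Otimes>\<^sub>M seq_space \<rightarrow>\<^sub>M seq_space"
  unfolding profile_def
  by (intro measurable_case_nat' measurable_seq_spaceI) measurable

lemma unprofile_measurable [measurable]: "unprofile \<in> seq_space \<rightarrow>\<^sub>M borel \<Otimes>\<^sub>M seq_space"
  unfolding unprofile_def
  by (intro measurable_Pair measurable_seq_spaceI) measurable

lemma unprofile_profile:
  assumes a: "ranked a" shows "unprofile (profile (s, a)) = (s, a)"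
proof -
  have "(SUP i. if real j + 1 \<le> count_above (pos_rat i) a then ennreal (pos_rat i) else 0) = ennreal (a j)" for j
  proof (rule antisym)
    show "(SUP i. if real j + 1 \<le> count_above (pos_rat i) a then ennreal (pos_rat i) else 0) \<le> ennreal (a j)"
      by (rule SUP_least) (auto simp: count_above_ranked(1)[OF a pos_rat_pos, symmetric] intro: ennreal_leI)
    show "ennreal (a j) \<le> (SUP i. if real j + 1 \<le> count_above (pos_rat i) a then ennreal (pos_rat i) else 0)"
    proof (rule dense_le)
      fix y assume y: "y < ennreal (a j)"
      then obtain z where z: "y = ennreal z" "0 \<le> z" by (cases y) auto
      with y have "z < a j" by (simp add: ennreal_less_iff)
      then obtain r where r: "r \<in> \<rat>" "z < r" "r < a j" using Rats_dense_in_real by blast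
      then have "r \<in> range pos_rat" using z range_pos_rat by auto
      then obtain i where i: "r = pos_rat i" by auto
      then have "real j + 1 \<le> count_above (pos_rat i) a"
        using r by (simp add: count_above_ranked(1)[OF a pos_rat_pos, symmetric])
      then have "ennreal r \<le> (SUP i. if real j + 1 \<le> count_above (pos_rat i) a then ennreal (pos_rat i) else 0)"
        unfolding i by (intro SUP_upper2[of i]) auto
      moreover have "y \<le> ennreal r" using r z by (auto intro: ennreal_leI)
      ultimately show "y \<le> (SUP i. if real j + 1 \<le> count_above (pos_rat i) a then ennreal (pos_rat i) else 0)" by (rule order_trans[rotated])
    qed
  qed
  then show ?thesis using ranked_nonneg[OF a] by (simp add: unprofile_def profile_def)
qed

text \<open>The coefficients are natural numbers because Laplace transforms at natural arguments
  determine a law.\<close>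

definition step_function :: "nat \<Rightarrow> (nat \<Rightarrow> nat) \<Rightarrow> real \<Rightarrow> real" where
  "step_function n t s = (\<Sum>i<n. real (t i) * indicator {pos_rat i..} s)"

lemma step_function_measurable [measurable]: "step_function n t \<in> borel_measurable borel"
  unfolding step_function_def by measurable

lemma step_function_nonneg: "0 \<le> step_function n t s"
  unfolding step_function_def by (intro sum_nonneg) auto

lemma tame_step_sum: "tame (step_function n t)"
  unfolding step_function_def[abs_def] by (intro tame_sum tame_cmult tame_step pos_rat_pos) auto

lemma sum_count_above:
  assumes "ranked a"
  shows "(\<Sum>i<n. real (t i) * count_above (pos_rat i) a) = (\<Sum>k. step_function n t (a k))" "summable (\<lambda>k. step_function n t (a k))"
proof -
  note s = count_above_ranked(2)[OF assms pos_rat_pos]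
  show "summable (\<lambda>k. step_function n t (a k))"
    unfolding step_function_def by (intro summable_sum summable_mult s)
  show "(\<Sum>i<n. real (t i) * count_above (pos_rat i) a) = (\<Sum>k. step_function n t (a k))"
    unfolding step_function_def count_above_def using s
    by (subst suminf_sum) (auto intro!: summable_mult sum.cong suminf_mult[symmetric])
qed

text \<open>The Laplace transform of the encoding \<open>profile\<close> is known, and \<open>unprofile\<close> recovers the pair from
  it.\<close>

theorem ranked_law_unique:
  fixes \<mu> \<nu> :: "(real \<times> (nat \<Rightarrow> real)) measure"
  assumes "finite_measure \<mu>" "finite_measure \<nu>"
    and S[measurable_cong]: "sets \<mu> = sets (borel \<Otimes>\<^sub>M seq_space)" "sets \<nu> = sets (borel \<Otimes>\<^sub>M seq_space)"
    and AE: "AE p in \<mu>. 0 \<le> fst p \<and> ranked (snd p)" "AE p in \<nu>. 0 \<le> fst p \<and> ranked (snd p)"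
    and eq: "\<And>u n t. (\<integral>\<^sup>+p. ennreal (exp (- (real u * fst p + (\<Sum>k. step_function n t (snd p k))))) \<partial>\<mu>) =
        (\<integral>\<^sup>+p. ennreal (exp (- (real u * fst p + (\<Sum>k. step_function n t (snd p k))))) \<partial>\<nu>)"
  shows "\<mu> = \<nu>"
proof -
  have recover: "distr (distr m seq_space profile) (borel \<Otimes>\<^sub>M seq_space) unprofile = m"
    if "sets m = sets (borel \<Otimes>\<^sub>M seq_space)" "AE p in m. 0 \<le> fst p \<and> ranked (snd p)" for m
  proof -
    note that(1)[measurable_cong]
    have "distr (distr m seq_space profile) (borel \<Otimes>\<^sub>M seq_space) unprofile = distr m (borel \<Otimes>\<^sub>M seq_space) (unprofile \<circ> profile)"
      by (rule distr_distr) measurable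
    also have "\<dots> = distr m (borel \<Otimes>\<^sub>M seq_space) (\<lambda>p. p)"
    proof (rule distr_cong_AE)
      show "AE p in m. (unprofile \<circ> profile) p = p"
        using that(2) by eventually_elim (auto simp: unprofile_profile)
    qed (auto intro!: measurable_comp[of _ _ seq_space])
    also have "\<dots> = m" using that(1)[symmetric] by (rule distr_id2)
    finally show ?thesis .
  qed
  (* Coordinate 0 of the encoding is the real component, so the arguments t are shifted by one. *)
  have lap: "(\<integral>\<^sup>+c. ennreal (exp (- (\<Sum>i<n. real (t i) * c i))) \<partial>distr m seq_space profile) =
     (\<integral>\<^sup>+p. ennreal (exp (- (real (if n = 0 then 0 else t 0) * fst p + (\<Sum>k. step_function (n - 1) (\<lambda>i. t (Suc i)) (snd p k))))) \<partial>m)"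
    if "sets m = sets (borel \<Otimes>\<^sub>M seq_space)" "AE p in m. 0 \<le> fst p \<and> ranked (snd p)" for m n t
  proof -
    note that(1)[measurable_cong]
    have "(\<integral>\<^sup>+c. ennreal (exp (- (\<Sum>i<n. real (t i) * c i))) \<partial>distr m seq_space profile)
      = (\<integral>\<^sup>+p. ennreal (exp (- (\<Sum>i<n. real (t i) * profile p i))) \<partial>m)"
      by (subst nn_integral_distr) auto
    also have "\<dots> = (\<integral>\<^sup>+p. ennreal (exp (- (real (if n = 0 then 0 else t 0) * fst p + (\<Sum>k. step_function (n - 1) (\<lambda>i. t (Suc i)) (snd p k))))) \<partial>m)"
    proof (rule nn_integral_cong_AE)
      show "AE p in m. ennreal (exp (- (\<Sum>i<n. real (t i) * profile p i))) = ennreal (exp (- (real (if n = 0 then 0 else t 0) * fst p + (\<Sum>k. step_function (n - 1) (\<lambda>i. t (Suc i)) (snd p k)))))"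
        using that(2)
      proof eventually_elim
        case (elim p)
        have "(\<Sum>i<n. real (t i) * profile p i) = real (if n = 0 then 0 else t 0) * fst p + (\<Sum>i<n-1. real (t (Suc i)) * count_above (pos_rat i) (snd p))"
          by (cases n) (simp_all add: sum.lessThan_Suc_shift profile_def del: sum.lessThan_Suc)
        then show ?case using elim by (simp only: sum_count_above(1))
      qed
    qed
    finally show ?thesis .
  qed
  have pos: "AE c in distr m seq_space profile. \<forall>i. 0 \<le> c i"
    if "sets m = sets (borel \<Otimes>\<^sub>M seq_space)" "AE p in m. 0 \<le> fst p \<and> ranked (snd p)" for m
  proof -
    note that(1)[measurable_cong]
    have "AE p in m. \<forall>i. 0 \<le> profile p i"
      using that(2) by eventually_elim (auto simp: profile_def count_above_ranked pos_rat_pos split: nat.split)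
    then show ?thesis by (subst AE_distr_iff) auto
  qed
  have fin: "finite_measure (distr m seq_space profile)"
    if "sets m = sets (borel \<Otimes>\<^sub>M seq_space)" "finite_measure m" for m
  proof -
    note that(1)[measurable_cong]
    show ?thesis by (rule finite_measure.finite_measure_distr[OF that(2)]) measurable
  qed
  have "distr \<mu> seq_space profile = distr \<nu> seq_space profile"
  proof (rule seq_laplace_transform_unique)
    show "finite_measure (distr \<mu> seq_space profile)" by (rule fin[OF S(1) assms(1)])
    show "finite_measure (distr \<nu> seq_space profile)" by (rule fin[OF S(2) assms(2)])
    show "AE c in distr \<mu> seq_space profile. \<forall>i. 0 \<le> c i" by (rule pos[OF S(1) AE(1)])
    show "AE c in distr \<nu> seq_space profile. \<forall>i. 0 \<le> c i" by (rule pos[OF S(2) AE(2)])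
    fix n and t :: "nat \<Rightarrow> nat"
    show "(\<integral>\<^sup>+c. ennreal (exp (- (\<Sum>i<n. real (t i) * c i))) \<partial>distr \<mu> seq_space profile)
        = (\<integral>\<^sup>+c. ennreal (exp (- (\<Sum>i<n. real (t i) * c i))) \<partial>distr \<nu> seq_space profile)"
      unfolding lap[OF S(1) AE(1)] lap[OF S(2) AE(2)] by (rule eq)
  qed simp_all
  then show ?thesis by (metis recover[OF S(1) AE(1)] recover[OF S(2) AE(2)])
qed

definition delete :: "nat \<Rightarrow> (nat \<Rightarrow> real) \<Rightarrow> nat \<Rightarrow> real" where
  "delete k a j = (if j < k then a j else a (Suc j))"

lemma delete_measurable [measurable]: "delete k \<in> seq_space \<rightarrow>\<^sub>M seq_space"
  unfolding delete_def[abs_def] by (intro measurable_seq_spaceI) measurable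

lemma sums_delete:
  fixes f :: "real \<Rightarrow> real"
  assumes "summable (\<lambda>j. f (a j))"
  shows "(\<lambda>j. f (delete k a j)) sums ((\<Sum>j. f (a j)) - f (a k))"
proof -
  have "(\<lambda>j. f (a (j + Suc k))) sums ((\<Sum>j. f (a j)) - (\<Sum>j<Suc k. f (a j)))"
    using assms summable_sums sums_split_initial_segment by blast
  then have "(\<lambda>j. f (delete k a (j + k))) sums ((\<Sum>j. f (a j)) - f (a k) - (\<Sum>j<k. f (delete k a j)))"
    by (simp add: delete_def algebra_simps)
  then show ?thesis by (subst (asm) sums_iff_shift) simp
qed

lemma ranked_delete: "ranked a \<Longrightarrow> ranked (delete k a)"
proof -
  assume a: "ranked a"
  have "decseq (delete k a)"
    using a unfolding ranked_def decseq_def delete_def by auto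
  moreover have "summable (delete k a)"
    using sums_delete[of "\<lambda>x. x" a k] ranked_summable[OF a] by (simp add: sums_iff)
  ultimately show ?thesis using ranked_nonneg[OF a] by (simp add: ranked_def delete_def)
qed

lemma suminf_delete: "ranked a \<Longrightarrow> suminf (delete k a) = suminf a - a k"
  using sums_delete[of "\<lambda>x. x" a k] by (simp add: ranked_summable sums_iff)

section \<open>The Mecke formula\<close>

lemma ranked_measurable [measurable]: "Measurable.pred seq_space ranked"
proof -
  have eq: "ranked = (\<lambda>a. (\<forall>n. a (Suc n) \<le> a n) \<and> (\<forall>k. 0 \<le> a k) \<and> (\<Sum>k. ennreal (a k)) < \<infinity>)"
  proof
    fix a :: "nat \<Rightarrow> real"
    show "ranked a = ((\<forall>n. a (Suc n) \<le> a n) \<and> (\<forall>k. 0 \<le> a k) \<and> (\<Sum>k. ennreal (a k)) < \<infinity>)"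
    proof (cases "\<forall>k. 0 \<le> a k")
      case True
      have "(\<Sum>k. ennreal (a k)) < \<infinity>" if "summable a"
        using True that by (subst suminf_ennreal2) auto
      moreover have "summable a" if "(\<Sum>k. ennreal (a k)) < \<infinity>"
        using True that by (intro summable_suminf_not_top) auto
      ultimately show ?thesis unfolding ranked_def decseq_Suc_iff by metis
    qed (auto simp: ranked_def)
  qed
  have "Measurable.pred seq_space (\<lambda>a. a (Suc n) \<le> a n)" for n
    unfolding pred_def by measurable
  moreover have "Measurable.pred seq_space (\<lambda>a. 0 \<le> a k)" for k :: nat by measurable
  moreover have "Measurable.pred seq_space (\<lambda>a. (\<Sum>k. ennreal (a k)) < \<infinity>)" by measurable
  ultimately show ?thesis unfolding eq by (intro pred_intros_logic pred_intros_countable)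
qed

context poisson_jumps
begin

abbreviation S :: "'a \<Rightarrow> real" where "S \<omega> \<equiv> suminf (A \<omega>)"

text \<open>A jump picked with weight equal to its size, together with the other jumps. The additional weight
  \<open>exp (- S \<omega>)\<close> makes the measure finite, so that Laplace transforms determine it.\<close>

definition palm_measure :: "(real \<times> (nat \<Rightarrow> real)) measure" where
  "palm_measure = distr (density (M \<Otimes>\<^sub>M count_space UNIV) (\<lambda>(\<omega>, k). ennreal (A \<omega> k * exp (- S \<omega>))))
     (borel \<Otimes>\<^sub>M seq_space) (\<lambda>(\<omega>, k). (A \<omega> k, delete k (A \<omega>)))"

text \<open>The product counterpart: a point \<open>s\<close> from the size-biased Levy measure and a full set of jumps.
  The weight \<open>exp (- (s + S \<omega>))\<close> corresponds to the one above, as \<open>s + S \<omega>\<close> plays the role of the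
  sum that includes the picked jump.\<close>

definition independent_pair_measure :: "(real \<times> (nat \<Rightarrow> real)) measure" where
  "independent_pair_measure = distr (density (lborel \<Otimes>\<^sub>M M) (\<lambda>(s, \<omega>). ennreal (indicator {0<..} s * (s * exp (- s) * \<rho> s) * exp (- S \<omega>))))
     (borel \<Otimes>\<^sub>M seq_space) (\<lambda>(s, \<omega>). (s, A \<omega>))"

lemma nn_integral_palm_measure:
  assumes [measurable]: "f \<in> borel_measurable (borel \<Otimes>\<^sub>M seq_space)"
  shows "(\<integral>\<^sup>+p. f p \<partial>palm_measure) = (\<integral>\<^sup>+\<omega>. (\<Sum>k. ennreal (A \<omega> k * exp (- S \<omega>)) * f (A \<omega> k, delete k (A \<omega>))) \<partial>M)"
proof -
  have m1 [measurable]: "(\<lambda>(\<omega>, k). ennreal (A \<omega> k * exp (- S \<omega>))) \<in> borel_measurable (M \<Otimes>\<^sub>M count_space UNIV)"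
    by (rule measurable_pair_swap_iff[THEN iffD2], rule measurable_pair_measure_countable1) (simp_all add: split_beta)
  have m2 [measurable]: "(\<lambda>(\<omega>, k). (A \<omega> k, delete k (A \<omega>))) \<in> M \<Otimes>\<^sub>M count_space UNIV \<rightarrow>\<^sub>M borel \<Otimes>\<^sub>M seq_space"
    by (rule measurable_pair_swap_iff[THEN iffD2], rule measurable_pair_measure_countable1) (simp_all add: split_beta)
  interpret C: sigma_finite_measure "count_space (UNIV :: nat set)" by (rule sigma_finite_measure_count_space)
  have "(\<integral>\<^sup>+p. f p \<partial>palm_measure) = (\<integral>\<^sup>+x. (case x of (\<omega>, k) \<Rightarrow> ennreal (A \<omega> k * exp (- S \<omega>))) * f (case x of (\<omega>, k) \<Rightarrow> (A \<omega> k, delete k (A \<omega>))) \<partial>(M \<Otimes>\<^sub>M count_space UNIV))"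
    unfolding palm_measure_def by (simp add: nn_integral_distr nn_integral_density)
  also have "\<dots> = (\<integral>\<^sup>+\<omega>. \<integral>\<^sup>+k. ennreal (A \<omega> k * exp (- S \<omega>)) * f (A \<omega> k, delete k (A \<omega>)) \<partial>count_space UNIV \<partial>M)"
    by (subst C.nn_integral_fst[symmetric]) simp_all
  finally show ?thesis by (simp add: nn_integral_count_space_nat)
qed

lemma nn_integral_independent_pair_measure:
  assumes [measurable]: "f \<in> borel_measurable (borel \<Otimes>\<^sub>M seq_space)"
  shows "(\<integral>\<^sup>+p. f p \<partial>independent_pair_measure)
    = (\<integral>\<^sup>+s. \<integral>\<^sup>+\<omega>. ennreal (indicator {0<..} s * (s * exp (- s) * \<rho> s) * exp (- S \<omega>)) * f (s, A \<omega>) \<partial>M \<partial>lborel)"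
proof -
  have "(\<integral>\<^sup>+p. f p \<partial>independent_pair_measure) = (\<integral>\<^sup>+x. (case x of (s, \<omega>) \<Rightarrow> ennreal (indicator {0<..} s * (s * exp (- s) * \<rho> s) * exp (- S \<omega>))) * f (case x of (s, \<omega>) \<Rightarrow> (s, A \<omega>)) \<partial>(lborel \<Otimes>\<^sub>M M))"
    unfolding independent_pair_measure_def by (simp add: nn_integral_distr nn_integral_density)
  also have "\<dots> = (\<integral>\<^sup>+s. \<integral>\<^sup>+\<omega>. ennreal (indicator {0<..} s * (s * exp (- s) * \<rho> s) * exp (- S \<omega>)) * f (s, A \<omega>) \<partial>M \<partial>lborel)"
    by (subst nn_integral_fst[symmetric]) simp_all
  finally show ?thesis .
qed

text \<open>Write \<open>\<phi>\<close> for the step function. Summing \<open>\<phi>\<close> over all jumps but one subtracts its value at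
  the picked jump, so the left-hand integral is the expectation of
  \<open>exp (- (\<Sum>k. g (A \<omega> k))) * (\<Sum>k. h (A \<omega> k))\<close> with \<open>g s = s + \<phi> s\<close> and
  \<open>h s = s * exp (- u * s + \<phi> s)\<close>. In the differentiated Laplace functional \<open>\<phi>\<close> cancels from the
  factor with \<open>h\<close>, which leaves the product on the right.\<close>

lemma palm_laplace:
  "(\<integral>\<^sup>+p. ennreal (exp (- (real u * fst p + (\<Sum>k. step_function n t (snd p k))))) \<partial>palm_measure)
     = (\<integral>\<^sup>+p. ennreal (exp (- (real u * fst p + (\<Sum>k. step_function n t (snd p k))))) \<partial>independent_pair_measure)"
  "(\<integral>\<^sup>+p. ennreal (exp (- (real u * fst p + (\<Sum>k. step_function n t (snd p k))))) \<partial>palm_measure) < \<infinity>"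
proof -
  define g where "g s = max 0 s + step_function n t s" for s
  define h where "h s = max 0 s * exp (- real u * max 0 s + step_function n t s)" for s
  have tid: "tame (\<lambda>s. max 0 s)" by (rule tame_continuous[where C = 1]) (auto intro!: continuous_intros)
  have g: "tame g" unfolding g_def[abs_def] by (intro tame_add tid tame_step_sum)
  have h: "tame h" unfolding h_def[abs_def] step_function_def by (rule tame_exp_step) (auto simp: pos_rat_pos)
  note [measurable] = tame_measurable[OF g] tame_measurable[OF h]
  obtain C where C: "0 \<le> C" "\<And>s. 0 \<le> s \<Longrightarrow> 0 \<le> h s" "\<And>s. 0 \<le> s \<Longrightarrow> h s \<le> C * s" using tame_bounds[OF h] by blast
  have g_ge: "s \<le> g s" for s unfolding g_def using step_function_nonneg[of n t s] by simp
  have gsum: "(\<Sum>k. g (A \<omega> k)) = S \<omega> + (\<Sum>k. step_function n t (A \<omega> k))" if "ranked (A \<omega>)" for \<omega>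
    unfolding g_def using ranked_nonneg[OF that] by (subst suminf_add[OF ranked_summable sum_count_above(2), symmetric]) (auto simp: that max_def)
  have "(\<integral>\<^sup>+p. ennreal (exp (- (real u * fst p + (\<Sum>k. step_function n t (snd p k))))) \<partial>palm_measure)
     = (\<integral>\<^sup>+\<omega>. ennreal (exp (- (\<Sum>k. g (A \<omega> k))) * (\<Sum>k. h (A \<omega> k))) \<partial>M)"
  proof (subst nn_integral_palm_measure)
    show "(\<integral>\<^sup>+\<omega>. (\<Sum>k. ennreal (A \<omega> k * exp (- S \<omega>)) * ennreal (exp (- (real u * fst (A \<omega> k, delete k (A \<omega>)) + (\<Sum>ka. step_function n t (snd (A \<omega> k, delete k (A \<omega>)) ka)))))) \<partial>M)
      = (\<integral>\<^sup>+\<omega>. ennreal (exp (- (\<Sum>k. g (A \<omega> k))) * (\<Sum>k. h (A \<omega> k))) \<partial>M)"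
    proof (rule nn_integral_cong_AE)
      show "AE \<omega> in M. (\<Sum>k. ennreal (A \<omega> k * exp (- S \<omega>)) * ennreal (exp (- (real u * fst (A \<omega> k, delete k (A \<omega>)) + (\<Sum>ka. step_function n t (snd (A \<omega> k, delete k (A \<omega>)) ka))))))
          = ennreal (exp (- (\<Sum>k. g (A \<omega> k))) * (\<Sum>k. h (A \<omega> k)))"
        using AE_ranked
      proof eventually_elim
        case (elim \<omega>)
        have sh: "summable (\<lambda>k. h (A \<omega> k))" using C by (intro summable_le_linear(1)[OF elim, where C = C]) simp
        have "ennreal (A \<omega> k * exp (- S \<omega>)) * ennreal (exp (- (real u * A \<omega> k + (\<Sum>j. step_function n t (delete k (A \<omega>) j)))))
            = ennreal (exp (- (\<Sum>k. g (A \<omega> k))) * h (A \<omega> k))" for k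
        proof -
          have "(\<Sum>j. step_function n t (delete k (A \<omega>) j)) = (\<Sum>j. step_function n t (A \<omega> j)) - step_function n t (A \<omega> k)"
            using sums_delete[of "step_function n t" "A \<omega>", OF sum_count_above(2)[OF elim]] by (simp add: sums_iff)
          then have "A \<omega> k * exp (- S \<omega>) * exp (- (real u * A \<omega> k + (\<Sum>j. step_function n t (delete k (A \<omega>) j))))
            = exp (- (\<Sum>k. g (A \<omega> k))) * h (A \<omega> k)"
            using ranked_nonneg[OF elim] unfolding gsum[OF elim] h_def
            by (simp add: max_def exp_add[symmetric] mult.assoc algebra_simps)
          then show ?thesis using ranked_nonneg[OF elim] by (simp add: ennreal_mult[symmetric])
        qed
        then have "(\<Sum>k. ennreal (A \<omega> k * exp (- S \<omega>)) * ennreal (exp (- (real u * fst (A \<omega> k, delete k (A \<omega>)) + (\<Sum>ka. step_function n t (snd (A \<omega> k, delete k (A \<omega>)) ka))))))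
            = (\<Sum>k. ennreal (exp (- (\<Sum>k. g (A \<omega> k))) * h (A \<omega> k)))" by simp
        also have "\<dots> = ennreal (\<Sum>k. exp (- (\<Sum>k. g (A \<omega> k))) * h (A \<omega> k))"
          using C ranked_nonneg[OF elim] sh by (intro suminf_ennreal2 summable_mult) auto
        also have "(\<Sum>k. exp (- (\<Sum>k. g (A \<omega> k))) * h (A \<omega> k)) = exp (- (\<Sum>k. g (A \<omega> k))) * (\<Sum>k. h (A \<omega> k))"
          by (rule suminf_mult[OF sh])
        finally show ?case .
      qed
    qed
  qed simp
  also have "\<dots> = ennreal (expectation (\<lambda>\<omega>. exp (- (\<Sum>k. g (A \<omega> k))) * (\<Sum>k. h (A \<omega> k))))"
  proof (rule nn_integral_eq_integral)
    show "integrable M (\<lambda>\<omega>. exp (- (\<Sum>k. g (A \<omega> k))) * (\<Sum>k. h (A \<omega> k)))"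
      by (rule mecke_laplace(2)[OF g _ h]) (rule g_ge)
    show "AE \<omega> in M. 0 \<le> exp (- (\<Sum>k. g (A \<omega> k))) * (\<Sum>k. h (A \<omega> k))"
      using AE_ranked
    proof eventually_elim
      case (elim \<omega>)
      have "0 \<le> (\<Sum>k. h (A \<omega> k))"
        using C ranked_nonneg[OF elim] by (intro suminf_nonneg summable_le_linear(1)[OF elim, where C = C]) auto
      then show ?case by simp
    qed
  qed
  also have "expectation (\<lambda>\<omega>. exp (- (\<Sum>k. g (A \<omega> k))) * (\<Sum>k. h (A \<omega> k)))
      = expectation (\<lambda>\<omega>. exp (- (\<Sum>k. g (A \<omega> k)))) * levy_integral (\<lambda>s. s * exp (- s) * exp (- real u * s))"
  proof -
    have "levy_integral (\<lambda>s. exp (- g s) * h s) = levy_integral (\<lambda>s. s * exp (- s) * exp (- real u * s))"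
    proof (rule levy_integral_cong)
      fix s :: real assume s: "0 < s"
      have "exp (- g s) * h s = s * (exp (- (s + step_function n t s)) * exp (- real u * s + step_function n t s))"
        using s by (simp add: g_def h_def max_def mult_ac)
      also have "exp (- (s + step_function n t s)) * exp (- real u * s + step_function n t s) = exp (- s) * exp (- real u * s)"
        by (simp add: exp_add[symmetric])
      finally show "exp (- g s) * h s = s * exp (- s) * exp (- real u * s)" by (simp only: mult.assoc)
    qed
    then show ?thesis using mecke_laplace(1)[OF g _ h] g_ge laplace_functional[OF g] by simp
  qed
  finally have L: "(\<integral>\<^sup>+p. ennreal (exp (- (real u * fst p + (\<Sum>k. step_function n t (snd p k))))) \<partial>palm_measure)
    = ennreal (expectation (\<lambda>\<omega>. exp (- (\<Sum>k. g (A \<omega> k)))) * levy_integral (\<lambda>s. s * exp (- s) * exp (- real u * s)))" .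
  then show "(\<integral>\<^sup>+p. ennreal (exp (- (real u * fst p + (\<Sum>k. step_function n t (snd p k))))) \<partial>palm_measure) < \<infinity>" by simp
  have int: "set_integrable lborel {0<..} (\<lambda>s. s * exp (- s) * exp (- real u * s) * \<rho> s)"
  proof (rule integrable_dominated[where C = 1])
    fix s :: real assume s: "0 < s"
    have "s * exp (- s) * exp (- real u * s) \<le> s * exp (- s) * 1" using s by (intro mult_left_mono) auto
    also have "\<dots> \<le> 1 * min 1 s" using mult_exp_minus_le_min[of s] s by simp
    finally show "\<bar>s * exp (- s) * exp (- real u * s)\<bar> \<le> 1 * min 1 s" using s by (simp only: abs_of_nonneg mult_nonneg_nonneg exp_ge_zero less_imp_le)
  qed simp
  have "(\<integral>\<^sup>+p. ennreal (exp (- (real u * fst p + (\<Sum>k. step_function n t (snd p k))))) \<partial>independent_pair_measure)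
    = (\<integral>\<^sup>+s. \<integral>\<^sup>+\<omega>. ennreal (indicator {0<..} s *\<^sub>R (s * exp (- s) * exp (- real u * s) * \<rho> s)) * ennreal (exp (- (\<Sum>k. g (A \<omega> k)))) \<partial>M \<partial>lborel)"
  proof (subst nn_integral_independent_pair_measure)
    show "(\<integral>\<^sup>+s. \<integral>\<^sup>+\<omega>. ennreal (indicator {0<..} s * (s * exp (- s) * \<rho> s) * exp (- S \<omega>)) * ennreal (exp (- (real u * fst (s, A \<omega>) + (\<Sum>k. step_function n t (snd (s, A \<omega>) k))))) \<partial>M \<partial>lborel)
      = (\<integral>\<^sup>+s. \<integral>\<^sup>+\<omega>. ennreal (indicator {0<..} s *\<^sub>R (s * exp (- s) * exp (- real u * s) * \<rho> s)) * ennreal (exp (- (\<Sum>k. g (A \<omega> k)))) \<partial>M \<partial>lborel)"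
    proof (rule nn_integral_cong, rule nn_integral_cong_AE)
      fix s :: real
      show "AE \<omega> in M. ennreal (indicator {0<..} s * (s * exp (- s) * \<rho> s) * exp (- S \<omega>)) * ennreal (exp (- (real u * fst (s, A \<omega>) + (\<Sum>k. step_function n t (snd (s, A \<omega>) k)))))
         = ennreal (indicator {0<..} s *\<^sub>R (s * exp (- s) * exp (- real u * s) * \<rho> s)) * ennreal (exp (- (\<Sum>k. g (A \<omega> k))))"
        using AE_ranked
      proof eventually_elim
        case (elim \<omega>)
        show ?case unfolding gsum[OF elim] using density_nonneg[of s]
          by (auto simp: ennreal_mult[symmetric] exp_minus_add mult_ac split: split_indicator simp del: minus_add_distrib)
      qed
    qed
  qed simp
  also have "\<dots> = (\<integral>\<^sup>+s. ennreal (indicator {0<..} s *\<^sub>R (s * exp (- s) * exp (- real u * s) * \<rho> s)) \<partial>lborel) * (\<integral>\<^sup>+\<omega>. ennreal (exp (- (\<Sum>k. g (A \<omega> k)))) \<partial>M)"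
    by (simp add: nn_integral_cmult nn_integral_multc)
  also have "(\<integral>\<^sup>+s. ennreal (indicator {0<..} s *\<^sub>R (s * exp (- s) * exp (- real u * s) * \<rho> s)) \<partial>lborel) = ennreal (levy_integral (\<lambda>s. s * exp (- s) * exp (- real u * s)))"
    unfolding levy_integral_def set_lebesgue_integral_def
    using int density_nonneg by (intro nn_integral_eq_integral) (auto simp: set_integrable_def split: split_indicator)
  also have "(\<integral>\<^sup>+\<omega>. ennreal (exp (- (\<Sum>k. g (A \<omega> k)))) \<partial>M) = ennreal (expectation (\<lambda>\<omega>. exp (- (\<Sum>k. g (A \<omega> k)))))"
  proof (intro nn_integral_eq_integral integrable_const_bound[where B = 1])
    show "AE \<omega> in M. norm (exp (- (\<Sum>k. g (A \<omega> k)))) \<le> 1" using AE_ranked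
    proof eventually_elim
      case (elim \<omega>)
      have "0 \<le> S \<omega> + (\<Sum>k. step_function n t (A \<omega> k))"
        by (intro add_nonneg_nonneg suminf_nonneg ranked_summable sum_count_above(2) elim ranked_nonneg step_function_nonneg)
      then show ?case by (simp add: gsum[OF elim])
    qed
  qed simp_all
  also have "ennreal (levy_integral (\<lambda>s. s * exp (- s) * exp (- real u * s))) * ennreal (expectation (\<lambda>\<omega>. exp (- (\<Sum>k. g (A \<omega> k)))))
     = ennreal (expectation (\<lambda>\<omega>. exp (- (\<Sum>k. g (A \<omega> k)))) * levy_integral (\<lambda>s. s * exp (- s) * exp (- real u * s)))"
    by (subst ennreal_mult[symmetric]) (auto intro!: levy_integral_nonneg integral_nonneg_AE simp: mult.commute)
  finally show "(\<integral>\<^sup>+p. ennreal (exp (- (real u * fst p + (\<Sum>k. step_function n t (snd p k))))) \<partial>palm_measure)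
     = (\<integral>\<^sup>+p. ennreal (exp (- (real u * fst p + (\<Sum>k. step_function n t (snd p k))))) \<partial>independent_pair_measure)"
    unfolding L by simp
qed

lemma palm_measure_eq: "palm_measure = independent_pair_measure"
proof (rule ranked_law_unique)
  have e: "emeasure m (space m) = (\<integral>\<^sup>+p. ennreal (exp (- (real 0 * fst p + (\<Sum>k. step_function 0 (\<lambda>_. 0) (snd p k))))) \<partial>m)" for m
    by (simp add: step_function_def)
  show "finite_measure palm_measure"
    by (rule finite_measureI) (use palm_laplace(2)[of 0 0 "\<lambda>_. 0"] in \<open>simp add: e del: of_nat_0\<close>)
  show "finite_measure independent_pair_measure"
    by (rule finite_measureI) (use palm_laplace[of 0 0 "\<lambda>_. 0"] in \<open>simp add: e del: of_nat_0\<close>)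
  show "sets palm_measure = sets (borel \<Otimes>\<^sub>M seq_space)" "sets independent_pair_measure = sets (borel \<Otimes>\<^sub>M seq_space)"
    by (simp_all add: palm_measure_def independent_pair_measure_def)
  have [measurable]: "Measurable.pred (borel \<Otimes>\<^sub>M seq_space) (\<lambda>p. ranked (snd p))"
    by (rule measurable_compose[OF measurable_snd ranked_measurable])
  (* Almost everywhere statements are proved by integrating the indicator of the exceptional set. *)
  let ?bad = "\<lambda>p. if 0 \<le> (fst p :: real) \<and> ranked (snd p) then 0 else 1 :: ennreal"
  have "Measurable.pred (borel \<Otimes>\<^sub>M seq_space) (\<lambda>p. 0 \<le> (fst p :: real))" by measurable
  then have "Measurable.pred (borel \<Otimes>\<^sub>M seq_space) (\<lambda>p. 0 \<le> (fst p :: real) \<and> ranked (snd p))"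
    by (intro pred_intros_logic \<open>Measurable.pred _ (\<lambda>p. ranked (snd p))\<close>) assumption
  then have bad [measurable]: "?bad \<in> borel_measurable (borel \<Otimes>\<^sub>M seq_space)"
    by (intro measurable_If) (simp_all add: pred_def)
  have ae: "AE p in m. 0 \<le> fst p \<and> ranked (snd p)"
    if "sets m = sets (borel \<Otimes>\<^sub>M seq_space)" "(\<integral>\<^sup>+p. ?bad p \<partial>m) = 0" for m
  proof -
    note that(1)[measurable_cong]
    have "AE p in m. ?bad p = 0" using that(2) by (subst (asm) nn_integral_0_iff_AE) simp_all
    then show ?thesis by eventually_elim (auto split: if_splits)
  qed
  show "AE p in palm_measure. 0 \<le> fst p \<and> ranked (snd p)"
  proof (rule ae)
    have "(\<integral>\<^sup>+p. ?bad p \<partial>palm_measure) = (\<integral>\<^sup>+\<omega>. 0 \<partial>M)"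
      unfolding nn_integral_palm_measure[OF bad]
    proof (rule nn_integral_cong_AE)
      show "AE \<omega> in M. (\<Sum>k. ennreal (A \<omega> k * exp (- S \<omega>)) * ?bad (A \<omega> k, delete k (A \<omega>))) = 0"
        using AE_ranked by eventually_elim (simp add: ranked_nonneg ranked_delete)
    qed
    then show "(\<integral>\<^sup>+p. ?bad p \<partial>palm_measure) = 0" by simp
  qed (simp add: palm_measure_def)
  show "AE p in independent_pair_measure. 0 \<le> fst p \<and> ranked (snd p)"
  proof (rule ae)
    have "(\<integral>\<^sup>+p. ?bad p \<partial>independent_pair_measure) = (\<integral>\<^sup>+(s :: real). \<integral>\<^sup>+\<omega>. 0 \<partial>M \<partial>lborel)"
      unfolding nn_integral_independent_pair_measure[OF bad]
    proof (rule nn_integral_cong, rule nn_integral_cong_AE)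
      fix s :: real
      show "AE \<omega> in M. ennreal (indicator {0<..} s * (s * exp (- s) * \<rho> s) * exp (- S \<omega>)) * ?bad (s, A \<omega>) = 0"
        using AE_ranked by eventually_elim (auto split: split_indicator)
    qed
    then show "(\<integral>\<^sup>+p. ?bad p \<partial>independent_pair_measure) = 0" by simp
  qed (simp add: independent_pair_measure_def)
  show "(\<integral>\<^sup>+p. ennreal (exp (- (real u * fst p + (\<Sum>k. step_function n t (snd p k))))) \<partial>palm_measure)
     = (\<integral>\<^sup>+p. ennreal (exp (- (real u * fst p + (\<Sum>k. step_function n t (snd p k))))) \<partial>independent_pair_measure)" for u n t
    by (rule palm_laplace)
qed

text \<open>Dividing out the weights \<open>exp (- S)\<close> in the equality of the two finite
  measures gives the formula for all nonnegative functions.\<close>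

theorem mecke_formula:
  assumes [measurable]: "H \<in> borel_measurable (borel \<Otimes>\<^sub>M seq_space)"
  shows "(\<integral>\<^sup>+\<omega>. (\<Sum>k. ennreal (A \<omega> k) * H (A \<omega> k, delete k (A \<omega>))) \<partial>M)
    = (\<integral>\<^sup>+s. \<integral>\<^sup>+\<omega>. ennreal (indicator {0<..} s * (s * \<rho> s)) * H (s, A \<omega>) \<partial>M \<partial>lborel)"
proof -
  define f where "f p = H p * ennreal (exp (fst p + suminf (snd p)))" for p
  have [measurable]: "f \<in> borel_measurable (borel \<Otimes>\<^sub>M seq_space)" unfolding f_def by measurable
  have c: "ennreal (x * exp (- y)) * (h * ennreal (exp y)) = ennreal x * h" for x y h
  proof -
    have "ennreal (x * exp (- y)) * (h * ennreal (exp y)) = (ennreal x * ennreal (exp (- y)) * ennreal (exp y)) * h"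
      by (simp add: ennreal_mult'' mult_ac)
    also have "ennreal x * ennreal (exp (- y)) * ennreal (exp y) = ennreal x"
      by (simp add: mult.assoc ennreal_mult[symmetric] exp_add[symmetric])
    finally show ?thesis .
  qed
  have "(\<integral>\<^sup>+\<omega>. (\<Sum>k. ennreal (A \<omega> k) * H (A \<omega> k, delete k (A \<omega>))) \<partial>M) = (\<integral>\<^sup>+p. f p \<partial>palm_measure)"
    unfolding nn_integral_palm_measure[OF \<open>f \<in> _\<close>]
  proof (rule nn_integral_cong_AE)
    show "AE \<omega> in M. (\<Sum>k. ennreal (A \<omega> k) * H (A \<omega> k, delete k (A \<omega>))) = (\<Sum>k. ennreal (A \<omega> k * exp (- S \<omega>)) * f (A \<omega> k, delete k (A \<omega>)))"
      using AE_ranked by eventually_elim (simp add: f_def suminf_delete c)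
  qed
  also have "\<dots> = (\<integral>\<^sup>+p. f p \<partial>independent_pair_measure)" by (simp add: palm_measure_eq)
  also have "\<dots> = (\<integral>\<^sup>+s. \<integral>\<^sup>+\<omega>. ennreal (indicator {0<..} s * (s * \<rho> s)) * H (s, A \<omega>) \<partial>M \<partial>lborel)"
    unfolding nn_integral_independent_pair_measure[OF \<open>f \<in> _\<close>]
  proof (intro nn_integral_cong)
    fix s \<omega>
    have "indicator {0<..} s * (s * exp (- s) * \<rho> s) * exp (- S \<omega>) = indicator {0<..} s * (s * \<rho> s) * exp (- (s + S \<omega>))"
      unfolding exp_minus_add by (simp add: mult_ac)
    then show "ennreal (indicator {0<..} s * (s * exp (- s) * \<rho> s) * exp (- S \<omega>)) * f (s, A \<omega>) = ennreal (indicator {0<..} s * (s * \<rho> s)) * H (s, A \<omega>)"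
      by (simp only: f_def fst_conv snd_conv c)
  qed
  finally show ?thesis .
qed

end

section \<open>Exponential tilting and the stable subordinator\<close>

lemma (in poisson_jumps) nn_laplace_functional:
  assumes g: "tame g"
  shows "(\<integral>\<^sup>+\<omega>. ennreal (exp (- (\<Sum>k. g (A \<omega> k)))) \<partial>M) = ennreal (exp (- levy_integral (\<lambda>s. 1 - exp (- g s))))"
proof -
  note [measurable] = tame_measurable[OF g]
  obtain D where D: "0 \<le> D" "\<And>s. 0 \<le> s \<Longrightarrow> 0 \<le> g s" "\<And>s. 0 \<le> s \<Longrightarrow> g s \<le> D * s" using tame_bounds[OF g] by blast
  have "(\<integral>\<^sup>+\<omega>. ennreal (exp (- (\<Sum>k. g (A \<omega> k)))) \<partial>M) = ennreal (expectation (\<lambda>\<omega>. exp (- (\<Sum>k. g (A \<omega> k)))))"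
  proof (intro nn_integral_eq_integral integrable_const_bound[where B = 1])
    show "AE \<omega> in M. norm (exp (- (\<Sum>k. g (A \<omega> k)))) \<le> 1" using AE_ranked
    proof eventually_elim
      case (elim \<omega>)
      have "0 \<le> (\<Sum>k. g (A \<omega> k))"
      proof (rule suminf_nonneg)
        show "summable (\<lambda>k. g (A \<omega> k))" by (rule summable_le_linear(1)[OF elim, where C = D]) (use D in simp)
      qed (use D ranked_nonneg[OF elim] in simp)
      then show ?case by simp
    qed
  qed simp_all
  then show ?thesis by (simp add: laplace_functional[OF g])
qed

lemma tame_linear: "0 \<le> c \<Longrightarrow> tame (\<lambda>s. c * max 0 s)"
  by (rule tame_continuous[where C = c]) (auto intro!: continuous_intros)

lemma (in poisson_jumps) nn_laplace_total:
  assumes "0 \<le> \<theta>"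
  shows "(\<integral>\<^sup>+\<omega>. ennreal (exp (- (\<theta> * S \<omega>))) \<partial>M) = ennreal (exp (- levy_integral (\<lambda>s. 1 - exp (- (\<theta> * s)))))"
proof -
  have "(\<integral>\<^sup>+\<omega>. ennreal (exp (- (\<theta> * S \<omega>))) \<partial>M) = (\<integral>\<^sup>+\<omega>. ennreal (exp (- (\<Sum>k. \<theta> * max 0 (A \<omega> k)))) \<partial>M)"
  proof (rule nn_integral_cong_AE)
    show "AE \<omega> in M. ennreal (exp (- (\<theta> * S \<omega>))) = ennreal (exp (- (\<Sum>k. \<theta> * max 0 (A \<omega> k))))"
      using AE_ranked
    proof eventually_elim
      case (elim \<omega>)
      show ?case using ranked_nonneg[OF elim] suminf_mult[OF ranked_summable[OF elim], of \<theta>] by (simp add: max_def)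
    qed
  qed
  also have "\<dots> = ennreal (exp (- levy_integral (\<lambda>s. 1 - exp (- (\<theta> * max 0 s)))))"
    by (rule nn_laplace_functional[OF tame_linear[OF assms]])
  also have "levy_integral (\<lambda>s. 1 - exp (- (\<theta> * max 0 s))) = levy_integral (\<lambda>s. 1 - exp (- (\<theta> * s)))"
    by (rule levy_integral_cong) simp
  finally show ?thesis .
qed

text \<open>The weight adds \<open>lam * s\<close> to the test function, and
  \<open>(1 - exp (- lam * s - g s)) - (1 - exp (- lam * s)) = (1 - exp (- g s)) * exp (- lam * s)\<close>; so
  the weighted Laplace functional is the one with Levy density \<open>exp (- lam * s) * \<rho> s\<close>.\<close>

theorem exponentially_tilted_jumps:
  fixes M :: "'a measure" and M' :: "'b measure"
  assumes J: "poisson_jumps M A \<rho>" and J': "poisson_jumps M' A' (\<lambda>s. exp (- lam * s) * \<rho> s)" and lam: "0 \<le> lam"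
    and c: "(\<integral>\<^sup>+\<omega>. ennreal (exp (- (lam * suminf (A \<omega>)))) \<partial>M) = ennreal (exp (- c))"
  shows "distr M' seq_space A' = distr (density M (\<lambda>\<omega>. ennreal (exp (c - lam * suminf (A \<omega>))))) seq_space A"
proof -
  interpret J: poisson_jumps M A \<rho> by fact
  interpret J': poisson_jumps M' A' "\<lambda>s. exp (- lam * s) * \<rho> s" by fact
  (* The uniqueness theorem concerns pairs, hence the dummy first component 0. *)
  define \<mu> where "\<mu> = distr M' (borel \<Otimes>\<^sub>M seq_space) (\<lambda>\<omega>. (0 :: real, A' \<omega>))"
  define \<nu> where "\<nu> = distr (density M (\<lambda>\<omega>. ennreal (exp (c - lam * suminf (A \<omega>))))) (borel \<Otimes>\<^sub>M seq_space) (\<lambda>\<omega>. (0 :: real, A \<omega>))"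
  have n\<mu>: "(\<integral>\<^sup>+p. f p \<partial>\<mu>) = (\<integral>\<^sup>+\<omega>. f (0, A' \<omega>) \<partial>M')" if [measurable]: "f \<in> borel_measurable (borel \<Otimes>\<^sub>M seq_space)" for f
    unfolding \<mu>_def by (subst nn_integral_distr) auto
  have n\<nu>: "(\<integral>\<^sup>+p. f p \<partial>\<nu>) = (\<integral>\<^sup>+\<omega>. ennreal (exp (c - lam * suminf (A \<omega>))) * f (0, A \<omega>) \<partial>M)" if [measurable]: "f \<in> borel_measurable (borel \<Otimes>\<^sub>M seq_space)" for f
    unfolding \<nu>_def by (simp add: nn_integral_distr nn_integral_density)
  have lim_c: "exp (- c) = exp (- J.levy_integral (\<lambda>s. 1 - exp (- (lam * s))))"
    using c J.nn_laplace_total[OF lam] by simp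
  then have c_eq: "c = J.levy_integral (\<lambda>s. 1 - exp (- (lam * s)))" by simp
  have lap: "(\<integral>\<^sup>+\<omega>. ennreal (exp (- (\<Sum>k. step_function n t (A' \<omega> k)))) \<partial>M')
     = (\<integral>\<^sup>+\<omega>. ennreal (exp (c - lam * suminf (A \<omega>))) * ennreal (exp (- (\<Sum>k. step_function n t (A \<omega> k)))) \<partial>M)" for n t
  proof -
    let ?g = "\<lambda>s. lam * max 0 s + step_function n t s"
    have tg: "tame ?g" by (intro tame_add tame_linear lam tame_step_sum)
    have "(\<integral>\<^sup>+\<omega>. ennreal (exp (c - lam * suminf (A \<omega>))) * ennreal (exp (- (\<Sum>k. step_function n t (A \<omega> k)))) \<partial>M)
        = (\<integral>\<^sup>+\<omega>. ennreal (exp c) * ennreal (exp (- (\<Sum>k. ?g (A \<omega> k)))) \<partial>M)"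
    proof (rule nn_integral_cong_AE)
      show "AE \<omega> in M. ennreal (exp (c - lam * suminf (A \<omega>))) * ennreal (exp (- (\<Sum>k. step_function n t (A \<omega> k)))) = ennreal (exp c) * ennreal (exp (- (\<Sum>k. ?g (A \<omega> k))))"
        using J.AE_ranked
      proof eventually_elim
        case (elim \<omega>)
        have "(\<Sum>k. ?g (A \<omega> k)) = lam * suminf (A \<omega>) + (\<Sum>k. step_function n t (A \<omega> k))"
          using ranked_nonneg[OF elim] sum_count_above(2)[OF elim] ranked_summable[OF elim]
          by (simp add: max_def suminf_add[symmetric] summable_mult suminf_mult)
        then show ?case by (simp add: ennreal_mult[symmetric] exp_add[symmetric])
      qed
    qed
    also have "\<dots> = ennreal (exp c) * ennreal (exp (- J.levy_integral (\<lambda>s. 1 - exp (- ?g s))))"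
      using tame_measurable[OF tg] by (subst nn_integral_cmult) (simp_all add: J.nn_laplace_functional[OF tg])
    also have "\<dots> = ennreal (exp (- (J.levy_integral (\<lambda>s. 1 - exp (- ?g s)) - c)))"
      by (simp add: ennreal_mult[symmetric] exp_add[symmetric])
    also have "J.levy_integral (\<lambda>s. 1 - exp (- ?g s)) - c = J'.levy_integral (\<lambda>s. 1 - exp (- step_function n t s))"
    proof -
      have "c = J.levy_integral (\<lambda>s. 1 - exp (- (lam * max 0 s)))"
        unfolding c_eq by (rule J.levy_integral_cong) simp
      then have "J.levy_integral (\<lambda>s. 1 - exp (- ?g s)) - c = J.levy_integral (\<lambda>s. (1 - exp (- ?g s)) - (1 - exp (- (lam * max 0 s))))"
        using J.levy_integral_diff[OF J.tame_integrable[OF tg] J.tame_integrable[OF tame_linear[OF lam]]] by simp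
      also have "\<dots> = J.levy_integral (\<lambda>s. (1 - exp (- step_function n t s)) * exp (- lam * s))"
        by (rule J.levy_integral_cong) (simp add: left_diff_distrib exp_add[symmetric])
      also have "\<dots> = J'.levy_integral (\<lambda>s. 1 - exp (- step_function n t s))"
        unfolding J.levy_integral_def J'.levy_integral_def by (simp only: mult.assoc)
      finally show ?thesis .
    qed
    finally show ?thesis by (simp add: J'.nn_laplace_functional[OF tame_step_sum])
  qed
  have "\<mu> = \<nu>"
  proof (rule ranked_law_unique)
    show s: "sets \<mu> = sets (borel \<Otimes>\<^sub>M seq_space)" "sets \<nu> = sets (borel \<Otimes>\<^sub>M seq_space)" by (simp_all add: \<mu>_def \<nu>_def)
    show fin: "finite_measure \<mu>" unfolding \<mu>_def by (rule J'.finite_measure_distr) simp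
    have "emeasure \<nu> (space \<nu>) = (\<integral>\<^sup>+\<omega>. ennreal (exp (c - lam * suminf (A \<omega>))) \<partial>M)"
      using n\<nu>[of "\<lambda>_. 1"] by simp
    also have "\<dots> = (\<integral>\<^sup>+\<omega>. ennreal (exp (- (\<Sum>k. step_function 0 (\<lambda>_. 0) (A' \<omega> k)))) \<partial>M')"
      unfolding lap by (simp add: step_function_def)
    also have "\<dots> < \<infinity>" by (simp add: J'.nn_laplace_functional[OF tame_step_sum])
    finally show "finite_measure \<nu>" by (intro finite_measureI) simp
    show "AE p in \<mu>. 0 \<le> fst p \<and> ranked (snd p)"
      unfolding \<mu>_def using J'.AE_ranked
      by (subst AE_distr_iff) (auto simp: pred_def[symmetric] intro!: measurable_compose[OF measurable_snd ranked_measurable])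
    show "AE p in \<nu>. 0 \<le> fst p \<and> ranked (snd p)"
      unfolding \<nu>_def using J.AE_ranked
      by (subst AE_distr_iff) (auto simp: AE_density pred_def[symmetric] intro!: measurable_compose[OF measurable_snd ranked_measurable] elim: eventually_mono)
    show "(\<integral>\<^sup>+p. ennreal (exp (- (real u * fst p + (\<Sum>k. step_function n t (snd p k))))) \<partial>\<mu>) =
        (\<integral>\<^sup>+p. ennreal (exp (- (real u * fst p + (\<Sum>k. step_function n t (snd p k))))) \<partial>\<nu>)" for u n t
      by (subst n\<mu>, simp, subst n\<nu>, simp) (simp add: lap)
  qed
  then have "distr \<mu> seq_space snd = distr \<nu> seq_space snd" by simp
  then show ?thesis unfolding \<mu>_def \<nu>_def by (simp add: distr_distr comp_def)
qed

lemma nn_integral_powr_exp: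
  assumes a: "0 < a" and u: "0 < u"
  shows "(\<integral>\<^sup>+x. ennreal (indicator {0<..} x * (x powr (a - 1) * exp (- (u * x)))) \<partial>lborel) = ennreal (Gamma a * u powr (- a))"
proof -
  have "(\<integral>\<^sup>+x. ennreal (indicator {0<..} x * (x powr (a - 1) * exp (- (u * x)))) \<partial>lborel)
      = \<bar>1 / u\<bar> * (\<integral>\<^sup>+x. ennreal (indicator {0<..} (0 + (1 / u) * x) * ((0 + (1 / u) * x) powr (a - 1) * exp (- (u * (0 + (1 / u) * x))))) \<partial>lborel)"
    using u by (intro nn_integral_real_affine) auto
  also have "(\<integral>\<^sup>+x. ennreal (indicator {0<..} (0 + (1 / u) * x) * ((0 + (1 / u) * x) powr (a - 1) * exp (- (u * (0 + (1 / u) * x))))) \<partial>lborel)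
      = (\<integral>\<^sup>+x. ennreal (u powr (1 - a)) * ennreal (indicator {0..} x * x powr (a - 1) / exp x) \<partial>lborel)"
  proof (intro nn_integral_cong)
    fix x :: real
    have "(1 / u * x) powr (a - 1) = u powr (1 - a) * x powr (a - 1)" if "0 < x"
      using u that by (simp add: powr_divide powr_minus_divide[symmetric] powr_diff divide_simps)
    then show "ennreal (indicator {0<..} (0 + (1 / u) * x) * ((0 + (1 / u) * x) powr (a - 1) * exp (- (u * (0 + (1 / u) * x)))))
        = ennreal (u powr (1 - a)) * ennreal (indicator {0..} x * x powr (a - 1) / exp x)"
      using u by (cases "x = 0"; cases "0 < x") (auto simp: ennreal_mult[symmetric] exp_minus divide_simps zero_less_divide_iff)
  qed
  also have "\<dots> = ennreal (u powr (1 - a)) * ennreal (Gamma a)"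
    by (subst nn_integral_cmult) (simp_all add: Gamma_conv_nn_integral_real[OF a])
  also have "ennreal \<bar>1 / u\<bar> * (ennreal (u powr (1 - a)) * ennreal (Gamma a)) = ennreal (Gamma a * u powr (- a))"
    using u Gamma_real_pos[OF a] by (simp add: ennreal_mult[symmetric] powr_diff powr_minus field_simps)
  finally show ?thesis .
qed

lemma nn_integral_one_minus_exp:
  assumes s: "0 < s" and \<theta>: "0 \<le> \<theta>"
  shows "(\<integral>\<^sup>+u. ennreal (s * exp (- (u * s))) * indicator {0..\<theta>} u \<partial>lborel) = ennreal (1 - exp (- (\<theta> * s)))"
proof -
  have "(\<integral>\<^sup>+u. ennreal (s * exp (- (u * s))) * indicator {0..\<theta>} u \<partial>lborel) = ennreal ((- exp (- (\<theta> * s))) - (- exp (- (0 * s))))"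
    using s \<theta> by (intro nn_integral_FTC_Icc) (auto intro!: derivative_eq_intros)
  then show ?thesis by simp
qed

lemma nn_integral_powr_from_0:
  assumes a: "-1 < a" and c: "0 \<le> c"
  shows "(\<integral>\<^sup>+u. ennreal (u powr a) * indicator {0..c} u \<partial>lborel) = ennreal (c powr (a + 1) / (a + 1))"
proof -
  have "(\<integral>\<^sup>+u. ennreal (u powr a) * indicator {0..c} u \<partial>lborel) = (\<integral>\<^sup>+u. ennreal (indicator {0..c} u * u powr a) \<partial>lborel)"
    by (intro nn_integral_cong) (auto split: split_indicator)
  also have "\<dots> = ennreal (c powr (a + 1) / (a + 1))"
    using nn_integral_has_integral_lebesgue[OF _ has_integral_powr_from_0[OF a c]] by simp
  finally show ?thesis .
qed

text \<open>With \<open>1 - exp (- \<theta> * s)\<close> written as the integral of \<open>s * exp (- u * s)\<close> over \<open>u\<close> from 0 to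
  \<open>\<theta>\<close>, the integral over \<open>s\<close> is a Gamma integral, which leaves the integral of
  \<open>\<alpha> * u powr (\<alpha> - 1)\<close>.\<close>

lemma stable_laplace_exponent_nn:
  assumes \<alpha>: "0 < \<alpha>" "\<alpha> < 1" and \<theta>: "0 \<le> \<theta>"
  shows "(\<integral>\<^sup>+s. ennreal (indicator {0<..} s * ((1 - exp (- (\<theta> * s))) * stable_levy_density \<alpha> s)) \<partial>lborel) = ennreal (\<theta> powr \<alpha>)"
proof -
  define c where "c = \<alpha> / Gamma (1 - \<alpha>)"
  have G: "0 < Gamma (1 - \<alpha>)" using \<alpha> by (intro Gamma_real_pos) auto
  have c: "0 < c" using \<alpha> G by (simp add: c_def)
  have "(\<integral>\<^sup>+s. ennreal (indicator {0<..} s * ((1 - exp (- (\<theta> * s))) * stable_levy_density \<alpha> s)) \<partial>lborel)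
     = (\<integral>\<^sup>+s. \<integral>\<^sup>+u. ennreal (c * (indicator {0<..} s * (s powr ((1 - \<alpha>) - 1) * exp (- (u * s))))) * indicator {0..\<theta>} u \<partial>lborel \<partial>lborel)"
  proof (rule nn_integral_cong)
    fix s :: real
    show "ennreal (indicator {0<..} s * ((1 - exp (- (\<theta> * s))) * stable_levy_density \<alpha> s))
      = (\<integral>\<^sup>+u. ennreal (c * (indicator {0<..} s * (s powr ((1 - \<alpha>) - 1) * exp (- (u * s))))) * indicator {0..\<theta>} u \<partial>lborel)"
    proof (cases "0 < s")
      case True
      have "(\<integral>\<^sup>+u. ennreal (c * (indicator {0<..} s * (s powr ((1 - \<alpha>) - 1) * exp (- (u * s))))) * indicator {0..\<theta>} u \<partial>lborel)
         = (\<integral>\<^sup>+u. ennreal (stable_levy_density \<alpha> s) * (ennreal (s * exp (- (u * s))) * indicator {0..\<theta>} u) \<partial>lborel)"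
      proof (rule nn_integral_cong)
        fix u
        have "s powr (- \<alpha>) = s powr (- \<alpha> - 1) * s" using True by (simp add: powr_diff)
        then have eq: "c * (s powr ((1 - \<alpha>) - 1) * exp (- (u * s))) = stable_levy_density \<alpha> s * (s * exp (- (u * s)))"
          by (simp add: c_def stable_levy_density_def mult_ac)
        have pos: "0 \<le> stable_levy_density \<alpha> s" "0 \<le> s * exp (- (u * s))" using \<alpha> G True by (simp_all add: stable_levy_density_def)
        have e: "indicator {0<..} s = (1 :: real)" using True by simp
        show "ennreal (c * (indicator {0<..} s * (s powr ((1 - \<alpha>) - 1) * exp (- (u * s))))) * indicator {0..\<theta>} u
          = ennreal (stable_levy_density \<alpha> s) * (ennreal (s * exp (- (u * s))) * indicator {0..\<theta>} u)"
          by (simp only: e mult_1_left eq ennreal_mult[OF pos] mult.assoc)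
      qed
      also have "\<dots> = ennreal (stable_levy_density \<alpha> s) * ennreal (1 - exp (- (\<theta> * s)))"
        by (subst nn_integral_cmult) (simp_all add: nn_integral_one_minus_exp[OF True \<theta>])
      also have "\<dots> = ennreal (indicator {0<..} s * ((1 - exp (- (\<theta> * s))) * stable_levy_density \<alpha> s))"
        using True \<alpha> \<theta> G by (subst ennreal_mult[symmetric]) (auto simp: stable_levy_density_def mult_ac)
      finally show ?thesis by simp
    qed simp
  qed
  also have "\<dots> = (\<integral>\<^sup>+u. \<integral>\<^sup>+s. ennreal (c * (indicator {0<..} s * (s powr ((1 - \<alpha>) - 1) * exp (- (u * s))))) * indicator {0..\<theta>} u \<partial>lborel \<partial>lborel)"
    by (rule lborel_pair.Fubini') measurable
  also have "\<dots> = (\<integral>\<^sup>+u. ennreal \<alpha> * (ennreal (u powr (\<alpha> - 1)) * indicator {0..\<theta>} u) \<partial>lborel)"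
  proof (rule nn_integral_cong_AE)
    show "AE u in lborel. (\<integral>\<^sup>+s. ennreal (c * (indicator {0<..} s * (s powr ((1 - \<alpha>) - 1) * exp (- (u * s))))) * indicator {0..\<theta>} u \<partial>lborel)
        = ennreal \<alpha> * (ennreal (u powr (\<alpha> - 1)) * indicator {0..\<theta>} u)"
      using AE_lborel_singleton[of 0]
    proof eventually_elim
      case (elim u)
      show ?case
      proof (cases "0 < u")
        case True
        have "(\<integral>\<^sup>+s. ennreal (c * (indicator {0<..} s * (s powr ((1 - \<alpha>) - 1) * exp (- (u * s))))) * indicator {0..\<theta>} u \<partial>lborel)
           = (\<integral>\<^sup>+s. ennreal c * ennreal (indicator {0<..} s * (s powr ((1 - \<alpha>) - 1) * exp (- (u * s)))) \<partial>lborel) * indicator {0..\<theta>} u"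
          using c by (subst nn_integral_multc) (auto simp: ennreal_mult)
        also have "\<dots> = ennreal c * ennreal (Gamma (1 - \<alpha>) * u powr (- (1 - \<alpha>))) * indicator {0..\<theta>} u"
        proof -
          have "0 < 1 - \<alpha>" using \<alpha> by simp
          have m: "(\<lambda>s. ennreal (indicator {0<..} s * (s powr ((1 - \<alpha>) - 1) * exp (- (u * s))))) \<in> borel_measurable lborel"
            by measurable
          show ?thesis unfolding nn_integral_cmult[OF m] nn_integral_powr_exp[OF \<open>0 < 1 - \<alpha>\<close> True] ..
        qed
        also have "ennreal c * ennreal (Gamma (1 - \<alpha>) * u powr (- (1 - \<alpha>))) = ennreal \<alpha> * ennreal (u powr (\<alpha> - 1))"
          using c G less_imp_neq[OF G] \<alpha> by (simp add: ennreal_mult[symmetric] c_def)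
        finally show ?thesis by (simp add: mult.assoc)
      next
        case False
        with elim have "u \<notin> {0..\<theta>}" by auto
        then show ?thesis by simp
      qed
    qed
  qed
  also have "\<dots> = ennreal \<alpha> * ennreal (\<theta> powr (\<alpha> - 1 + 1) / (\<alpha> - 1 + 1))"
    using \<alpha> \<theta> by (subst nn_integral_cmult) (auto simp: nn_integral_powr_from_0[of "\<alpha> - 1" \<theta>])
  also have "\<dots> = ennreal (\<theta> powr \<alpha>)"
    using \<alpha> by (simp add: ennreal_mult[symmetric])
  finally show ?thesis .
qed

lemma stable_jumps_laplace_total:
  assumes \<alpha>: "0 < \<alpha>" "\<alpha> < 1" and J: "poisson_jumps M A (stable_levy_density \<alpha>)" and \<theta>: "0 \<le> \<theta>"
  shows "(\<integral>\<^sup>+\<omega>. ennreal (exp (- (\<theta> * suminf (A \<omega>)))) \<partial>M) = ennreal (exp (- (\<theta> powr \<alpha>)))"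
proof -
  interpret poisson_jumps M A "stable_levy_density \<alpha>" by fact
  have "levy_integral (\<lambda>s. 1 - exp (- (\<theta> * s))) = \<theta> powr \<alpha>"
    unfolding levy_integral_def set_lebesgue_integral_def
    using stable_laplace_exponent_nn[OF \<alpha> \<theta>] density_nonneg \<theta>
    by (subst integral_eq_nn_integral) (auto split: split_indicator simp: AE_I2)
  then show ?thesis using nn_laplace_total[OF \<theta>] by simp
qed

lemma stable_total_mass_law:
  assumes \<alpha>: "0 < \<alpha>" "\<alpha> < 1" and J: "poisson_jumps M A (stable_levy_density \<alpha>)" and f: "stable_density \<alpha> f"
  shows "distr M borel (\<lambda>\<omega>. suminf (A \<omega>)) = density lborel (\<lambda>t. ennreal (f t))"
proof (rule laplace_transform_unique)
  interpret poisson_jumps M A "stable_levy_density \<alpha>" by fact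
  have f': "f \<in> borel_measurable borel" "\<And>t. 0 \<le> f t" "\<And>t. t \<le> 0 \<Longrightarrow> f t = 0"
    "\<And>\<theta>. 0 \<le> \<theta> \<Longrightarrow> (\<integral>\<^sup>+t. ennreal (exp (- \<theta> * t) * f t) \<partial>lborel) = ennreal (exp (- (\<theta> powr \<alpha>)))"
    using f by (auto simp: stable_density_def)
  note f'(1)[measurable]
  show "finite_measure (distr M borel (\<lambda>\<omega>. suminf (A \<omega>)))" by (rule finite_measure_distr) simp
  show "finite_measure (density lborel (\<lambda>t. ennreal (f t)))"
    using f'(4)[of 0] by (intro finite_measureI) (simp add: emeasure_density)
  show "AE x in distr M borel (\<lambda>\<omega>. suminf (A \<omega>)). 0 \<le> x"
  proof (subst AE_distr_iff)
    show "AE \<omega> in M. 0 \<le> suminf (A \<omega>)"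
      using AE_ranked by eventually_elim (intro suminf_nonneg ranked_summable ranked_nonneg)
  qed simp_all
  show "AE x in density lborel (\<lambda>t. ennreal (f t)). 0 \<le> x"
  proof (subst AE_density)
    have "0 < ennreal (f x) \<Longrightarrow> 0 \<le> x" for x using f'(3)[of x] by (cases "x \<le> 0") auto
    then show "AE x in lborel. 0 < ennreal (f x) \<longrightarrow> 0 \<le> x" by simp
  qed simp
  fix n :: nat
  have "(\<integral>\<^sup>+x. ennreal (exp (- real n * x)) \<partial>distr M borel (\<lambda>\<omega>. suminf (A \<omega>))) = (\<integral>\<^sup>+\<omega>. ennreal (exp (- (real n * suminf (A \<omega>)))) \<partial>M)"
    by (subst nn_integral_distr) auto
  also have "\<dots> = (\<integral>\<^sup>+t. ennreal (exp (- real n * t) * f t) \<partial>lborel)"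
    using stable_jumps_laplace_total[OF \<alpha> J, of "real n"] f'(4)[of "real n"] by simp
  also have "\<dots> = (\<integral>\<^sup>+x. ennreal (exp (- real n * x)) \<partial>density lborel (\<lambda>t. ennreal (f t)))"
    using f'(2) by (subst nn_integral_density) (auto intro!: nn_integral_cong simp: ennreal_mult[symmetric] mult.commute)
  finally show "(\<integral>\<^sup>+x. ennreal (exp (- real n * x)) \<partial>distr M borel (\<lambda>\<omega>. suminf (A \<omega>))) = (\<integral>\<^sup>+x. ennreal (exp (- real n * x)) \<partial>density lborel (\<lambda>t. ennreal (f t)))" .
qed simp_all

lemma normalized_measurable [measurable]: "normalized \<in> seq_space \<rightarrow>\<^sub>M seq_space"
  unfolding normalized_def[abs_def] total_mass_def by (intro measurable_seq_spaceI) measurable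

lemma total_mass_measurable [measurable]: "total_mass \<in> borel_measurable seq_space"
  unfolding total_mass_def[abs_def] by measurable

text \<open>The mixing density is the density of the total mass times \<open>exp (lam powr \<alpha> - lam * t)\<close>, a
  function of the total mass alone, so undoing the disintegration puts this weight on the original
  probability space.\<close>

lemma tilted_PD_eq:
  assumes M: "prob_space M" and A[measurable]: "A \<in> M \<rightarrow>\<^sub>M seq_space"
    and f[measurable]: "f \<in> borel_measurable borel" and f0: "\<And>t. 0 \<le> f t" "\<And>t. t \<le> 0 \<Longrightarrow> f t = 0"
    and law: "distr M borel (\<lambda>\<omega>. total_mass (A \<omega>)) = density lborel (\<lambda>t. ennreal (f t))"
    and K: "conditional_law M seq_space (\<lambda>\<omega>. normalized (A \<omega>)) (\<lambda>\<omega>. total_mass (A \<omega>)) K"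
  shows "tilted_PD \<alpha> lam f K = distr (density M (\<lambda>\<omega>. ennreal (exp (lam powr \<alpha> - lam * total_mass (A \<omega>))))) seq_space (\<lambda>\<omega>. normalized (A \<omega>))"
proof (rule measure_eqI)
  let ?w = "\<lambda>t. ennreal (exp (lam powr \<alpha> - lam * t))"
  let ?D = "density lborel (\<lambda>t. ennreal (exp (lam powr \<alpha>) * exp (- lam * t) * f t) * indicator {0<..} t)"
  have Kp[measurable]: "K \<in> borel \<rightarrow>\<^sub>M prob_algebra seq_space" using K by (simp add: conditional_law_def)
  have Ks: "K \<in> ?D \<rightarrow>\<^sub>M subprob_algebra seq_space" using measurable_prob_algebraD[OF Kp] by simp
  have Ksets: "sets (K t) = sets seq_space" for t using measurable_space[OF Kp, of t] by (simp add: space_prob_algebra)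
  show s: "sets (tilted_PD \<alpha> lam f K) = sets (distr (density M (\<lambda>\<omega>. ?w (total_mass (A \<omega>)))) seq_space (\<lambda>\<omega>. normalized (A \<omega>)))"
    unfolding tilted_PD_def by (simp add: sets_bind[OF Ksets])
  fix B assume "B \<in> sets (tilted_PD \<alpha> lam f K)"
  then have B[measurable]: "B \<in> sets seq_space" using s by simp
  have KB[measurable]: "(\<lambda>t. emeasure (K t) B) \<in> borel_measurable borel"
    using measurable_emeasure_kernel[OF measurable_prob_algebraD[OF Kp] B] .
  let ?m1 = "distr (density M (\<lambda>\<omega>. indicator B (normalized (A \<omega>)))) borel (\<lambda>\<omega>. total_mass (A \<omega>))"
  let ?m2 = "density (distr M borel (\<lambda>\<omega>. total_mass (A \<omega>))) (\<lambda>t. emeasure (K t) B)"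
  have m12: "?m1 = ?m2"
  proof (rule measure_eqI)
    fix C assume "C \<in> sets ?m1"
    then have C[measurable]: "C \<in> sets borel" by simp
    have "emeasure ?m1 C = emeasure (density M (\<lambda>\<omega>. indicator B (normalized (A \<omega>)))) ((\<lambda>\<omega>. total_mass (A \<omega>)) -` C \<inter> space M)"
      by (simp add: emeasure_distr)
    also have "\<dots> = (\<integral>\<^sup>+\<omega>. indicator B (normalized (A \<omega>)) * indicator ((\<lambda>\<omega>. total_mass (A \<omega>)) -` C \<inter> space M) \<omega> \<partial>M)"
      by (rule emeasure_density) measurable
    also have "\<dots> = (\<integral>\<^sup>+\<omega>. indicator {\<omega> \<in> space M. normalized (A \<omega>) \<in> B \<and> total_mass (A \<omega>) \<in> C} \<omega> \<partial>M)"
      by (rule nn_integral_cong) (auto split: split_indicator)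
    also have "\<dots> = emeasure M {\<omega> \<in> space M. normalized (A \<omega>) \<in> B \<and> total_mass (A \<omega>) \<in> C}"
      by (rule nn_integral_indicator) measurable
    also have "\<dots> = (\<integral>\<^sup>+t\<in>C. emeasure (K t) B \<partial>distr M borel (\<lambda>\<omega>. total_mass (A \<omega>)))"
      using K B C by (simp add: conditional_law_def)
    also have "\<dots> = emeasure ?m2 C" by (subst emeasure_density) auto
    finally show "emeasure ?m1 C = emeasure ?m2 C" .
  qed simp
  have "emeasure (tilted_PD \<alpha> lam f K) B = (\<integral>\<^sup>+t. emeasure (K t) B \<partial>?D)"
    unfolding tilted_PD_def by (rule emeasure_bind[OF _ Ks B]) simp
  also have "\<dots> = (\<integral>\<^sup>+t. (ennreal (exp (lam powr \<alpha>) * exp (- lam * t) * f t) * indicator {0<..} t) * emeasure (K t) B \<partial>lborel)"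
    by (rule nn_integral_density) auto
  also have "\<dots> = (\<integral>\<^sup>+t. ennreal (f t) * (?w t * emeasure (K t) B) \<partial>lborel)"
  proof (rule nn_integral_cong)
    fix t
    have "ennreal (exp (lam powr \<alpha>) * exp (- lam * t) * f t) * indicator {0<..} t = ennreal (f t) * ?w t"
      using f0(1)[of t] f0(2)[of t] by (cases "0 < t") (auto simp: ennreal_mult[symmetric] exp_add[symmetric] mult.commute)
    then show "(ennreal (exp (lam powr \<alpha>) * exp (- lam * t) * f t) * indicator {0<..} t) * emeasure (K t) B = ennreal (f t) * (?w t * emeasure (K t) B)"
      by (simp add: mult.assoc)
  qed
  also have "\<dots> = (\<integral>\<^sup>+t. ?w t * emeasure (K t) B \<partial>distr M borel (\<lambda>\<omega>. total_mass (A \<omega>)))"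
    unfolding law by (rule nn_integral_density[symmetric]) auto
  also have "\<dots> = (\<integral>\<^sup>+t. ?w t \<partial>?m2)" by (subst nn_integral_density) (auto simp: mult.commute)
  also have "\<dots> = (\<integral>\<^sup>+t. ?w t \<partial>?m1)" by (simp add: m12)
  also have "\<dots> = (\<integral>\<^sup>+\<omega>. indicator B (normalized (A \<omega>)) * ?w (total_mass (A \<omega>)) \<partial>M)"
    by (simp add: nn_integral_distr nn_integral_density)
  also have "\<dots> = emeasure (distr (density M (\<lambda>\<omega>. ?w (total_mass (A \<omega>)))) seq_space (\<lambda>\<omega>. normalized (A \<omega>))) B"
    by (subst emeasure_distr, simp, simp, subst emeasure_density) (auto intro!: nn_integral_cong split: split_indicator simp: mult.commute)
  finally show "emeasure (tilted_PD \<alpha> lam f K) B = emeasure (distr (density M (\<lambda>\<omega>. ?w (total_mass (A \<omega>)))) seq_space (\<lambda>\<omega>. normalized (A \<omega>))) B" .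
qed

section \<open>Size-biased picking\<close>

text \<open>The conditional expectation, given the masses \<open>p\<close>, of the product of the functions \<open>\<phi>s\<close>
  of the next size-biased picks, when the indices in \<open>J\<close> have been picked already.\<close>

primrec picks_expectation :: "(real \<Rightarrow> ennreal) list \<Rightarrow> nat set \<Rightarrow> (nat \<Rightarrow> real) \<Rightarrow> ennreal" where
  "picks_expectation [] J p = 1"
| "picks_expectation (\<phi> # \<phi>s) J p = (\<Sum>i. ennreal (pick_prob p J i) * (\<phi> (p i) * picks_expectation \<phi>s (insert i J) p))"

lemma pick_prob_measurable [measurable]: "(\<lambda>p. pick_prob p J i) \<in> borel_measurable seq_space"
  unfolding pick_prob_def by (cases "i \<in> J") simp_all

lemma picks_expectation_measurable [measurable (raw)]:
  assumes "\<And>\<phi>. \<phi> \<in> set \<phi>s \<Longrightarrow> \<phi> \<in> borel_measurable borel"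
  shows "picks_expectation \<phi>s J \<in> borel_measurable seq_space"
  using assms
proof (induction \<phi>s arbitrary: J)
  case Nil
  then show ?case by simp
next
  case (Cons \<phi> \<phi>s)
  have [measurable]: "\<phi> \<in> borel_measurable borel" "\<And>J. picks_expectation \<phi>s J \<in> borel_measurable seq_space"
    using Cons by auto
  show ?case by simp
qed

lemma size_biased_rearrangement_measurable:
  assumes P: "P \<in> N \<rightarrow>\<^sub>M seq_space" and Pt: "size_biased_rearrangement N P Pt"
  shows "Pt \<in> N \<rightarrow>\<^sub>M seq_space"
proof (rule measurable_seq_spaceI)
  fix n
  from Pt obtain I :: "nat \<Rightarrow> 'a \<Rightarrow> nat" where I: "I n \<in> N \<rightarrow>\<^sub>M count_space UNIV" "\<forall>\<omega>\<in>space N. Pt \<omega> n = P \<omega> (I n \<omega>)"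
    unfolding size_biased_rearrangement_def by blast
  have "(\<lambda>\<omega>. P \<omega> (I n \<omega>)) \<in> borel_measurable N"
    by (rule measurable_compose_countable[where f = "\<lambda>i \<omega>. P \<omega> i", OF _ I(1)]) (rule measurable_compose[OF P measurable_component_singleton], simp)
  then show "(\<lambda>\<omega>. Pt \<omega> n) \<in> borel_measurable N"
    using I(2) by (simp cong: measurable_cong)
qed

text \<open>Induction on the number of picks still to come: the event that the earlier picks have prescribed
  indices is carried along, and the law of one pick given the masses and the earlier picks peels off
  the next factor.\<close>

lemma size_biased_picks_expectation:
  assumes N: "prob_space N" and P[measurable]: "P \<in> N \<rightarrow>\<^sub>M seq_space"
    and Pt: "size_biased_rearrangement N P Pt"
    and \<phi>s: "\<And>\<phi>. \<phi> \<in> set \<phi>s \<Longrightarrow> \<phi> \<in> borel_measurable borel"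
  shows "(\<integral>\<^sup>+\<omega>. (\<Prod>l<length \<phi>s. (\<phi>s ! l) (Pt \<omega> l)) \<partial>N) = (\<integral>\<^sup>+p. picks_expectation \<phi>s {} p \<partial>distr N seq_space P)"
proof -
  define law where "law I \<longleftrightarrow>
        (\<forall>n. I n \<in> N \<rightarrow>\<^sub>M count_space UNIV) \<and>
        (\<forall>\<omega>\<in>space N. \<forall>n. Pt \<omega> n = P \<omega> (I n \<omega>)) \<and>
        (\<forall>B\<in>sets seq_space. \<forall>n (j :: nat \<Rightarrow> nat) i.
           emeasure N {\<omega> \<in> space N. (P \<omega> \<in> B \<and> (\<forall>m<n. I m \<omega> = j m)) \<and> I n \<omega> = i} =
           (\<integral>\<^sup>+\<omega>\<in>{\<omega> \<in> space N. P \<omega> \<in> B \<and> (\<forall>m<n. I m \<omega> = j m)}.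
              ennreal (pick_prob (P \<omega>) (j ` {..<n}) i) \<partial>N))" for I :: "nat \<Rightarrow> 'a \<Rightarrow> nat"
  have "\<exists>I. law I" using Pt unfolding size_biased_rearrangement_def law_def .
  then obtain I where law: "law I" by blast
  have I[measurable]: "I n \<in> N \<rightarrow>\<^sub>M count_space UNIV" for n
    using law unfolding law_def by blast
  have Pt_eq: "Pt \<omega> n = P \<omega> (I n \<omega>)" if "\<omega> \<in> space N" for \<omega> n
    using law that unfolding law_def by blast
  have pick: "emeasure N {\<omega> \<in> space N. (P \<omega> \<in> B \<and> (\<forall>m<n. I m \<omega> = j m)) \<and> I n \<omega> = i} =
       (\<integral>\<^sup>+\<omega>\<in>{\<omega> \<in> space N. P \<omega> \<in> B \<and> (\<forall>m<n. I m \<omega> = j m)}. ennreal (pick_prob (P \<omega>) (j ` {..<n}) i) \<partial>N)"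
    if "B \<in> sets seq_space" for B n i and j :: "nat \<Rightarrow> nat"
    by (rule law[unfolded law_def, THEN conjunct2, THEN conjunct2, THEN bspec, OF that, THEN spec, THEN spec, THEN spec])
  (* the indicator of the event that the first n picks have the indices j *)
  define E where "E n j \<omega> = (if \<forall>m<n. I m \<omega> = j m then 1 else 0 :: ennreal)" for n j \<omega>
  have [measurable]: "E n j \<in> borel_measurable N" for n j unfolding E_def[abs_def] by measurable
  have step: "(\<integral>\<^sup>+\<omega>. E n j \<omega> * (if I n \<omega> = i then 1 else 0) * H (P \<omega>) \<partial>N)
     = (\<integral>\<^sup>+\<omega>. E n j \<omega> * ennreal (pick_prob (P \<omega>) (j ` {..<n}) i) * H (P \<omega>) \<partial>N)"
    if H[measurable]: "H \<in> borel_measurable seq_space" for n j i H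
  proof -
    let ?m1 = "distr (density N (\<lambda>\<omega>. E n j \<omega> * (if I n \<omega> = i then 1 else 0))) seq_space P"
    let ?m2 = "distr (density N (\<lambda>\<omega>. E n j \<omega> * ennreal (pick_prob (P \<omega>) (j ` {..<n}) i))) seq_space P"
    have d: "emeasure (distr (density N w) seq_space P) B = (\<integral>\<^sup>+\<omega>. w \<omega> * indicator B (P \<omega>) \<partial>N)"
      if [measurable]: "w \<in> borel_measurable N" "B \<in> sets seq_space" for w B
    proof -
      have "emeasure (distr (density N w) seq_space P) B = emeasure (density N w) (P -` B \<inter> space N)"
        by (simp add: emeasure_distr)
      also have "\<dots> = (\<integral>\<^sup>+\<omega>. w \<omega> * indicator (P -` B \<inter> space N) \<omega> \<partial>N)"
        by (rule emeasure_density) measurable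
      also have "\<dots> = (\<integral>\<^sup>+\<omega>. w \<omega> * indicator B (P \<omega>) \<partial>N)"
        by (rule nn_integral_cong) (auto split: split_indicator)
      finally show ?thesis .
    qed
    have "?m1 = ?m2"
    proof (rule measure_eqI)
      fix B assume "B \<in> sets ?m1"
      then have B[measurable]: "B \<in> sets seq_space" by simp
      have "emeasure ?m1 B = (\<integral>\<^sup>+\<omega>. indicator {\<omega> \<in> space N. (P \<omega> \<in> B \<and> (\<forall>m<n. I m \<omega> = j m)) \<and> I n \<omega> = i} \<omega> \<partial>N)"
        by (subst d, measurable, rule nn_integral_cong) (auto simp: E_def split: split_indicator)
      also have "\<dots> = emeasure N {\<omega> \<in> space N. (P \<omega> \<in> B \<and> (\<forall>m<n. I m \<omega> = j m)) \<and> I n \<omega> = i}"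
        by (rule nn_integral_indicator) measurable
      also have "\<dots> = (\<integral>\<^sup>+\<omega>\<in>{\<omega> \<in> space N. P \<omega> \<in> B \<and> (\<forall>m<n. I m \<omega> = j m)}. ennreal (pick_prob (P \<omega>) (j ` {..<n}) i) \<partial>N)"
        by (rule pick[OF B])
      also have "\<dots> = emeasure ?m2 B"
        by (subst d, measurable, rule nn_integral_cong) (auto simp: E_def split: split_indicator)
      finally show "emeasure ?m1 B = emeasure ?m2 B" .
    qed simp
    then have "(\<integral>\<^sup>+p. H p \<partial>?m1) = (\<integral>\<^sup>+p. H p \<partial>?m2)" by simp
    then show ?thesis by (simp add: nn_integral_distr nn_integral_density)
  qed
  have main: "(\<integral>\<^sup>+\<omega>. E n j \<omega> * H (P \<omega>) * (\<Prod>l<length \<phi>s. (\<phi>s ! l) (P \<omega> (I (n + l) \<omega>))) \<partial>N)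
      = (\<integral>\<^sup>+\<omega>. E n j \<omega> * H (P \<omega>) * picks_expectation \<phi>s (j ` {..<n}) (P \<omega>) \<partial>N)"
    if "H \<in> borel_measurable seq_space" "\<And>\<phi>. \<phi> \<in> set \<phi>s \<Longrightarrow> \<phi> \<in> borel_measurable borel" for n j H \<phi>s
    using that
  proof (induction \<phi>s arbitrary: n j H)
    case Nil
    then show ?case by simp
  next
    case (Cons \<phi> \<phi>s)
    note [measurable] = Cons.prems(1)
    have \<phi>m[measurable]: "\<phi> \<in> borel_measurable borel" using Cons.prems by simp
    have \<phi>sm: "\<And>\<psi>. \<psi> \<in> set \<phi>s \<Longrightarrow> \<psi> \<in> borel_measurable borel" using Cons.prems by simp
    have nthm[measurable]: "\<phi>s ! l \<in> borel_measurable borel" if "l < length \<phi>s" for l using \<phi>sm that by simp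
    have pm[measurable]: "picks_expectation \<phi>s J \<in> borel_measurable seq_space" for J
      by (rule picks_expectation_measurable[OF \<phi>sm])
    have PIm[measurable]: "(\<lambda>\<omega>. P \<omega> (I k \<omega>)) \<in> borel_measurable N" for k
      by (rule measurable_compose_countable[where f = "\<lambda>i \<omega>. P \<omega> i" and g = "I k"]) measurable
    let ?F = "\<lambda>\<omega>. \<Prod>l<length \<phi>s. (\<phi>s ! l) (P \<omega> (I (Suc n + l) \<omega>))"
    have Fm[measurable]: "?F \<in> borel_measurable N"
      by (intro borel_measurable_prod_ennreal measurable_compose[OF PIm]) simp
    have Esuc: "E n j \<omega> * (if I n \<omega> = i then 1 else 0) = E (Suc n) (j(n := i)) \<omega>" for i \<omega>
      by (auto simp: E_def less_Suc_eq)
    have img: "(j(n := i)) ` {..<Suc n} = insert i (j ` {..<n})" for i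
      by (auto simp: lessThan_Suc)
    have "(\<integral>\<^sup>+\<omega>. E n j \<omega> * H (P \<omega>) * (\<Prod>l<length (\<phi> # \<phi>s). ((\<phi> # \<phi>s) ! l) (P \<omega> (I (n + l) \<omega>))) \<partial>N)
       = (\<integral>\<^sup>+\<omega>. (\<Sum>i. E (Suc n) (j(n := i)) \<omega> * (H (P \<omega>) * \<phi> (P \<omega> i)) * ?F \<omega>) \<partial>N)"
    proof (rule nn_integral_cong)
      fix \<omega>
      have "(\<Prod>l<length (\<phi> # \<phi>s). ((\<phi> # \<phi>s) ! l) (P \<omega> (I (n + l) \<omega>))) = \<phi> (P \<omega> (I n \<omega>)) * ?F \<omega>"
        by (simp add: prod.lessThan_Suc_shift del: prod.lessThan_Suc)
      moreover have "(\<Sum>i. E (Suc n) (j(n := i)) \<omega> * (H (P \<omega>) * \<phi> (P \<omega> i)) * ?F \<omega>) = (\<Sum>i\<in>{I n \<omega>}. E (Suc n) (j(n := i)) \<omega> * (H (P \<omega>) * \<phi> (P \<omega> i)) * ?F \<omega>)"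
        by (rule suminf_finite) (auto simp: Esuc[symmetric])
      moreover have "E (Suc n) (j(n := I n \<omega>)) \<omega> = E n j \<omega>" by (simp add: Esuc[symmetric])
      ultimately show "E n j \<omega> * H (P \<omega>) * (\<Prod>l<length (\<phi> # \<phi>s). ((\<phi> # \<phi>s) ! l) (P \<omega> (I (n + l) \<omega>)))
          = (\<Sum>i. E (Suc n) (j(n := i)) \<omega> * (H (P \<omega>) * \<phi> (P \<omega> i)) * ?F \<omega>)"
        by (simp add: mult.assoc)
    qed
    also have "\<dots> = (\<Sum>i. \<integral>\<^sup>+\<omega>. E (Suc n) (j(n := i)) \<omega> * (H (P \<omega>) * \<phi> (P \<omega> i)) * ?F \<omega> \<partial>N)"
      by (rule nn_integral_suminf) measurable
    also have "\<dots> = (\<Sum>i. \<integral>\<^sup>+\<omega>. E (Suc n) (j(n := i)) \<omega> * (H (P \<omega>) * \<phi> (P \<omega> i)) * picks_expectation \<phi>s (insert i (j ` {..<n})) (P \<omega>) \<partial>N)"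
    proof (rule suminf_cong)
      fix i
      show "(\<integral>\<^sup>+\<omega>. E (Suc n) (j(n := i)) \<omega> * (H (P \<omega>) * \<phi> (P \<omega> i)) * ?F \<omega> \<partial>N) = (\<integral>\<^sup>+\<omega>. E (Suc n) (j(n := i)) \<omega> * (H (P \<omega>) * \<phi> (P \<omega> i)) * picks_expectation \<phi>s (insert i (j ` {..<n})) (P \<omega>) \<partial>N)"
      proof -
        have "(\<lambda>p. H p * \<phi> (p i)) \<in> borel_measurable seq_space" by measurable
        from Cons.IH[OF this \<phi>sm, of "Suc n" "j(n := i)"] show ?thesis unfolding img .
      qed
    qed
    also have "\<dots> = (\<Sum>i. \<integral>\<^sup>+\<omega>. E n j \<omega> * ennreal (pick_prob (P \<omega>) (j ` {..<n}) i) * (H (P \<omega>) * \<phi> (P \<omega> i) * picks_expectation \<phi>s (insert i (j ` {..<n})) (P \<omega>)) \<partial>N)"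
    proof (rule suminf_cong)
      fix i
      show "(\<integral>\<^sup>+\<omega>. E (Suc n) (j(n := i)) \<omega> * (H (P \<omega>) * \<phi> (P \<omega> i)) * picks_expectation \<phi>s (insert i (j ` {..<n})) (P \<omega>) \<partial>N)
        = (\<integral>\<^sup>+\<omega>. E n j \<omega> * ennreal (pick_prob (P \<omega>) (j ` {..<n}) i) * (H (P \<omega>) * \<phi> (P \<omega> i) * picks_expectation \<phi>s (insert i (j ` {..<n})) (P \<omega>)) \<partial>N)"
        using step[of "\<lambda>p. H p * \<phi> (p i) * picks_expectation \<phi>s (insert i (j ` {..<n})) p" n j i]
        by (simp add: Esuc mult.assoc)
    qed
    also have "\<dots> = (\<integral>\<^sup>+\<omega>. (\<Sum>i. E n j \<omega> * ennreal (pick_prob (P \<omega>) (j ` {..<n}) i) * (H (P \<omega>) * \<phi> (P \<omega> i) * picks_expectation \<phi>s (insert i (j ` {..<n})) (P \<omega>))) \<partial>N)"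
      by (rule nn_integral_suminf[symmetric]) measurable
    also have "\<dots> = (\<integral>\<^sup>+\<omega>. E n j \<omega> * H (P \<omega>) * picks_expectation (\<phi> # \<phi>s) (j ` {..<n}) (P \<omega>) \<partial>N)"
      unfolding picks_expectation.simps ennreal_suminf_cmult[symmetric] by (simp only: mult_ac)
    finally show ?case .
  qed
  have "(\<integral>\<^sup>+\<omega>. (\<Prod>l<length \<phi>s. (\<phi>s ! l) (Pt \<omega> l)) \<partial>N) = (\<integral>\<^sup>+\<omega>. E 0 (\<lambda>_. 0) \<omega> * 1 * (\<Prod>l<length \<phi>s. (\<phi>s ! l) (P \<omega> (I (0 + l) \<omega>))) \<partial>N)"
    by (intro nn_integral_cong) (simp add: Pt_eq E_def)
  also have "\<dots> = (\<integral>\<^sup>+\<omega>. E 0 (\<lambda>_. 0) \<omega> * 1 * picks_expectation \<phi>s ((\<lambda>_. 0) ` {..<0 :: nat}) (P \<omega>) \<partial>N)"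
    by (rule main[of "\<lambda>_. 1"]) (use \<phi>s in auto)
  also have "\<dots> = (\<integral>\<^sup>+p. picks_expectation \<phi>s {} p \<partial>distr N seq_space P)"
    using picks_expectation_measurable[OF \<phi>s] by (subst nn_integral_distr) (simp_all add: E_def)
  finally show ?thesis .
qed

text \<open>The same expectation, computed for unnormalized masses \<open>a\<close> from which each picked mass is
  deleted. The functions are to be evaluated at masses relative to the initial total, and \<open>c\<close> is
  the proportion of that total which remains. In this form a pick is followed by picks from a new
  sequence, as required for an induction based on the Mecke formula.\<close>

primrec deletion_expectation :: "(real \<Rightarrow> ennreal) list \<Rightarrow> real \<Rightarrow> (nat \<Rightarrow> real) \<Rightarrow> ennreal" where
  "deletion_expectation [] c a = 1"
| "deletion_expectation (\<phi> # \<phi>s) c a = (\<Sum>k. ennreal (a k / suminf a) *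
     (\<phi> (c * (a k / suminf a)) * deletion_expectation \<phi>s (c * (1 - a k / suminf a)) (delete k a)))"

lemma deletion_expectation_measurable:
  assumes "\<And>\<phi>. \<phi> \<in> set \<phi>s \<Longrightarrow> \<phi> \<in> borel_measurable borel"
  shows "(\<lambda>p. deletion_expectation \<phi>s (fst p) (snd p)) \<in> borel_measurable (borel \<Otimes>\<^sub>M seq_space)"
  using assms
proof (induction \<phi>s)
  case Nil
  then show ?case by simp
next
  case (Cons \<phi> \<phi>s)
  have [measurable]: "\<phi> \<in> borel_measurable borel" using Cons by auto
  have *: "(\<lambda>p. deletion_expectation \<phi>s (fst p) (snd p)) \<in> borel_measurable (borel \<Otimes>\<^sub>M seq_space)"
    using Cons by auto
  have [measurable]: "(\<lambda>p. deletion_expectation \<phi>s (fst p * (1 - snd p k / suminf (snd p))) (delete k (snd p))) \<in> borel_measurable (borel \<Otimes>\<^sub>M seq_space)" for k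
    using measurable_compose[OF _ *, of "\<lambda>p. (fst p * (1 - snd p k / suminf (snd p)), delete k (snd p))"] by simp
  show ?case by simp
qed

lemma delete_skip: "delete k a = a \<circ> (\<lambda>j. if j < k then j else Suc j)"
  by (auto simp: delete_def fun_eq_iff)

lemma bij_betw_skip: "bij_betw (\<lambda>j. if j < k then j else Suc j) UNIV (- {k :: nat})"
proof (rule bij_betwI[where g = "\<lambda>i. if i < k then i else i - 1"])
qed (auto split: if_splits)

lemma suminf_ennreal_reindex:
  fixes f :: "nat \<Rightarrow> ennreal"
  assumes \<iota>: "bij_betw \<iota> UNIV (- J)" and J: "\<And>i. i \<in> J \<Longrightarrow> f i = 0"
  shows "(\<Sum>k. f (\<iota> k)) = (\<Sum>i. f i)"
proof -
  have "(\<Sum>i. f i) = (\<integral>\<^sup>+i. f i \<partial>count_space UNIV)" by (simp add: nn_integral_count_space_nat)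
  also have "\<dots> = (\<integral>\<^sup>+i. f i * indicator (- J) i \<partial>count_space UNIV)"
    using J by (intro nn_integral_cong) (auto split: split_indicator)
  also have "\<dots> = (\<integral>\<^sup>+i. f i \<partial>count_space (- J))"
    by (simp add: nn_integral_count_space_indicator)
  also have "\<dots> = (\<integral>\<^sup>+k. f (\<iota> k) \<partial>count_space UNIV)"
    by (rule nn_integral_bij_count_space[OF \<iota>, symmetric])
  finally show ?thesis by (simp add: nn_integral_count_space_nat)
qed

text \<open>The map \<open>\<iota>\<close> enumerates the indices not yet picked. If no mass remains, both sides give weight 0
  to every further pick, because \<open>x / 0 = 0\<close>.\<close>

lemma deletion_expectation_eq_picks:
  assumes a: "ranked a" "0 < suminf a" and J: "finite J" and \<iota>: "bij_betw \<iota> UNIV (- J)"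
    and s: "summable (a \<circ> \<iota>)" "suminf (a \<circ> \<iota>) = suminf a - (\<Sum>i\<in>J. a i)"
  shows "deletion_expectation \<phi>s (suminf (a \<circ> \<iota>) / suminf a) (a \<circ> \<iota>) = picks_expectation \<phi>s J (normalized a)"
  using J \<iota> s
proof (induction \<phi>s arbitrary: J \<iota>)
  case Nil
  then show ?case by simp
next
  case (Cons \<phi> \<phi>s)
  define T where "T = suminf (a \<circ> \<iota>)"
  have T: "T = suminf a - (\<Sum>i\<in>J. a i)" unfolding T_def by (rule Cons.prems(4))
  have norm: "normalized a i = a i / suminf a" for i by (simp add: normalized_def total_mass_def)
  have rest: "1 - (\<Sum>m\<in>J. normalized a m) = T / suminf a"
    using a(2) by (simp add: norm T sum_divide_distrib[symmetric] diff_divide_distrib)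
  have pick: "pick_prob (normalized a) J i = (if i \<in> J then 0 else a i / T)" for i
    using a(2) unfolding pick_prob_def rest by (simp add: norm)
  define f where "f i = ennreal (pick_prob (normalized a) J i) * (\<phi> (normalized a i) * picks_expectation \<phi>s (insert i J) (normalized a))" for i
  have "deletion_expectation (\<phi> # \<phi>s) (T / suminf a) (a \<circ> \<iota>) = (\<Sum>k. f (\<iota> k))"
    unfolding deletion_expectation.simps
  proof (rule suminf_cong)
    fix k
    have k: "\<iota> k \<notin> J" using Cons.prems(2) by (auto simp: bij_betw_def)
    show "ennreal ((a \<circ> \<iota>) k / suminf (a \<circ> \<iota>)) *
         (\<phi> (T / suminf a * ((a \<circ> \<iota>) k / suminf (a \<circ> \<iota>))) * deletion_expectation \<phi>s (T / suminf a * (1 - (a \<circ> \<iota>) k / suminf (a \<circ> \<iota>))) (delete k (a \<circ> \<iota>))) = f (\<iota> k)"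
    proof (cases "T = 0")
      case True
      then show ?thesis using k unfolding T_def[symmetric] by (simp add: f_def pick)
    next
      case False
      define \<iota>' where "\<iota>' = \<iota> \<circ> (\<lambda>j. if j < k then j else Suc j)"
      have del: "delete k (a \<circ> \<iota>) = a \<circ> \<iota>'" by (simp add: delete_skip \<iota>'_def comp_assoc)
      have sd: "(a \<circ> \<iota>') sums (T - a (\<iota> k))"
        using sums_delete[of "\<lambda>x. x" "a \<circ> \<iota>" k, OF Cons.prems(3)] unfolding del T_def unfolding comp_def .
      have bij': "bij_betw \<iota>' UNIV (- insert (\<iota> k) J)"
      proof -
        have "bij_betw \<iota> (- {k}) (- J - {\<iota> k})"
          using Cons.prems(2) by (auto simp: bij_betw_def inj_on_def)
        then have "bij_betw \<iota>' UNIV (- J - {\<iota> k})"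
          unfolding \<iota>'_def by (rule bij_betw_trans[OF bij_betw_skip])
        moreover have "- J - {\<iota> k} = - insert (\<iota> k) J" by auto
        ultimately show ?thesis by simp
      qed
      have f1: "deletion_expectation \<phi>s (suminf (a \<circ> \<iota>') / suminf a) (a \<circ> \<iota>') = picks_expectation \<phi>s (insert (\<iota> k) J) (normalized a)"
      proof (rule Cons.IH)
        show "finite (insert (\<iota> k) J)" using Cons.prems(1) by simp
        show "summable (a \<circ> \<iota>')" using sd by (rule sums_summable)
        have "sum a (insert (\<iota> k) J) = a (\<iota> k) + sum a J" using Cons.prems(1) k by simp
        then show "suminf (a \<circ> \<iota>') = suminf a - sum a (insert (\<iota> k) J)"
          using sums_unique[OF sd] T by linarith
      qed (rule bij')
      have f2: "T / suminf a * (1 - a (\<iota> k) / T) = suminf (a \<circ> \<iota>') / suminf a"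
      proof -
        have "T * (1 - a (\<iota> k) / T) = T - a (\<iota> k)" using False by (simp add: right_diff_distrib)
        then show ?thesis unfolding sums_unique[OF sd, symmetric] by (simp only: times_divide_eq_left)
      qed
      have f3: "T / suminf a * (a (\<iota> k) / T) = normalized a (\<iota> k)" using False by (simp add: norm)
      show ?thesis unfolding T_def[symmetric] del o_apply f1 f2 f3 f_def pick using k by simp
    qed
  qed
  also have "\<dots> = (\<Sum>i. f i)"
    by (rule suminf_ennreal_reindex[OF Cons.prems(2)]) (simp add: f_def pick)
  also have "(\<Sum>i. f i) = picks_expectation (\<phi> # \<phi>s) J (normalized a)"
    unfolding f_def by (simp only: picks_expectation.simps)
  finally show ?case unfolding T_def .
qed

corollary deletion_expectation_normalized:
  assumes a: "ranked a" "0 < suminf a"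
  shows "deletion_expectation \<phi>s 1 a = picks_expectation \<phi>s {} (normalized a)"
  using deletion_expectation_eq_picks[OF a, of "{}" "\<lambda>i. i" \<phi>s] a ranked_summable[OF a(1)]
  by (simp add: comp_def bij_betw_def)

section \<open>Changes of variables\<close>

text \<open>The substitution rule on compact intervals extends to half-open and
  infinite ranges by monotone convergence.\<close>

lemma nn_integral_substitution_exhaustion:
  fixes f :: "real \<Rightarrow> ennreal"
  assumes [measurable]: "f \<in> borel_measurable borel" "g \<in> borel_measurable borel" "g' \<in> borel_measurable borel"
    and b: "incseq b" "\<And>n. a < b n"
    and deriv: "\<And>n x. a \<le> x \<Longrightarrow> x \<le> b n \<Longrightarrow> (g has_real_derivative g' x) (at x)"
    and cont: "\<And>n. continuous_on {a..b n} g'"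
    and pos: "\<And>n x. a \<le> x \<Longrightarrow> x \<le> b n \<Longrightarrow> 0 \<le> g' x"
  shows "(\<integral>\<^sup>+x. f x * indicator (\<Union>n. {g a..g (b n)}) x \<partial>lborel)
    = (\<integral>\<^sup>+x. f (g x) * ennreal (g' x) * indicator (\<Union>n. {a..b n}) x \<partial>lborel)"
proof -
  have lim: "(\<integral>\<^sup>+x. h x * indicator (\<Union>n. {u..v n}) x \<partial>lborel) = (SUP n. \<integral>\<^sup>+x. h x * indicator {u..v n} x \<partial>lborel)"
    if [measurable]: "h \<in> borel_measurable borel" and v: "incseq v" for h :: "real \<Rightarrow> ennreal" and u and v :: "nat \<Rightarrow> real"
  proof -
    have inc: "incseq (\<lambda>n x. h x * indicator {u..v n} x)"
      using v by (intro incseq_SucI le_funI mult_left_mono)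
        (auto simp: incseq_Suc_iff split: split_indicator intro: order_trans)
    have "(\<integral>\<^sup>+x. h x * indicator (\<Union>n. {u..v n}) x \<partial>lborel) = (\<integral>\<^sup>+x. (SUP n. h x * indicator {u..v n} x) \<partial>lborel)"
    proof (rule nn_integral_cong)
      fix x
      show "h x * indicator (\<Union>n. {u..v n}) x = (SUP n. h x * indicator {u..v n} x)"
      proof (cases "x \<in> (\<Union>n. {u..v n})")
        case True
        then obtain n where n: "x \<in> {u..v n}" by blast
        have "(SUP n. h x * indicator {u..v n} x) = h x"
        proof (rule antisym)
          show "(SUP n. h x * indicator {u..v n} x) \<le> h x"
            by (rule SUP_least) (simp split: split_indicator)
          show "h x \<le> (SUP n. h x * indicator {u..v n} x)"
            using n by (intro SUP_upper2[of n]) auto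
        qed
        with True show ?thesis by simp
      next
        case False
        then have "x \<notin> {u..v n}" for n by blast
        with False show ?thesis by simp
      qed
    qed
    also have "\<dots> = (SUP n. \<integral>\<^sup>+x. h x * indicator {u..v n} x \<partial>lborel)"
      by (rule nn_integral_monotone_convergence_SUP[OF inc]) measurable
    finally show ?thesis .
  qed
  have mono: "g (b m) \<le> g (b n)" if "m \<le> n" for m n
  proof (rule DERIV_nonneg_imp_nondecreasing[where f = g])
    show "b m \<le> b n" using b(1) that by (rule incseqD)
    fix x assume "b m \<le> x" "x \<le> b n"
    moreover have "a \<le> x" using b(2)[of m] \<open>b m \<le> x\<close> by simp
    ultimately show "\<exists>y. (g has_real_derivative y) (at x) \<and> 0 \<le> y" using deriv pos by blast
  qed
  have "(\<integral>\<^sup>+x. f x * indicator (\<Union>n. {g a..g (b n)}) x \<partial>lborel) = (SUP n. \<integral>\<^sup>+x. f x * indicator {g a..g (b n)} x \<partial>lborel)"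
    using mono by (intro lim) (auto simp: incseq_def)
  also have "\<dots> = (SUP n. \<integral>\<^sup>+x. f (g x) * ennreal (g' x) * indicator {a..b n} x \<partial>lborel)"
    using deriv cont pos b by (intro SUP_cong refl nn_integral_substitution_aux) auto
  also have "\<dots> = (\<integral>\<^sup>+x. f (g x) * ennreal (g' x) * indicator (\<Union>n. {a..b n}) x \<partial>lborel)"
    using b by (intro lim[symmetric]) auto
  finally show ?thesis .
qed

text \<open>If the other masses sum to \<open>T\<close>, a mass \<open>s = T * p / (1 - p)\<close> is
  the proportion \<open>p\<close> of the total \<open>s + T\<close>.\<close>

lemma nn_integral_proportion_substitution:
  fixes f :: "real \<Rightarrow> ennreal"
  assumes f[measurable]: "f \<in> borel_measurable borel" and T: "0 < T"
  shows "(\<integral>\<^sup>+s. f s * indicator {0<..} s \<partial>lborel)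
    = (\<integral>\<^sup>+p. f (T * p / (1 - p)) * ennreal (T / (1 - p)\<^sup>2) * indicator {0<..<1} p \<partial>lborel)"
proof -
  define b where "b n = 1 - 1 / (real n + 2)" for n :: nat
  have b: "incseq b" "0 < b n" "b n < 1" for n
    by (auto simp: b_def incseq_def field_simps)
  have U1: "(\<Union>n. {0..b n}) = {0..<1}"
  proof safe
    fix x n assume "x \<in> {0..b n}" then show "x \<in> {0..<1}" using b(3)[of n] by auto
  next
    fix x :: real assume x: "x \<in> {0..<1}"
    then obtain n where "1 / (1 - x) < real n" using reals_Archimedean2 by blast
    then have "1 / (1 - x) \<le> real n + 2" by simp
    then have "1 / (real n + 2) \<le> 1 - x" using x by (simp add: field_simps)
    then show "x \<in> (\<Union>n. {0..b n})" using x by (auto simp: b_def intro!: exI[of _ n])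
  qed
  have U2: "(\<Union>n. {T * 0 / (1 - 0)..T * b n / (1 - b n)}) = {0..}"
  proof -
    have "x \<in> (\<Union>n. {T * 0 / (1 - 0)..T * b n / (1 - b n)})" if x: "0 \<le> x" for x
    proof -
      obtain n where n: "x / T < real n" using reals_Archimedean2 by blast
      have "T * b n / (1 - b n) = T * (real n + 1)" by (simp add: b_def field_simps)
      moreover have "x \<le> T * (real n + 1)" using n T by (simp add: field_simps)
      ultimately have "x \<in> {T * 0 / (1 - 0)..T * b n / (1 - b n)}" using x by simp
      then show ?thesis by blast
    qed
    then show ?thesis by auto
  qed
  have "(\<integral>\<^sup>+s. f s * indicator (\<Union>n. {T * 0 / (1 - 0)..T * b n / (1 - b n)}) s \<partial>lborel)
    = (\<integral>\<^sup>+p. f (T * p / (1 - p)) * ennreal (T / (1 - p)\<^sup>2) * indicator (\<Union>n. {0..b n}) p \<partial>lborel)"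
  proof (rule nn_integral_substitution_exhaustion[where g = "\<lambda>p. T * p / (1 - p)" and g' = "\<lambda>p. T / (1 - p)\<^sup>2"])
    fix n x assume x: "0 \<le> x" "x \<le> b n"
    then have "x < 1" using b(3)[of n] by simp
    then show "((\<lambda>p. T * p / (1 - p)) has_real_derivative T / (1 - x)\<^sup>2) (at x)"
      by (auto intro!: derivative_eq_intros simp: power2_eq_square divide_simps) (simp add: algebra_simps)
    show "0 \<le> T / (1 - x)\<^sup>2" using T by simp
  next
    fix n show "continuous_on {0..b n} (\<lambda>p. T / (1 - p)\<^sup>2)"
      using b(3)[of n] by (intro continuous_intros) auto
  qed (use b in auto)
  then have *: "(\<integral>\<^sup>+s. f s * indicator {0..} s \<partial>lborel) = (\<integral>\<^sup>+p. f (T * p / (1 - p)) * ennreal (T / (1 - p)\<^sup>2) * indicator {0..<1} p \<partial>lborel)"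
    unfolding U1 U2 .
  have "(\<integral>\<^sup>+s. f s * indicator {0<..} s \<partial>lborel) = (\<integral>\<^sup>+s. f s * indicator {0..} s \<partial>lborel)"
    by (rule nn_integral_cong_AE, rule eventually_mono[OF AE_lborel_singleton[of 0]]) (auto split: split_indicator)
  also note *
  also have "(\<integral>\<^sup>+p. f (T * p / (1 - p)) * ennreal (T / (1 - p)\<^sup>2) * indicator {0..<1} p \<partial>lborel)
     = (\<integral>\<^sup>+p. f (T * p / (1 - p)) * ennreal (T / (1 - p)\<^sup>2) * indicator {0<..<1} p \<partial>lborel)"
    by (rule nn_integral_cong_AE, rule eventually_mono[OF AE_lborel_singleton[of 0]]) (auto split: split_indicator)
  finally show ?thesis .
qed

lemma nn_integral_power_substitution:
  fixes f :: "real \<Rightarrow> ennreal"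
  assumes f[measurable]: "f \<in> borel_measurable borel" and lam: "0 < lam" and \<alpha>: "0 < \<alpha>"
  shows "(\<integral>\<^sup>+y. f y * indicator {0..} y \<partial>lborel)
    = (\<integral>\<^sup>+x. f (x powr \<alpha> - lam powr \<alpha>) * ennreal (\<alpha> * x powr (\<alpha> - 1)) * indicator {lam..} x \<partial>lborel)"
proof -
  define b where "b n = lam + real n + 1" for n :: nat
  have b: "incseq b" "lam < b n" for n by (auto simp: b_def incseq_def)
  have U1: "(\<Union>n. {lam..b n}) = {lam..}"
  proof -
    have "x \<in> (\<Union>n. {lam..b n})" if x: "lam \<le> x" for x
    proof -
      obtain n where "x < real n" using reals_Archimedean2 by blast
      then have "x \<in> {lam..b n}" using lam x by (simp add: b_def)
      then show ?thesis by blast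
    qed
    then show ?thesis by auto
  qed
  have U2: "(\<Union>n. {lam powr \<alpha> - lam powr \<alpha>..b n powr \<alpha> - lam powr \<alpha>}) = {0..}"
  proof -
    have "x \<in> (\<Union>n. {lam powr \<alpha> - lam powr \<alpha>..b n powr \<alpha> - lam powr \<alpha>})" if x: "0 \<le> x" for x
    proof -
      define y where "y = x + lam powr \<alpha>"
      have y: "0 \<le> y" using x by (simp add: y_def)
      obtain n where n: "y powr (1 / \<alpha>) < real n" using reals_Archimedean2 by blast
      have "y = (y powr (1 / \<alpha>)) powr \<alpha>" using \<alpha> y by (simp add: powr_powr)
      also have "\<dots> \<le> b n powr \<alpha>" using n lam \<alpha> by (intro powr_mono2) (auto simp: b_def)
      finally have "x \<in> {lam powr \<alpha> - lam powr \<alpha>..b n powr \<alpha> - lam powr \<alpha>}"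
        using x by (simp add: y_def)
      then show ?thesis by blast
    qed
    then show ?thesis by auto
  qed
  have "(\<integral>\<^sup>+y. f y * indicator (\<Union>n. {lam powr \<alpha> - lam powr \<alpha>..b n powr \<alpha> - lam powr \<alpha>}) y \<partial>lborel)
    = (\<integral>\<^sup>+x. f (x powr \<alpha> - lam powr \<alpha>) * ennreal (\<alpha> * x powr (\<alpha> - 1)) * indicator (\<Union>n. {lam..b n}) x \<partial>lborel)"
  proof (rule nn_integral_substitution_exhaustion[where g = "\<lambda>x. x powr \<alpha> - lam powr \<alpha>" and g' = "\<lambda>x. \<alpha> * x powr (\<alpha> - 1)"])
    fix n x assume x: "lam \<le> x" "x \<le> b n"
    then have "0 < x" using lam by simp
    then show "((\<lambda>x. x powr \<alpha> - lam powr \<alpha>) has_real_derivative \<alpha> * x powr (\<alpha> - 1)) (at x)"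
      by (auto intro!: derivative_eq_intros)
    show "0 \<le> \<alpha> * x powr (\<alpha> - 1)" using \<alpha> by simp
  next
    fix n show "continuous_on {lam..b n} (\<lambda>x. \<alpha> * x powr (\<alpha> - 1))"
      using lam by (intro continuous_intros) auto
  qed (use b in auto)
  then show ?thesis unfolding U1 U2 .
qed

text \<open>The Gamma integral with \<open>x\<close> shifted by \<open>z\<close>. It expresses the
  non-exponential dependence on \<open>T\<close> as a mixture of exponential tilts.\<close>

lemma tilted_power_as_mixture:
  assumes \<alpha>: "0 < \<alpha>" and T: "0 < T"
  shows "(\<integral>\<^sup>+x. ennreal (indicator {z<..} x * ((x - z) powr (\<alpha> - 1) * exp (- (x * T)))) \<partial>lborel)
    = ennreal (Gamma \<alpha> * (T powr (- \<alpha>) * exp (- (z * T))))"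
proof -
  have "(\<integral>\<^sup>+x. ennreal (indicator {z<..} x * ((x - z) powr (\<alpha> - 1) * exp (- (x * T)))) \<partial>lborel)
    = ennreal \<bar>1\<bar> * (\<integral>\<^sup>+x. ennreal (indicator {z<..} (z + 1 * x) * (((z + 1 * x) - z) powr (\<alpha> - 1) * exp (- ((z + 1 * x) * T)))) \<partial>lborel)"
    by (rule nn_integral_real_affine) auto
  also have "\<dots> = (\<integral>\<^sup>+x. ennreal (exp (- (z * T))) * ennreal (indicator {0<..} x * (x powr (\<alpha> - 1) * exp (- (T * x)))) \<partial>lborel)"
    unfolding abs_one ennreal_1 mult_1_left
  proof (rule nn_integral_cong)
    fix x
    have "exp (- ((z + x) * T)) = exp (- (z * T)) * exp (- (T * x))"
      unfolding exp_minus_add[symmetric] by (simp add: algebra_simps)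
    then show "ennreal (indicator {z<..} (z + x) * ((z + x - z) powr (\<alpha> - 1) * exp (- ((z + x) * T))))
      = ennreal (exp (- (z * T))) * ennreal (indicator {0<..} x * (x powr (\<alpha> - 1) * exp (- (T * x))))"
      by (simp add: ennreal_mult[symmetric] mult_ac split: split_indicator)
  qed
  also have "\<dots> = ennreal (exp (- (z * T))) * ennreal (Gamma \<alpha> * T powr (- \<alpha>))"
    by (subst nn_integral_cmult) (simp_all add: nn_integral_powr_exp[OF \<alpha> T] del: mult_minus_left)
  also have "\<dots> = ennreal (Gamma \<alpha> * (T powr (- \<alpha>) * exp (- (z * T))))"
    using Gamma_real_pos[OF \<alpha>] by (simp add: ennreal_mult[symmetric] mult_ac)
  finally show ?thesis .
qed

text \<open>The joint density of the fraction \<open>p\<close> of the total mass that is picked and of the tilting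
  parameter \<open>x\<close> of the masses left behind, up to the ratio of the normalizing constants
  \<open>exp (- (lam powr \<alpha>))\<close> and \<open>exp (- (x powr \<alpha>))\<close> of the two tilted laws.\<close>

definition pick_kernel :: "real \<Rightarrow> real \<Rightarrow> real \<Rightarrow> real \<Rightarrow> real" where
  "pick_kernel \<alpha> lam p x = (if 0 < p \<and> p < 1 \<and> lam < (1 - p) * x
     then \<alpha> / (Gamma (1 - \<alpha>) * Gamma \<alpha>) * (p powr (- \<alpha>) * ((1 - p) * x - lam) powr (\<alpha> - 1)) else 0)"

lemma pick_kernel_measurable [measurable (raw)]:
  assumes [measurable]: "u \<in> borel_measurable N" "v \<in> borel_measurable N"
  shows "(\<lambda>x. pick_kernel \<alpha> lam (u x) (v x)) \<in> borel_measurable N"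
  unfolding pick_kernel_def by measurable

text \<open>On the left is the size-biased stable density at the mass \<open>s = T * p / (1 - p)\<close>, times the tilting
  weight over the total \<open>s + T = T / (1 - p)\<close>, times the Jacobian. Collecting powers leaves
  \<open>T powr (- \<alpha>) * exp (- (lam / (1 - p)) * T)\<close>, to which the mixture formula applies with
  \<open>z = lam / (1 - p)\<close>.\<close>

lemma stable_pick_density:
  assumes \<alpha>: "0 < \<alpha>" "\<alpha> < 1" and T: "0 < T" and p: "0 < p" "p < 1"
  shows "ennreal (T * p / (1 - p) * stable_levy_density \<alpha> (T * p / (1 - p)))
      * ennreal (exp (- (lam * (T * p / (1 - p) + T))) / (T * p / (1 - p) + T)) * ennreal (T / (1 - p)\<^sup>2)
    = (\<integral>\<^sup>+x. ennreal (pick_kernel \<alpha> lam p x) * ennreal (exp (- (x * T))) \<partial>lborel)"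
proof -
  define q where "q = 1 - p"
  have q: "0 < q" using p by (simp add: q_def)
  have G: "0 < Gamma (1 - \<alpha>)" "0 < Gamma \<alpha>" using \<alpha> by (auto intro!: Gamma_real_pos)
  define c where "c = \<alpha> / (Gamma (1 - \<alpha>) * Gamma \<alpha>)"
  have c: "0 < c" using \<alpha> G by (simp add: c_def)
  define s where "s = T * p / q"
  have s: "0 < s" using T p q by (simp add: s_def)
  have sT: "s + T = T / q" using q by (simp add: s_def field_simps) (simp add: q_def algebra_simps)
  have "(\<integral>\<^sup>+x. ennreal (pick_kernel \<alpha> lam p x) * ennreal (exp (- (x * T))) \<partial>lborel)
    = (\<integral>\<^sup>+x. ennreal (c * p powr (- \<alpha>) * q powr (\<alpha> - 1)) * ennreal (indicator {lam / q<..} x * ((x - lam / q) powr (\<alpha> - 1) * exp (- (x * T)))) \<partial>lborel)"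
  proof (rule nn_integral_cong)
    fix x
    show "ennreal (pick_kernel \<alpha> lam p x) * ennreal (exp (- (x * T))) = ennreal (c * p powr (- \<alpha>) * q powr (\<alpha> - 1)) * ennreal (indicator {lam / q<..} x * ((x - lam / q) powr (\<alpha> - 1) * exp (- (x * T))))"
    proof (cases "lam < q * x")
      case True
      then have x: "lam / q < x" using q by (simp add: field_simps)
      have "(q * x - lam) powr (\<alpha> - 1) = (q * (x - lam / q)) powr (\<alpha> - 1)" using q by (simp add: right_diff_distrib)
      also have "\<dots> = q powr (\<alpha> - 1) * (x - lam / q) powr (\<alpha> - 1)" using q x by (intro powr_mult) 
      finally have "pick_kernel \<alpha> lam p x = c * p powr (- \<alpha>) * q powr (\<alpha> - 1) * (x - lam / q) powr (\<alpha> - 1)"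
        using True p by (simp add: pick_kernel_def q_def c_def mult_ac)
      then show ?thesis using x c by (simp add: ennreal_mult[symmetric] mult_ac)
    next
      case False
      then have "\<not> lam / q < x" using q by (simp add: field_simps)
      then show ?thesis using False by (simp add: pick_kernel_def q_def)
    qed
  qed
  also have "\<dots> = ennreal (c * p powr (- \<alpha>) * q powr (\<alpha> - 1)) * ennreal (Gamma \<alpha> * (T powr (- \<alpha>) * exp (- (lam / q * T))))"
    by (subst nn_integral_cmult) (simp_all only: tilted_power_as_mixture[OF \<alpha>(1) T], measurable)
  also have "\<dots> = ennreal (c * p powr (- \<alpha>) * q powr (\<alpha> - 1) * (Gamma \<alpha> * (T powr (- \<alpha>) * exp (- (lam / q * T)))))"
    using c G by (simp add: ennreal_mult[symmetric])
  also have "c * p powr (- \<alpha>) * q powr (\<alpha> - 1) * (Gamma \<alpha> * (T powr (- \<alpha>) * exp (- (lam / q * T))))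
    = (s * stable_levy_density \<alpha> s) * (exp (- (lam * (s + T))) / (s + T)) * (T / q\<^sup>2)"
  proof -
    have "s * s powr (- \<alpha> - 1) = s powr (- \<alpha>)" using s by (simp add: powr_diff)
    also have "\<dots> = T powr (- \<alpha>) * p powr (- \<alpha>) * q powr \<alpha>"
      using T p q by (simp add: s_def powr_mult powr_divide powr_minus divide_simps)
    finally have 1: "s * stable_levy_density \<alpha> s = \<alpha> / Gamma (1 - \<alpha>) * (T powr (- \<alpha>) * p powr (- \<alpha>) * q powr \<alpha>)"
      by (simp add: stable_levy_density_def mult_ac)
    have 2: "exp (- (lam * (s + T))) / (s + T) * (T / q\<^sup>2) = exp (- (lam / q * T)) / q"
      unfolding sT using T q by (simp add: power2_eq_square field_simps)
    have 3: "q powr (\<alpha> - 1) = q powr \<alpha> / q" using q by (simp add: powr_diff)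
    have 4: "c * Gamma \<alpha> = \<alpha> / Gamma (1 - \<alpha>)" using G by (simp add: c_def)
    have "(s * stable_levy_density \<alpha> s) * (exp (- (lam * (s + T))) / (s + T)) * (T / q\<^sup>2)
      = (\<alpha> / Gamma (1 - \<alpha>) * (T powr (- \<alpha>) * p powr (- \<alpha>) * q powr \<alpha>)) * (exp (- (lam / q * T)) / q)"
      unfolding 1 2[symmetric] by (simp only: mult.assoc)
    also have "\<dots> = (c * Gamma \<alpha> * (T powr (- \<alpha>) * p powr (- \<alpha>) * q powr \<alpha>)) * (exp (- (lam / q * T)) / q)"
      unfolding 4 ..
    also have "\<dots> = c * p powr (- \<alpha>) * q powr (\<alpha> - 1) * (Gamma \<alpha> * (T powr (- \<alpha>) * exp (- (lam / q * T))))"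
      unfolding 3 by (simp add: mult_ac)
    finally show ?thesis by simp
  qed
  also have "ennreal \<dots> = ennreal (s * stable_levy_density \<alpha> s) * ennreal (exp (- (lam * (s + T))) / (s + T)) * ennreal (T / q\<^sup>2)"
  proof -
    have n: "0 \<le> s * stable_levy_density \<alpha> s" "0 \<le> exp (- (lam * (s + T))) / (s + T)" "0 \<le> T / q\<^sup>2"
      using s T \<alpha> G by (simp_all add: stable_levy_density_def)
    show ?thesis by (simp only: ennreal_mult[OF mult_nonneg_nonneg[OF n(1,2)] n(3)] ennreal_mult[OF n(1,2)])
  qed
  finally show ?thesis unfolding s_def q_def ..
qed

section \<open>Size-biased picks from tilted stable jumps\<close>

lemma measurable_picks_of_deletion:
  assumes "\<And>\<phi>. \<phi> \<in> set \<phi>s \<Longrightarrow> \<phi> \<in> borel_measurable borel"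
    and [measurable]: "u \<in> borel_measurable N" "v \<in> N \<rightarrow>\<^sub>M seq_space"
  shows "(\<lambda>x. deletion_expectation \<phi>s (u x) (v x)) \<in> borel_measurable N"
  using measurable_compose[OF _ deletion_expectation_measurable[OF assms(1)], of "\<lambda>x. (u x, v x)"] by simp

locale stable_jumps = poisson_jumps M A "stable_levy_density \<alpha>"
  for M :: "'a measure" and A \<alpha> +
  assumes \<alpha>: "0 < \<alpha>" "\<alpha> < 1" and S_pos: "AE \<omega> in M. 0 < suminf (A \<omega>)"
begin

text \<open>The expectation of a product of functions of successive picks from stable
  jumps tilted by \<open>lam\<close>, without the normalizing constant \<open>exp (lam powr \<alpha>)\<close>.\<close>

definition tilted_picks :: "(real \<Rightarrow> ennreal) list \<Rightarrow> real \<Rightarrow> real \<Rightarrow> ennreal" where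
  "tilted_picks \<phi>s lam c = (\<integral>\<^sup>+\<omega>. ennreal (exp (- (lam * S \<omega>))) * deletion_expectation \<phi>s c (A \<omega>) \<partial>M)"

lemma tilted_picks_measurable:
  assumes "\<And>\<phi>. \<phi> \<in> set \<phi>s \<Longrightarrow> \<phi> \<in> borel_measurable borel"
    and [measurable]: "u \<in> borel_measurable N" "v \<in> borel_measurable N"
  shows "(\<lambda>x. tilted_picks \<phi>s (u x) (v x)) \<in> borel_measurable N"
proof -
  have [measurable]: "(\<lambda>q. deletion_expectation \<phi>s (v (fst q)) (A (snd q))) \<in> borel_measurable (N \<Otimes>\<^sub>M M)"
    by (rule measurable_picks_of_deletion[OF assms(1)]) simp_all
  have "(\<lambda>q. ennreal (exp (- (u (fst q) * S (snd q)))) * deletion_expectation \<phi>s (v (fst q)) (A (snd q))) \<in> borel_measurable (N \<Otimes>\<^sub>M M)"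
    by measurable
  then have "(\<lambda>(x, \<omega>). ennreal (exp (- (u x * S \<omega>))) * deletion_expectation \<phi>s (v x) (A \<omega>)) \<in> borel_measurable (N \<Otimes>\<^sub>M M)"
    by (simp add: split_beta)
  then show ?thesis unfolding tilted_picks_def by (rule borel_measurable_nn_integral)
qed

lemma tilted_picks_Nil: "0 \<le> lam \<Longrightarrow> tilted_picks [] lam c = ennreal (exp (- (lam powr \<alpha>)))"
  unfolding tilted_picks_def using stable_jumps_laplace_total[OF \<alpha> poisson_jumps_axioms] by simp

text \<open>The Mecke formula separates the picked jump \<open>s\<close> from the rest, which are again stable jumps \<open>A\<close>.
  In the variable \<open>p\<close>, with \<open>s = S * p / (1 - p)\<close>, the density depends on \<open>A\<close> only through a
  mixture of the weights \<open>exp (- x * S)\<close>; so the remaining picks are made from stable jumps tilted by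
  \<open>x\<close>.\<close>

lemma tilted_picks_Cons:
  assumes \<phi>[measurable]: "\<phi> \<in> borel_measurable borel" and \<phi>s: "\<And>\<phi>. \<phi> \<in> set \<phi>s \<Longrightarrow> \<phi> \<in> borel_measurable borel"
  shows "tilted_picks (\<phi> # \<phi>s) lam c
    = (\<integral>\<^sup>+p. \<integral>\<^sup>+x. ennreal (pick_kernel \<alpha> lam p x) * (\<phi> (c * p) * tilted_picks \<phi>s x (c * (1 - p))) \<partial>lborel \<partial>lborel)"
proof -
  note DEm[measurable] = measurable_picks_of_deletion[OF \<phi>s]
  (* the picked mass and the other masses, so that fst q + suminf (snd q) is the total mass *)
  define H where "H q = ennreal (exp (- (lam * (fst q + suminf (snd q)))) / (fst q + suminf (snd q))) *
     (\<phi> (c * (fst q / (fst q + suminf (snd q)))) * deletion_expectation \<phi>s (c * (1 - fst q / (fst q + suminf (snd q)))) (snd q))" for q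
  have Hm[measurable]: "H \<in> borel_measurable (borel \<Otimes>\<^sub>M seq_space)" unfolding H_def by measurable
  have "tilted_picks (\<phi> # \<phi>s) lam c = (\<integral>\<^sup>+\<omega>. (\<Sum>k. ennreal (A \<omega> k) * H (A \<omega> k, delete k (A \<omega>))) \<partial>M)"
    unfolding tilted_picks_def
  proof (rule nn_integral_cong_AE)
    show "AE \<omega> in M. ennreal (exp (- (lam * S \<omega>))) * deletion_expectation (\<phi> # \<phi>s) c (A \<omega>) = (\<Sum>k. ennreal (A \<omega> k) * H (A \<omega> k, delete k (A \<omega>)))"
      using AE_ranked
    proof eventually_elim
      case (elim \<omega>)
      have S0: "0 \<le> S \<omega>" by (intro suminf_nonneg ranked_summable[OF elim] ranked_nonneg[OF elim])
      have e: "A \<omega> k + suminf (delete k (A \<omega>)) = S \<omega>" for k by (simp add: suminf_delete[OF elim])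
      have "ennreal (exp (- (lam * S \<omega>))) * (ennreal (A \<omega> k / S \<omega>) * y) = ennreal (A \<omega> k) * (ennreal (exp (- (lam * S \<omega>)) / S \<omega>) * y)" for k y
      proof -
        have "ennreal (exp (- (lam * S \<omega>))) * ennreal (A \<omega> k / S \<omega>) = ennreal (A \<omega> k) * ennreal (exp (- (lam * S \<omega>)) / S \<omega>)"
          using S0 ranked_nonneg[OF elim, of k] by (simp add: ennreal_mult[symmetric] mult.commute)
        then show ?thesis by (simp only: mult.assoc[symmetric])
      qed
      then show ?case unfolding deletion_expectation.simps ennreal_suminf_cmult[symmetric] H_def fst_conv snd_conv e by simp
    qed
  qed
  also have "\<dots> = (\<integral>\<^sup>+s. \<integral>\<^sup>+\<omega>. ennreal (indicator {0<..} s * (s * stable_levy_density \<alpha> s)) * H (s, A \<omega>) \<partial>M \<partial>lborel)"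
    by (rule mecke_formula) measurable
  also have "\<dots> = (\<integral>\<^sup>+\<omega>. \<integral>\<^sup>+s. ennreal (indicator {0<..} s * (s * stable_levy_density \<alpha> s)) * H (s, A \<omega>) \<partial>lborel \<partial>M)"
  proof -
    interpret pair_sigma_finite lborel M ..
    have "(\<lambda>q. ennreal (indicator {0<..} (fst q) * (fst q * stable_levy_density \<alpha> (fst q))) * H (fst q, A (snd q))) \<in> borel_measurable (lborel \<Otimes>\<^sub>M M)"
      by measurable
    then show ?thesis by (intro Fubini'[symmetric]) (simp add: split_beta)
  qed
  also have "\<dots> = (\<integral>\<^sup>+\<omega>. \<integral>\<^sup>+p. \<integral>\<^sup>+x. ennreal (pick_kernel \<alpha> lam p x) * (\<phi> (c * p) * (ennreal (exp (- (x * S \<omega>))) * deletion_expectation \<phi>s (c * (1 - p)) (A \<omega>))) \<partial>lborel \<partial>lborel \<partial>M)"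
  proof (rule nn_integral_cong_AE)
    show "AE \<omega> in M. (\<integral>\<^sup>+s. ennreal (indicator {0<..} s * (s * stable_levy_density \<alpha> s)) * H (s, A \<omega>) \<partial>lborel)
      = (\<integral>\<^sup>+p. \<integral>\<^sup>+x. ennreal (pick_kernel \<alpha> lam p x) * (\<phi> (c * p) * (ennreal (exp (- (x * S \<omega>))) * deletion_expectation \<phi>s (c * (1 - p)) (A \<omega>))) \<partial>lborel \<partial>lborel)"
      using S_pos AE_space
    proof eventually_elim
      case (elim \<omega>)
      define T where "T = S \<omega>"
      have T: "0 < T" using elim by (simp add: T_def)
      have a[measurable]: "A \<omega> \<in> space seq_space" by (simp add: space_PiM)
      have [measurable]: "(\<lambda>s. H (s, A \<omega>)) \<in> borel_measurable borel"
        using measurable_compose[OF _ Hm, of "\<lambda>s. (s, A \<omega>)"] a by simp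
      have "(\<integral>\<^sup>+s. ennreal (indicator {0<..} s * (s * stable_levy_density \<alpha> s)) * H (s, A \<omega>) \<partial>lborel)
        = (\<integral>\<^sup>+s. ennreal (s * stable_levy_density \<alpha> s) * H (s, A \<omega>) * indicator {0<..} s \<partial>lborel)"
        by (intro nn_integral_cong) (auto split: split_indicator)
      also have "\<dots> = (\<integral>\<^sup>+p. ennreal (T * p / (1 - p) * stable_levy_density \<alpha> (T * p / (1 - p))) * H (T * p / (1 - p), A \<omega>) * ennreal (T / (1 - p)\<^sup>2) * indicator {0<..<1} p \<partial>lborel)"
        by (rule nn_integral_proportion_substitution[OF _ T]) measurable
      also have "\<dots> = (\<integral>\<^sup>+p. \<integral>\<^sup>+x. ennreal (pick_kernel \<alpha> lam p x) * (\<phi> (c * p) * (ennreal (exp (- (x * S \<omega>))) * deletion_expectation \<phi>s (c * (1 - p)) (A \<omega>))) \<partial>lborel \<partial>lborel)"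
      proof (rule nn_integral_cong)
        fix p :: real
        show "ennreal (T * p / (1 - p) * stable_levy_density \<alpha> (T * p / (1 - p))) * H (T * p / (1 - p), A \<omega>) * ennreal (T / (1 - p)\<^sup>2) * indicator {0<..<1} p
          = (\<integral>\<^sup>+x. ennreal (pick_kernel \<alpha> lam p x) * (\<phi> (c * p) * (ennreal (exp (- (x * S \<omega>))) * deletion_expectation \<phi>s (c * (1 - p)) (A \<omega>))) \<partial>lborel)"
        proof (cases "0 < p \<and> p < 1")
          case True
          let ?s = "T * p / (1 - p)"
          have sT: "?s + T = T / (1 - p)" using True by (simp add: field_simps)
          have frac: "?s / (?s + T) = p" unfolding sT using True T by simp
          have "ennreal (?s * stable_levy_density \<alpha> ?s) * H (?s, A \<omega>) * ennreal (T / (1 - p)\<^sup>2)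
            = (ennreal (?s * stable_levy_density \<alpha> ?s) * ennreal (exp (- (lam * (?s + T))) / (?s + T)) * ennreal (T / (1 - p)\<^sup>2))
              * (\<phi> (c * p) * deletion_expectation \<phi>s (c * (1 - p)) (A \<omega>))"
            unfolding H_def fst_conv snd_conv T_def[symmetric] frac by (simp only: mult_ac)
          also have "\<dots> = (\<integral>\<^sup>+x. ennreal (pick_kernel \<alpha> lam p x) * ennreal (exp (- (x * T))) \<partial>lborel) * (\<phi> (c * p) * deletion_expectation \<phi>s (c * (1 - p)) (A \<omega>))"
            using stable_pick_density[OF \<alpha> T, of p lam] True by simp
          also have "\<dots> = (\<integral>\<^sup>+x. ennreal (pick_kernel \<alpha> lam p x) * ennreal (exp (- (x * T))) * (\<phi> (c * p) * deletion_expectation \<phi>s (c * (1 - p)) (A \<omega>)) \<partial>lborel)"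
            by (rule nn_integral_multc[symmetric]) measurable
          finally show ?thesis using True by (simp add: T_def mult_ac)
        next
          case False
          then show ?thesis by (auto simp: pick_kernel_def)
        qed
      qed
      finally show ?case .
    qed
  qed
  also have "\<dots> = (\<integral>\<^sup>+p. \<integral>\<^sup>+\<omega>. \<integral>\<^sup>+x. ennreal (pick_kernel \<alpha> lam p x) * (\<phi> (c * p) * (ennreal (exp (- (x * S \<omega>))) * deletion_expectation \<phi>s (c * (1 - p)) (A \<omega>))) \<partial>lborel \<partial>M \<partial>lborel)"
  proof -
    interpret pair_sigma_finite lborel M ..
    have [measurable]: "(\<lambda>q. ennreal (pick_kernel \<alpha> lam (fst (fst q)) (snd q))) \<in> borel_measurable ((lborel \<Otimes>\<^sub>M M) \<Otimes>\<^sub>M lborel)"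
      by measurable
    have "(\<lambda>q. ennreal (pick_kernel \<alpha> lam (fst (fst q)) (snd q)) * (\<phi> (c * fst (fst q)) * (ennreal (exp (- (snd q * S (snd (fst q))))) * deletion_expectation \<phi>s (c * (1 - fst (fst q))) (A (snd (fst q)))))) \<in> borel_measurable ((lborel \<Otimes>\<^sub>M M) \<Otimes>\<^sub>M lborel)"
      by (intro borel_measurable_times_ennreal DEm) simp_all
    then have "(\<lambda>(r, x). ennreal (pick_kernel \<alpha> lam (fst r) x) * (\<phi> (c * fst r) * (ennreal (exp (- (x * S (snd r)))) * deletion_expectation \<phi>s (c * (1 - fst r)) (A (snd r))))) \<in> borel_measurable ((lborel \<Otimes>\<^sub>M M) \<Otimes>\<^sub>M lborel)"
      by (simp add: split_beta)
    then have "(\<lambda>r. \<integral>\<^sup>+x. ennreal (pick_kernel \<alpha> lam (fst r) x) * (\<phi> (c * fst r) * (ennreal (exp (- (x * S (snd r)))) * deletion_expectation \<phi>s (c * (1 - fst r)) (A (snd r)))) \<partial>lborel) \<in> borel_measurable (lborel \<Otimes>\<^sub>M M)"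
      by (rule lborel.borel_measurable_nn_integral)
    then show ?thesis by (intro Fubini') (simp add: split_beta)
  qed
  also have "\<dots> = (\<integral>\<^sup>+p. \<integral>\<^sup>+x. \<integral>\<^sup>+\<omega>. ennreal (pick_kernel \<alpha> lam p x) * (\<phi> (c * p) * (ennreal (exp (- (x * S \<omega>))) * deletion_expectation \<phi>s (c * (1 - p)) (A \<omega>))) \<partial>M \<partial>lborel \<partial>lborel)"
  proof (rule nn_integral_cong)
    fix p :: real
    interpret pair_sigma_finite lborel M ..
    have [measurable]: "(\<lambda>q. ennreal (pick_kernel \<alpha> lam p (fst q))) \<in> borel_measurable (lborel \<Otimes>\<^sub>M M)"
      by measurable
    have "(\<lambda>q. ennreal (pick_kernel \<alpha> lam p (fst q)) * (\<phi> (c * p) * (ennreal (exp (- (fst q * S (snd q)))) * deletion_expectation \<phi>s (c * (1 - p)) (A (snd q))))) \<in> borel_measurable (lborel \<Otimes>\<^sub>M M)"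
      by measurable
    then show "(\<integral>\<^sup>+\<omega>. \<integral>\<^sup>+x. ennreal (pick_kernel \<alpha> lam p x) * (\<phi> (c * p) * (ennreal (exp (- (x * S \<omega>))) * deletion_expectation \<phi>s (c * (1 - p)) (A \<omega>))) \<partial>lborel \<partial>M)
      = (\<integral>\<^sup>+x. \<integral>\<^sup>+\<omega>. ennreal (pick_kernel \<alpha> lam p x) * (\<phi> (c * p) * (ennreal (exp (- (x * S \<omega>))) * deletion_expectation \<phi>s (c * (1 - p)) (A \<omega>))) \<partial>M \<partial>lborel)"
      by (intro Fubini') (simp add: split_beta)
  qed
  also have "\<dots> = (\<integral>\<^sup>+p. \<integral>\<^sup>+x. ennreal (pick_kernel \<alpha> lam p x) * (\<phi> (c * p) * tilted_picks \<phi>s x (c * (1 - p))) \<partial>lborel \<partial>lborel)"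
  proof (intro nn_integral_cong)
    fix p x :: real
    have [measurable]: "(\<lambda>\<omega>. deletion_expectation \<phi>s (c * (1 - p)) (A \<omega>)) \<in> borel_measurable M" by measurable
    show "(\<integral>\<^sup>+\<omega>. ennreal (pick_kernel \<alpha> lam p x) * (\<phi> (c * p) * (ennreal (exp (- (x * S \<omega>))) * deletion_expectation \<phi>s (c * (1 - p)) (A \<omega>))) \<partial>M)
      = ennreal (pick_kernel \<alpha> lam p x) * (\<phi> (c * p) * tilted_picks \<phi>s x (c * (1 - p)))"
      unfolding tilted_picks_def by (simp add: nn_integral_cmult)
  qed
  finally show ?thesis .
qed

end

text \<open>The value of \<open>1 - R\<^sub>k\<close> when \<open>z\<close> is \<open>lam powr \<alpha>\<close> plus the sum of the first \<open>k - 1\<close>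
  exponential variables and \<open>y\<close> is the next one.\<close>

definition one_minus_R :: "real \<Rightarrow> real \<Rightarrow> real \<Rightarrow> real" where
  "one_minus_R \<alpha> z y = 1 - (z / (z + y)) powr (1 / \<alpha>)"

text \<open>The expectation of a product of functions of the sticks, one stick at a time:
  \<open>z\<close> is \<open>lam powr \<alpha>\<close> plus the exponential variables already used, and \<open>c\<close> is the length that
  is left to break.\<close>

primrec sticks_expectation :: "real \<Rightarrow> (real \<Rightarrow> ennreal) list \<Rightarrow> real \<Rightarrow> real \<Rightarrow> ennreal" where
  "sticks_expectation \<alpha> [] z c = 1"
| "sticks_expectation \<alpha> (\<phi> # \<phi>s) z c = (\<integral>\<^sup>+y. ennreal (exponential_density 1 y) *
     (\<integral>\<^sup>+b. ennreal (beta_density (1 - \<alpha>) \<alpha> b) * (\<phi> (c * (b * one_minus_R \<alpha> z y)) *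
        sticks_expectation \<alpha> \<phi>s (z + y) (c * (1 - b * one_minus_R \<alpha> z y))) \<partial>lborel) \<partial>lborel)"

lemma beta_density_measurable [measurable]: "beta_density a b \<in> borel_measurable borel"
  unfolding beta_density_def[abs_def] by measurable

lemma one_minus_R_measurable [measurable (raw)]:
  assumes [measurable]: "u \<in> borel_measurable N" "v \<in> borel_measurable N"
  shows "(\<lambda>x. one_minus_R \<alpha> (u x) (v x)) \<in> borel_measurable N"
  unfolding one_minus_R_def by measurable

lemma sticks_expectation_measurable:
  assumes "\<And>\<phi>. \<phi> \<in> set \<phi>s \<Longrightarrow> \<phi> \<in> borel_measurable borel"
    and "u \<in> borel_measurable N" "v \<in> borel_measurable N"
  shows "(\<lambda>x. sticks_expectation \<alpha> \<phi>s (u x) (v x)) \<in> borel_measurable N"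
proof -
  have "(\<lambda>q. sticks_expectation \<alpha> \<phi>s (fst q) (snd q)) \<in> borel_measurable (borel \<Otimes>\<^sub>M borel)"
    using assms(1)
  proof (induction \<phi>s)
    case Nil
    then show ?case by simp
  next
    case (Cons \<phi> \<phi>s)
    have [measurable]: "\<phi> \<in> borel_measurable borel" using Cons.prems by simp
    have IH: "(\<lambda>q. sticks_expectation \<alpha> \<phi>s (fst q) (snd q)) \<in> borel_measurable (borel \<Otimes>\<^sub>M borel)"
      using Cons by simp
    have [measurable]: "(\<lambda>x. sticks_expectation \<alpha> \<phi>s (f x) (g x)) \<in> borel_measurable N"
      if "f \<in> borel_measurable N" "g \<in> borel_measurable N" for f g and N :: "(((real \<times> real) \<times> real) \<times> real) measure"
      using measurable_compose[OF _ IH, of "\<lambda>x. (f x, g x)"] that by simp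
    show ?case unfolding sticks_expectation.simps by measurable
  qed
  from measurable_compose[OF _ this, of "\<lambda>x. (u x, v x)" N] assms show ?thesis by simp
qed

text \<open>The density of the pair \<open>(\<beta> * (1 - lam / x), x)\<close> when \<open>x powr \<alpha> - lam powr \<alpha>\<close> is exponential and
  \<open>\<beta>\<close> is an independent Beta variable, up to the exponential factor. Here
  \<open>x * (1 - lam / x - p) = (1 - p) * x - lam\<close>.\<close>

lemma beta_scaled_density:
  assumes \<alpha>: "0 < \<alpha>" "\<alpha> < 1" and lam: "0 < lam" and x: "lam < x"
  shows "ennreal (\<alpha> * x powr (\<alpha> - 1)) * ennreal (\<bar>1 / (1 - lam / x)\<bar> * beta_density (1 - \<alpha>) \<alpha> (p / (1 - lam / x)))
    = ennreal (pick_kernel \<alpha> lam p x)"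
proof -
  define d where "d = 1 - lam / x"
  have x0: "0 < x" using lam x by simp
  have d: "0 < d" "d < 1" using lam x x0 by (auto simp: d_def)
  have G: "0 < Gamma (1 - \<alpha>)" "0 < Gamma \<alpha>" using \<alpha> by (auto intro!: Gamma_real_pos)
  have B: "Beta (1 - \<alpha>) \<alpha> = Gamma (1 - \<alpha>) * Gamma \<alpha>" by (simp add: Beta_def)
  have iff: "0 < p / d \<and> p / d < 1 \<longleftrightarrow> 0 < p \<and> p < 1 \<and> lam < (1 - p) * x"
  proof -
    have "0 < p / d \<longleftrightarrow> 0 < p" using d by (simp add: zero_less_divide_iff)
    moreover have "p / d < 1 \<longleftrightarrow> p < d" using d by (simp add: divide_less_eq)
    moreover have "p < d \<longleftrightarrow> lam < (1 - p) * x" using x0 by (simp add: d_def field_simps)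
    moreover have "p < d \<Longrightarrow> p < 1" using d by simp
    ultimately show ?thesis by auto
  qed
  show ?thesis
  proof (cases "0 < p \<and> p < 1 \<and> lam < (1 - p) * x")
    case True
    then have c: "0 < p / d" "p / d < 1" using iff by auto
    have pd: "0 < p" "p < d" using c d by (auto simp: zero_less_divide_iff divide_less_eq)
    have e1: "(p / d) powr (- \<alpha>) = p powr (- \<alpha>) * d powr \<alpha>"
      using pd d by (simp add: powr_divide powr_minus divide_simps)
    have e2: "(1 - p / d) powr (\<alpha> - 1) = (d - p) powr (\<alpha> - 1) * d powr (1 - \<alpha>)"
    proof -
      have "1 - p / d = (d - p) / d" using d by (simp add: diff_divide_distrib)
      then have "(1 - p / d) powr (\<alpha> - 1) = (d - p) powr (\<alpha> - 1) / d powr (\<alpha> - 1)" using pd d by (simp add: powr_divide)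
      also have "d powr (\<alpha> - 1) = inverse (d powr (1 - \<alpha>))" by (metis minus_diff_eq powr_minus)
      finally show ?thesis by (simp add: divide_inverse)
    qed
    have e3: "d powr \<alpha> * d powr (1 - \<alpha>) = d" using d by (simp add: powr_add[symmetric])
    have e4: "x powr (\<alpha> - 1) * (d - p) powr (\<alpha> - 1) = ((1 - p) * x - lam) powr (\<alpha> - 1)"
    proof -
      have "x * (d - p) = (1 - p) * x - lam" using x0 by (simp add: d_def field_simps)
      then show ?thesis using x0 pd by (metis diff_ge_0_iff_ge less_imp_le powr_mult)
    qed
    have "\<alpha> * x powr (\<alpha> - 1) * (\<bar>1 / d\<bar> * beta_density (1 - \<alpha>) \<alpha> (p / d))
      = \<alpha> * x powr (\<alpha> - 1) * ((1 / d) * ((p powr (- \<alpha>) * d powr \<alpha>) * ((d - p) powr (\<alpha> - 1) * d powr (1 - \<alpha>)) / (Gamma (1 - \<alpha>) * Gamma \<alpha>)))"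
      using c d unfolding beta_density_def B by (simp add: e1 e2)
    also have "\<dots> = \<alpha> / (Gamma (1 - \<alpha>) * Gamma \<alpha>) * (p powr (- \<alpha>) * (x powr (\<alpha> - 1) * (d - p) powr (\<alpha> - 1))) * ((d powr \<alpha> * d powr (1 - \<alpha>)) / d)"
      by (simp add: mult_ac)
    also have "\<dots> = pick_kernel \<alpha> lam p x"
      unfolding e3 e4 using True d by (simp add: pick_kernel_def)
    finally have "\<alpha> * x powr (\<alpha> - 1) * (\<bar>1 / d\<bar> * beta_density (1 - \<alpha>) \<alpha> (p / d)) = pick_kernel \<alpha> lam p x" .
    moreover have "0 \<le> \<bar>1 / d\<bar> * beta_density (1 - \<alpha>) \<alpha> (p / d)" using G unfolding beta_density_def B by simp
    ultimately show ?thesis using \<alpha> by (simp add: d_def[symmetric] ennreal_mult[symmetric])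
  next
    case False
    then have "beta_density (1 - \<alpha>) \<alpha> (p / d) = 0" using iff by (auto simp: beta_density_def)
    moreover have "pick_kernel \<alpha> lam p x = 0" using False by (auto simp: pick_kernel_def)
    ultimately show ?thesis by (simp add: d_def)
  qed
qed

text \<open>Substituting \<open>z + y = x powr \<alpha>\<close> with \<open>z = lam powr \<alpha>\<close> turns \<open>one_minus_R\<close> into \<open>1 - lam / x\<close>,
  so both recursions have the same kernel, and the parameters passed on agree: \<open>x\<close> for the picks,
  \<open>x powr \<alpha>\<close> for the sticks. The exponential density supplies the ratio of the normalizing
  constants.\<close>

theorem (in stable_jumps) tilted_picks_eq_sticks:
  assumes \<phi>s: "\<And>\<phi>. \<phi> \<in> set \<phi>s \<Longrightarrow> \<phi> \<in> borel_measurable borel" and lam: "0 < lam"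
  shows "ennreal (exp (lam powr \<alpha>)) * tilted_picks \<phi>s lam c = sticks_expectation \<alpha> \<phi>s (lam powr \<alpha>) c"
  using assms
proof (induction \<phi>s arbitrary: lam c)
  case Nil
  then show ?case by (simp add: tilted_picks_Nil ennreal_mult[symmetric] exp_add[symmetric])
next
  case (Cons \<phi> \<phi>s)
  have \<phi>[measurable]: "\<phi> \<in> borel_measurable borel" using Cons.prems by simp
  have \<phi>s: "\<And>\<psi>. \<psi> \<in> set \<phi>s \<Longrightarrow> \<psi> \<in> borel_measurable borel" using Cons.prems by simp
  have lam: "0 < lam" by fact
  note SEm[measurable] = sticks_expectation_measurable[OF \<phi>s]
  note TPm[measurable] = tilted_picks_measurable[OF \<phi>s]
  have IH: "sticks_expectation \<alpha> \<phi>s (x powr \<alpha>) c' = ennreal (exp (x powr \<alpha>)) * tilted_picks \<phi>s x c'" if "0 < x" for x c'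
    using Cons.IH[OF \<phi>s that] by simp
  have kernel_m: "(\<lambda>(x, p). ennreal (pick_kernel \<alpha> lam p x) * (\<phi> (c * p) * tilted_picks \<phi>s x (c * (1 - p)))) \<in> borel_measurable (lborel \<Otimes>\<^sub>M lborel)"
  proof -
    have "(\<lambda>q. ennreal (pick_kernel \<alpha> lam (snd q) (fst q))) \<in> borel_measurable (borel \<Otimes>\<^sub>M borel)"
      by measurable
    moreover have "(\<lambda>q. \<phi> (c * snd q) * tilted_picks \<phi>s (fst q) (c * (1 - snd q))) \<in> borel_measurable (borel \<Otimes>\<^sub>M borel)"
      by (intro borel_measurable_times_ennreal TPm) simp_all
    ultimately show ?thesis by (simp add: split_beta borel_measurable_times_ennreal cong: measurable_cong_sets)
  qed
  define z where "z = lam powr \<alpha>"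
  define F where "F y = ennreal (exponential_density 1 y) * (\<integral>\<^sup>+b. ennreal (beta_density (1 - \<alpha>) \<alpha> b) * (\<phi> (c * (b * one_minus_R \<alpha> z y)) *
        sticks_expectation \<alpha> \<phi>s (z + y) (c * (1 - b * one_minus_R \<alpha> z y))) \<partial>lborel)" for y
  have [measurable]: "F \<in> borel_measurable borel" unfolding F_def by measurable
  have "sticks_expectation \<alpha> (\<phi> # \<phi>s) z c = (\<integral>\<^sup>+y. F y * indicator {0..} y \<partial>lborel)"
    unfolding sticks_expectation.simps F_def
    by (intro nn_integral_cong) (auto simp: exponential_density_def split: split_indicator)
  also have "\<dots> = (\<integral>\<^sup>+x. F (x powr \<alpha> - lam powr \<alpha>) * ennreal (\<alpha> * x powr (\<alpha> - 1)) * indicator {lam..} x \<partial>lborel)"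
    by (rule nn_integral_power_substitution[OF _ lam \<alpha>(1)]) measurable
  also have "\<dots> = (\<integral>\<^sup>+x. ennreal (exp (lam powr \<alpha>)) * (\<integral>\<^sup>+p. ennreal (pick_kernel \<alpha> lam p x) * (\<phi> (c * p) * tilted_picks \<phi>s x (c * (1 - p))) \<partial>lborel) \<partial>lborel)"
  proof (rule nn_integral_cong_AE, rule eventually_mono[OF AE_lborel_singleton[of lam]])
    fix x :: real assume ne: "x \<noteq> lam"
    show "F (x powr \<alpha> - lam powr \<alpha>) * ennreal (\<alpha> * x powr (\<alpha> - 1)) * indicator {lam..} x
      = ennreal (exp (lam powr \<alpha>)) * (\<integral>\<^sup>+p. ennreal (pick_kernel \<alpha> lam p x) * (\<phi> (c * p) * tilted_picks \<phi>s x (c * (1 - p))) \<partial>lborel)"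
    proof (cases "lam < x")
      case True
      define d where "d = 1 - lam / x"
      have x0: "0 < x" using lam True by simp
      have d: "0 < d" using True x0 by (simp add: d_def)
      have rem: "one_minus_R \<alpha> z (x powr \<alpha> - lam powr \<alpha>) = d"
      proof -
        have "z / (z + (x powr \<alpha> - lam powr \<alpha>)) = (lam / x) powr \<alpha>" using lam x0 by (simp add: z_def powr_divide)
        then show ?thesis using \<alpha> lam x0 by (simp add: one_minus_R_def d_def powr_powr)
      qed
      define h where "h p = \<phi> (c * p) * tilted_picks \<phi>s x (c * (1 - p))" for p
      have hm[measurable]: "h \<in> borel_measurable borel" unfolding h_def by measurable
      have zy: "z + (x powr \<alpha> - lam powr \<alpha>) = x powr \<alpha>" by (simp add: z_def)
      have le: "lam powr \<alpha> \<le> x powr \<alpha>" using lam True \<alpha> by (intro powr_mono2) auto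
      have "F (x powr \<alpha> - lam powr \<alpha>) = ennreal (exp (- (x powr \<alpha> - lam powr \<alpha>))) * (\<integral>\<^sup>+b. ennreal (beta_density (1 - \<alpha>) \<alpha> b) * (ennreal (exp (x powr \<alpha>)) * h (b * d)) \<partial>lborel)"
        unfolding F_def rem zy IH[OF x0] h_def using le
        by (simp add: exponential_density_def mult_ac)
      also have "(\<integral>\<^sup>+b. ennreal (beta_density (1 - \<alpha>) \<alpha> b) * (ennreal (exp (x powr \<alpha>)) * h (b * d)) \<partial>lborel)
        = (\<integral>\<^sup>+b. ennreal (exp (x powr \<alpha>)) * (ennreal (beta_density (1 - \<alpha>) \<alpha> b) * h (b * d)) \<partial>lborel)"
        by (simp only: mult_ac)
      also have "\<dots> = ennreal (exp (x powr \<alpha>)) * (\<integral>\<^sup>+b. ennreal (beta_density (1 - \<alpha>) \<alpha> b) * h (b * d) \<partial>lborel)"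
        by (rule nn_integral_cmult) measurable
      also have "(\<integral>\<^sup>+b. ennreal (beta_density (1 - \<alpha>) \<alpha> b) * h (b * d) \<partial>lborel)
        = ennreal \<bar>1 / d\<bar> * (\<integral>\<^sup>+p. ennreal (beta_density (1 - \<alpha>) \<alpha> (0 + (1 / d) * p)) * h ((0 + (1 / d) * p) * d) \<partial>lborel)"
        using d by (intro nn_integral_real_affine) auto
      also have "\<dots> = (\<integral>\<^sup>+p. ennreal \<bar>1 / d\<bar> * (ennreal (beta_density (1 - \<alpha>) \<alpha> (p / d)) * h p) \<partial>lborel)"
        using d by (subst nn_integral_cmult) auto
      also have "\<dots> = (\<integral>\<^sup>+p. ennreal (\<bar>1 / d\<bar> * beta_density (1 - \<alpha>) \<alpha> (p / d)) * h p \<partial>lborel)"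
        by (simp only: ennreal_mult'[OF abs_ge_zero] mult.assoc)
      finally have Fx: "F (x powr \<alpha> - lam powr \<alpha>) = ennreal (exp (- (x powr \<alpha> - lam powr \<alpha>))) *
         (ennreal (exp (x powr \<alpha>)) * (\<integral>\<^sup>+p. ennreal (\<bar>1 / d\<bar> * beta_density (1 - \<alpha>) \<alpha> (p / d)) * h p \<partial>lborel))" .
      have ex: "ennreal (exp (- (x powr \<alpha> - lam powr \<alpha>))) * ennreal (exp (x powr \<alpha>)) = ennreal (exp (lam powr \<alpha>))"
        by (simp add: ennreal_mult[symmetric] exp_add[symmetric])
      have "(\<integral>\<^sup>+p. ennreal (\<bar>1 / d\<bar> * beta_density (1 - \<alpha>) \<alpha> (p / d)) * h p \<partial>lborel) * ennreal (\<alpha> * x powr (\<alpha> - 1))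
        = (\<integral>\<^sup>+p. ennreal (\<bar>1 / d\<bar> * beta_density (1 - \<alpha>) \<alpha> (p / d)) * h p * ennreal (\<alpha> * x powr (\<alpha> - 1)) \<partial>lborel)"
        by (rule nn_integral_multc[symmetric]) measurable
      also have "\<dots> = (\<integral>\<^sup>+p. ennreal (pick_kernel \<alpha> lam p x) * h p \<partial>lborel)"
        by (intro nn_integral_cong) (simp add: beta_scaled_density[OF \<alpha> lam True, folded d_def, symmetric] mult_ac)
      finally show ?thesis unfolding Fx mult.assoc[symmetric] ex using True by (simp add: h_def mult.assoc)
    next
      case False
      then have x: "x < lam" using ne by simp
      have "pick_kernel \<alpha> lam p x = 0" for p
      proof -
        have "(1 - p) * x \<le> lam" if p: "0 < p" "p < 1"
        proof (cases "x \<le> 0")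
          case True
          then have "(1 - p) * x \<le> 0" using p by (intro mult_nonneg_nonpos) auto
          then show ?thesis using lam by simp
        next
          case False
          then have "(1 - p) * x \<le> 1 * x" using p by (intro mult_right_mono) auto
          then show ?thesis using x by simp
        qed
        then show ?thesis by (force simp: pick_kernel_def)
      qed
      then show ?thesis using False ne by simp
    qed
  qed
  also have "\<dots> = ennreal (exp (lam powr \<alpha>)) * (\<integral>\<^sup>+x. \<integral>\<^sup>+p. ennreal (pick_kernel \<alpha> lam p x) * (\<phi> (c * p) * tilted_picks \<phi>s x (c * (1 - p))) \<partial>lborel \<partial>lborel)"
    using lborel.borel_measurable_nn_integral[OF kernel_m] by (intro nn_integral_cmult) simp
  also have "(\<integral>\<^sup>+x. \<integral>\<^sup>+p. ennreal (pick_kernel \<alpha> lam p x) * (\<phi> (c * p) * tilted_picks \<phi>s x (c * (1 - p))) \<partial>lborel \<partial>lborel)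
     = (\<integral>\<^sup>+p. \<integral>\<^sup>+x. ennreal (pick_kernel \<alpha> lam p x) * (\<phi> (c * p) * tilted_picks \<phi>s x (c * (1 - p))) \<partial>lborel \<partial>lborel)"
    by (rule lborel_pair.Fubini'[OF kernel_m, symmetric])
  also have "\<dots> = tilted_picks (\<phi> # \<phi>s) lam c"
    by (rule tilted_picks_Cons[OF \<phi> \<phi>s, symmetric])
  finally show ?case by (simp add: z_def)
qed

section \<open>The stick-breaking side\<close>

text \<open>The integrand of \<open>sticks_expectation\<close>, for fixed sequences \<open>x\<close> of Beta and \<open>y\<close>
  of exponential values.\<close>

primrec stick_product :: "real \<Rightarrow> (real \<Rightarrow> ennreal) list \<Rightarrow> real \<Rightarrow> real \<Rightarrow> (nat \<Rightarrow> real) \<Rightarrow> (nat \<Rightarrow> real) \<Rightarrow> ennreal" where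
  "stick_product \<alpha> [] z c x y = 1"
| "stick_product \<alpha> (\<phi> # \<phi>s) z c x y = \<phi> (c * (x 0 * one_minus_R \<alpha> z (y 0))) *
     stick_product \<alpha> \<phi>s (z + y 0) (c * (1 - x 0 * one_minus_R \<alpha> z (y 0))) (\<lambda>i. x (Suc i)) (\<lambda>i. y (Suc i))"

lemma stick_product_measurable:
  assumes "\<And>\<phi>. \<phi> \<in> set \<phi>s \<Longrightarrow> \<phi> \<in> borel_measurable borel"
    and "fz \<in> borel_measurable N" "fc \<in> borel_measurable N" "fx \<in> N \<rightarrow>\<^sub>M seq_space" "fy \<in> N \<rightarrow>\<^sub>M seq_space"
  shows "(\<lambda>q. stick_product \<alpha> \<phi>s (fz q) (fc q) (fx q) (fy q)) \<in> borel_measurable N"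
  using assms
proof (induction \<phi>s arbitrary: fz fc fx fy)
  case Nil
  then show ?case by simp
next
  case (Cons \<phi> \<phi>s)
  note [measurable] = Cons.prems(2-5)
  have [measurable]: "\<phi> \<in> borel_measurable borel" using Cons.prems by simp
  have "(\<lambda>q. stick_product \<alpha> \<phi>s (fz q + fy q 0) (fc q * (1 - fx q 0 * one_minus_R \<alpha> (fz q) (fy q 0))) (\<lambda>i. fx q (Suc i)) (\<lambda>i. fy q (Suc i))) \<in> borel_measurable N"
    using Cons.prems(1) by (intro Cons.IH measurable_seq_spaceI) simp_all
  then show ?case unfolding stick_product.simps by (intro borel_measurable_times_ennreal) simp_all
qed

text \<open>The sequence \<open>W\<close> with values \<open>x\<close> and \<open>y\<close> indexed from 0 and a general \<open>z\<close> in place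
  of \<open>lam powr \<alpha>\<close>. Dropping the first Beta and exponential values then amounts to replacing \<open>z\<close>
  by \<open>z + y 0\<close>.\<close>

definition W_from :: "real \<Rightarrow> real \<Rightarrow> (nat \<Rightarrow> real) \<Rightarrow> (nat \<Rightarrow> real) \<Rightarrow> nat \<Rightarrow> real" where
  "W_from \<alpha> z x y k = 1 - x (k - 1) * (1 - ((z + (\<Sum>i<k - 1. y i)) / (z + (\<Sum>i<k. y i))) powr (1 / \<alpha>))"

lemma W_from_Suc_0: "1 - W_from \<alpha> z x y (Suc 0) = x 0 * one_minus_R \<alpha> z (y 0)"
  by (simp add: W_from_def one_minus_R_def)

lemma W_from_shift: "0 < k \<Longrightarrow> W_from \<alpha> z x y (Suc k) = W_from \<alpha> (z + y 0) (\<lambda>i. x (Suc i)) (\<lambda>i. y (Suc i)) k"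
proof -
  assume "0 < k"
  then obtain m where m: "k = Suc m" by (cases k) auto
  have "(\<Sum>i<Suc n. y i) = y 0 + (\<Sum>i<n. y (Suc i))" for n by (rule sum.lessThan_Suc_shift)
  then show ?thesis unfolding W_from_def m by (simp del: sum.lessThan_Suc add: add.assoc)
qed

lemma stick_breaking_0: "stick_breaking w 0 = 1 - w 1"
  by (simp add: stick_breaking_def)

lemma stick_breaking_Suc: "stick_breaking w (Suc l) = w 1 * stick_breaking (\<lambda>k. w (Suc k)) l"
proof -
  have "(\<Prod>i=1..Suc l. w i) = w 1 * (\<Prod>i=1..l. w (Suc i))"
    unfolding One_nat_def prod.atLeast1_atMost_eq by (rule prod.lessThan_Suc_shift)
  then show ?thesis by (simp add: stick_breaking_def)
qed

lemma stick_breaking_cong: "(\<And>k. 0 < k \<Longrightarrow> w k = w' k) \<Longrightarrow> stick_breaking w l = stick_breaking w' l"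
  unfolding stick_breaking_def by (intro arg_cong2[where f = "(*)"] prod.cong) auto

lemma prod_sticks_eq_stick_product:
  "(\<Prod>l<length \<phi>s. (\<phi>s ! l) (c * stick_breaking (W_from \<alpha> z x y) l)) = stick_product \<alpha> \<phi>s z c x y"
proof (induction \<phi>s arbitrary: z c x y)
  case Nil
  then show ?case by simp
next
  case (Cons \<phi> \<phi>s)
  define c' where "c' = c * W_from \<alpha> z x y (Suc 0)"
  have c': "c' = c * (1 - x 0 * one_minus_R \<alpha> z (y 0))"
    unfolding c'_def W_from_Suc_0[symmetric] by simp
  have s: "c * stick_breaking (W_from \<alpha> z x y) (Suc l)
      = c' * stick_breaking (W_from \<alpha> (z + y 0) (\<lambda>i. x (Suc i)) (\<lambda>i. y (Suc i))) l" for l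
  proof -
    have "stick_breaking (\<lambda>k. W_from \<alpha> z x y (Suc k)) l = stick_breaking (W_from \<alpha> (z + y 0) (\<lambda>i. x (Suc i)) (\<lambda>i. y (Suc i))) l"
      by (rule stick_breaking_cong) (rule W_from_shift)
    then show ?thesis by (simp add: stick_breaking_Suc c'_def)
  qed
  have "(\<Prod>l<length (\<phi> # \<phi>s). ((\<phi> # \<phi>s) ! l) (c * stick_breaking (W_from \<alpha> z x y) l))
      = \<phi> (c * stick_breaking (W_from \<alpha> z x y) 0) * (\<Prod>l<length \<phi>s. (\<phi>s ! l) (c * stick_breaking (W_from \<alpha> z x y) (Suc l)))"
    by (simp add: prod.lessThan_Suc_shift del: prod.lessThan_Suc)
  also have "\<dots> = \<phi> (c * (x 0 * one_minus_R \<alpha> z (y 0))) * stick_product \<alpha> \<phi>s (z + y 0) c' (\<lambda>i. x (Suc i)) (\<lambda>i. y (Suc i))"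
    unfolding s Cons.IH stick_breaking_0 by (simp add: W_from_Suc_0)
  finally show ?case by (simp add: c')
qed

lemma nn_integral_iid_sequence_split:
  assumes D: "prob_space D" "sets D = sets borel" and f: "f \<in> borel_measurable seq_space"
  shows "(\<integral>\<^sup>+x. f x \<partial>PiM UNIV (\<lambda>_ :: nat. D)) = (\<integral>\<^sup>+s. \<integral>\<^sup>+x. f (case_nat s x) \<partial>PiM UNIV (\<lambda>_ :: nat. D) \<partial>D)"
proof -
  interpret D: prob_space D by fact
  interpret sequence_space D ..
  note D(2)[measurable_cong]
  have f'[measurable]: "f \<in> borel_measurable S" using f D(2) by (simp cong: measurable_cong_sets sets_PiM_cong)
  have "(\<integral>\<^sup>+x. f x \<partial>S) = (\<integral>\<^sup>+x. f x \<partial>distr (D \<Otimes>\<^sub>M S) S (\<lambda>(s, \<omega>). case_nat s \<omega>))"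
    by (simp only: PiM_iter)
  also have "\<dots> = (\<integral>\<^sup>+q. f (case_nat (fst q) (snd q)) \<partial>(D \<Otimes>\<^sub>M S))"
    by (subst nn_integral_distr) (simp_all add: split_beta)
  also have "\<dots> = (\<integral>\<^sup>+s. \<integral>\<^sup>+x. f (case_nat s x) \<partial>S \<partial>D)"
  proof -
    have "(\<lambda>q. f (case_nat (fst q) (snd q))) \<in> borel_measurable (D \<Otimes>\<^sub>M S)" by measurable
    then show ?thesis by (subst P.nn_integral_fst[symmetric]) simp_all
  qed
  finally show ?thesis .
qed

text \<open>Splitting off the first coordinates of the two independent sequences reproduces the recursion of
  \<open>sticks_expectation\<close>.\<close>

lemma stick_product_expectation:
  assumes B: "prob_space B" "B = density lborel (\<lambda>x. ennreal (beta_density (1 - \<alpha>) \<alpha> x))"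
    and E: "prob_space E" "E = density lborel (\<lambda>x. ennreal (exponential_density 1 x))"
    and \<phi>s: "\<And>\<phi>. \<phi> \<in> set \<phi>s \<Longrightarrow> \<phi> \<in> borel_measurable borel"
  shows "(\<integral>\<^sup>+x. \<integral>\<^sup>+y. stick_product \<alpha> \<phi>s z c x y \<partial>PiM UNIV (\<lambda>_ :: nat. E) \<partial>PiM UNIV (\<lambda>_ :: nat. B)) = sticks_expectation \<alpha> \<phi>s z c"
  using \<phi>s
proof (induction \<phi>s arbitrary: z c)
  case Nil
  interpret B: prob_space B by fact
  interpret E: prob_space E by fact
  interpret PB: sequence_space B ..
  interpret PE: sequence_space E ..
  show ?case by (simp add: PB.P.emeasure_space_1 PE.P.emeasure_space_1)
next
  case (Cons \<phi> \<phi>s)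
  interpret B: prob_space B by fact
  interpret E: prob_space E by fact
  interpret PB: sequence_space B ..
  interpret PE: sequence_space E ..
  let ?SB = "PiM UNIV (\<lambda>_ :: nat. B)" and ?SE = "PiM UNIV (\<lambda>_ :: nat. E)"
  have sets[measurable_cong]: "sets B = sets borel" "sets E = sets borel" by (simp_all add: B(2) E(2))
  have setsS[measurable_cong]: "sets ?SB = sets seq_space" "sets ?SE = sets seq_space"
    by (simp_all add: sets cong: sets_PiM_cong)
  have \<phi>[measurable]: "\<phi> \<in> borel_measurable borel" using Cons.prems by simp
  have \<phi>s: "\<And>\<psi>. \<psi> \<in> set \<phi>s \<Longrightarrow> \<psi> \<in> borel_measurable borel" using Cons.prems by simp
  note SPm = stick_product_measurable[OF Cons.prems] and SPm' = stick_product_measurable[OF \<phi>s]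
  let ?SP = "stick_product \<alpha> (\<phi> # \<phi>s) z c"
  have "(\<integral>\<^sup>+x. \<integral>\<^sup>+y. ?SP x y \<partial>?SE \<partial>?SB) = (\<integral>\<^sup>+x. \<integral>\<^sup>+t. \<integral>\<^sup>+y. ?SP x (case_nat t y) \<partial>?SE \<partial>E \<partial>?SB)"
    by (intro nn_integral_cong nn_integral_iid_sequence_split E(1) sets SPm)
       (simp_all add: setsS[THEN sets_eq_imp_space_eq] space_PiM)
  also have "\<dots> = (\<integral>\<^sup>+t. \<integral>\<^sup>+x. \<integral>\<^sup>+y. ?SP x (case_nat t y) \<partial>?SE \<partial>?SB \<partial>E)"
  proof -
    interpret pair_sigma_finite E ?SB ..
    have "(\<lambda>(q, y). ?SP (snd q) (case_nat (fst q) y)) \<in> borel_measurable ((E \<Otimes>\<^sub>M ?SB) \<Otimes>\<^sub>M ?SE)"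
      unfolding split_beta by (intro SPm) measurable
    then have "(\<lambda>q. \<integral>\<^sup>+y. ?SP (snd q) (case_nat (fst q) y) \<partial>?SE) \<in> borel_measurable (E \<Otimes>\<^sub>M ?SB)"
      by (rule PE.P.borel_measurable_nn_integral)
    then show ?thesis by (intro Fubini') (simp add: split_beta)
  qed
  also have "\<dots> = (\<integral>\<^sup>+t. \<integral>\<^sup>+s. \<integral>\<^sup>+x. \<integral>\<^sup>+y. ?SP (case_nat s x) (case_nat t y) \<partial>?SE \<partial>?SB \<partial>B \<partial>E)"
  proof (intro nn_integral_cong nn_integral_iid_sequence_split B(1) sets)
    fix t
    have "(\<lambda>(x, y). ?SP x (case_nat t y)) \<in> borel_measurable (seq_space \<Otimes>\<^sub>M ?SE)"
      unfolding split_beta by (intro SPm) measurable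
    then show "(\<lambda>x. \<integral>\<^sup>+y. ?SP x (case_nat t y) \<partial>?SE) \<in> borel_measurable seq_space"
      by (rule PE.P.borel_measurable_nn_integral)
  qed
  also have "\<dots> = (\<integral>\<^sup>+t. \<integral>\<^sup>+s. \<phi> (c * (s * one_minus_R \<alpha> z t)) * sticks_expectation \<alpha> \<phi>s (z + t) (c * (1 - s * one_minus_R \<alpha> z t)) \<partial>B \<partial>E)"
  proof (intro nn_integral_cong)
    fix t s
    let ?u = "\<phi> (c * (s * one_minus_R \<alpha> z t))"
    let ?SP' = "stick_product \<alpha> \<phi>s (z + t) (c * (1 - s * one_minus_R \<alpha> z t))"
    have m: "(\<lambda>(x, y). ?SP' x y) \<in> borel_measurable (?SB \<Otimes>\<^sub>M ?SE)"
      unfolding split_beta by (intro SPm') measurable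
    have my: "?SP' x \<in> borel_measurable ?SE" if "x \<in> space ?SB" for x
      using measurable_compose_Pair1[OF that m] by simp
    have "(\<integral>\<^sup>+x. \<integral>\<^sup>+y. ?SP (case_nat s x) (case_nat t y) \<partial>?SE \<partial>?SB) = (\<integral>\<^sup>+x. ?u * (\<integral>\<^sup>+y. ?SP' x y \<partial>?SE) \<partial>?SB)"
    proof (rule nn_integral_cong)
      fix x assume "x \<in> space ?SB"
      have "(\<integral>\<^sup>+y. ?SP (case_nat s x) (case_nat t y) \<partial>?SE) = (\<integral>\<^sup>+y. ?u * ?SP' x y \<partial>?SE)" by simp
      also have "\<dots> = ?u * (\<integral>\<^sup>+y. ?SP' x y \<partial>?SE)"
        by (rule nn_integral_cmult[OF my[OF \<open>x \<in> space ?SB\<close>]])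
      finally show "(\<integral>\<^sup>+y. ?SP (case_nat s x) (case_nat t y) \<partial>?SE) = ?u * (\<integral>\<^sup>+y. ?SP' x y \<partial>?SE)" .
    qed
    also have "\<dots> = ?u * (\<integral>\<^sup>+x. \<integral>\<^sup>+y. ?SP' x y \<partial>?SE \<partial>?SB)"
      by (rule nn_integral_cmult) (rule PE.P.borel_measurable_nn_integral[OF m])
    also have "(\<integral>\<^sup>+x. \<integral>\<^sup>+y. ?SP' x y \<partial>?SE \<partial>?SB) = sticks_expectation \<alpha> \<phi>s (z + t) (c * (1 - s * one_minus_R \<alpha> z t))"
      by (rule Cons.IH[OF \<phi>s])
    finally show "(\<integral>\<^sup>+x. \<integral>\<^sup>+y. ?SP (case_nat s x) (case_nat t y) \<partial>?SE \<partial>?SB) = ?u * sticks_expectation \<alpha> \<phi>s (z + t) (c * (1 - s * one_minus_R \<alpha> z t))" .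
  qed
  also have "\<dots> = sticks_expectation \<alpha> (\<phi> # \<phi>s) z c"
  proof -
    note SEm[measurable] = sticks_expectation_measurable[OF \<phi>s]
    have "(\<integral>\<^sup>+s. \<phi> (c * (s * one_minus_R \<alpha> z t)) * sticks_expectation \<alpha> \<phi>s (z + t) (c * (1 - s * one_minus_R \<alpha> z t)) \<partial>B)
      = (\<integral>\<^sup>+s. ennreal (beta_density (1 - \<alpha>) \<alpha> s) * (\<phi> (c * (s * one_minus_R \<alpha> z t)) * sticks_expectation \<alpha> \<phi>s (z + t) (c * (1 - s * one_minus_R \<alpha> z t))) \<partial>lborel)" for t
      unfolding B(2) by (rule nn_integral_density) measurable
    moreover have "(\<lambda>(t, s). ennreal (beta_density (1 - \<alpha>) \<alpha> s) * (\<phi> (c * (s * one_minus_R \<alpha> z t)) * sticks_expectation \<alpha> \<phi>s (z + t) (c * (1 - s * one_minus_R \<alpha> z t)))) \<in> borel_measurable (lborel \<Otimes>\<^sub>M lborel)"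
      unfolding split_beta by measurable
    then have "(\<lambda>t. \<integral>\<^sup>+s. ennreal (beta_density (1 - \<alpha>) \<alpha> s) * (\<phi> (c * (s * one_minus_R \<alpha> z t)) * sticks_expectation \<alpha> \<phi>s (z + t) (c * (1 - s * one_minus_R \<alpha> z t))) \<partial>lborel) \<in> borel_measurable lborel"
      by (rule lborel.borel_measurable_nn_integral)
    ultimately show ?thesis unfolding E(2) by (simp only: sticks_expectation.simps) (subst nn_integral_density, measurable)
  qed
  finally show ?case .
qed

text \<open>Re-indexing a sequence that starts at 1, so that the laws of sequences indexed by
  all natural numbers apply.\<close>

lemma iid_shifted_law:
  assumes Q: "prob_space Q" and ind: "prob_space.indep_vars Q (\<lambda>_. borel) b {1 :: nat..}"
    and d: "\<And>k. 1 \<le> k \<Longrightarrow> distributed Q lborel (b k) g"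
  shows "distr Q seq_space (\<lambda>\<omega> k. b (Suc k) \<omega>) = PiM UNIV (\<lambda>_. density lborel g)" "prob_space (density lborel g)"
    "\<And>k. 1 \<le> k \<Longrightarrow> b k \<in> borel_measurable Q"
proof -
  interpret Q: prob_space Q by fact
  have bm: "b k \<in> borel_measurable Q" if "1 \<le> k" for k using distributed_measurable[OF d[OF that]] by simp
  then show "\<And>k. 1 \<le> k \<Longrightarrow> b k \<in> borel_measurable Q" .
  have law: "distr Q borel (b k) = density lborel g" if "1 \<le> k" for k
    using distributed_distr_eq_density[OF d[OF that]] by (simp cong: distr_cong)
  show p: "prob_space (density lborel g)"
    unfolding law[of 1, symmetric, simplified] by (rule Q.prob_space_distr) (simp add: bm)
  have "distr Q (PiM {1..} (\<lambda>_. borel)) (\<lambda>\<omega>. \<lambda>i\<in>{1..}. b i \<omega>) = PiM {1..} (\<lambda>i. distr Q borel (b i))"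
    using ind bm by (subst (asm) Q.indep_vars_iff_distr_eq_PiM') auto
  also have "\<dots> = PiM {1..} (\<lambda>i. density lborel g)" by (intro PiM_cong) (auto simp: law)
  finally have 1: "distr Q (PiM {1..} (\<lambda>_. borel)) (\<lambda>\<omega>. \<lambda>i\<in>{1..}. b i \<omega>) = PiM {1..} (\<lambda>i. density lborel g)" .
  have rm: "(\<lambda>\<omega>. \<lambda>i\<in>{1 :: nat..}. b i \<omega>) \<in> Q \<rightarrow>\<^sub>M PiM {1..} (\<lambda>_. borel)"
    using bm by (intro measurable_restrict) auto
  have sm: "(\<lambda>x k. x (Suc k)) \<in> PiM {1..} (\<lambda>_. borel :: real measure) \<rightarrow>\<^sub>M seq_space"
    by (intro measurable_seq_spaceI measurable_component_singleton) auto
  have "PiM UNIV (\<lambda>_. density lborel g) = distr (PiM {1..} (\<lambda>i. density lborel g)) (PiM UNIV (\<lambda>i. density lborel g)) (\<lambda>\<omega>. \<lambda>n\<in>UNIV. \<omega> (Suc n))"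
    using p by (intro distr_PiM_reindex[symmetric]) auto
  also have "\<dots> = distr (PiM {1..} (\<lambda>i. density lborel g)) seq_space (\<lambda>\<omega> k. \<omega> (Suc k))"
    by (rule distr_cong) (auto cong: sets_PiM_cong)
  also have "\<dots> = distr Q seq_space (\<lambda>\<omega> k. b (Suc k) \<omega>)"
    unfolding 1[symmetric] by (subst distr_distr[OF sm rm]) (simp add: comp_def)
  finally show "distr Q seq_space (\<lambda>\<omega> k. b (Suc k) \<omega>) = PiM UNIV (\<lambda>_. density lborel g)" by simp
qed

lemma gamma_sum_eq: "gamma_sum e k = (\<Sum>i<k. e (Suc i))"
  unfolding gamma_sum_def by (rule sum.reindex_bij_witness[of _ Suc "\<lambda>i. i - 1"]) auto

lemma W_seq_eq_W_from:
  assumes "0 < k"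
  shows "W_seq b (R_seq \<alpha> lam e) k = W_from \<alpha> (lam powr \<alpha>) (\<lambda>i. b (Suc i)) (\<lambda>i. e (Suc i)) k"
  using assms unfolding W_seq_def R_seq_def W_from_def gamma_sum_eq by (simp add: add.commute)

lemma W_from_measurable:
  assumes [measurable]: "fx \<in> N \<rightarrow>\<^sub>M seq_space" "fy \<in> N \<rightarrow>\<^sub>M seq_space"
  shows "(\<lambda>q. W_from \<alpha> z (fx q) (fy q) k) \<in> borel_measurable N"
  unfolding W_from_def by measurable

lemma stick_breaking_measurable:
  assumes "\<And>k. 0 < k \<Longrightarrow> (\<lambda>q. w q k) \<in> borel_measurable N"
  shows "(\<lambda>q. stick_breaking (w q)) \<in> N \<rightarrow>\<^sub>M seq_space"
  unfolding stick_breaking_def[abs_def] using assms by (intro measurable_seq_spaceI borel_measurable_times borel_measurable_diff borel_measurable_prod) auto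

text \<open>Independence is available between the Beta variables and \<open>R\<close>, not the exponential variables
  themselves; therefore the expectation is first written as a double integral over two copies of the
  probability space, and only then is \<open>R\<close> expressed by the exponential variables.\<close>

lemma stick_breaking_expectation:
  assumes Q: "prob_space Q"
    and b: "prob_space.indep_vars Q (\<lambda>_. borel) b {1 :: nat..}" "\<And>k. 1 \<le> k \<Longrightarrow> distributed Q lborel (b k) (beta_density (1 - \<alpha>) \<alpha>)"
    and e: "prob_space.indep_vars Q (\<lambda>_. borel) e {1 :: nat..}" "\<And>k. 1 \<le> k \<Longrightarrow> distributed Q lborel (e k) (exponential_density 1)"
    and R: "\<And>\<omega> k. R \<omega> k = R_seq \<alpha> lam (\<lambda>i. e i \<omega>) k"
    and bR: "prob_space.indep_var Q (PiM {1..} (\<lambda>_. borel)) (\<lambda>\<omega>. \<lambda>k\<in>{1..}. b k \<omega>) (PiM {1..} (\<lambda>_. borel)) (\<lambda>\<omega>. \<lambda>k\<in>{1..}. R \<omega> k)"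
    and W: "\<And>\<omega> k. W \<omega> k = W_seq (\<lambda>i. b i \<omega>) (R \<omega>) k"
    and \<phi>s: "\<And>\<phi>. \<phi> \<in> set \<phi>s \<Longrightarrow> \<phi> \<in> borel_measurable borel"
  shows "(\<integral>\<^sup>+\<omega>. (\<Prod>l<length \<phi>s. (\<phi>s ! l) (stick_breaking (W \<omega>) l)) \<partial>Q) = sticks_expectation \<alpha> \<phi>s (lam powr \<alpha>) 1"
    "(\<lambda>\<omega>. stick_breaking (W \<omega>)) \<in> Q \<rightarrow>\<^sub>M seq_space"
proof -
  interpret Q: prob_space Q by fact
  have bl: "distr Q seq_space (\<lambda>\<omega> k. b (Suc k) \<omega>) = PiM UNIV (\<lambda>_. density lborel (beta_density (1 - \<alpha>) \<alpha>))"
      "prob_space (density lborel (beta_density (1 - \<alpha>) \<alpha>))" "\<And>k. b (Suc k) \<in> borel_measurable Q"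
    using iid_shifted_law[OF Q b(1)] b(2) by simp_all
  have el: "distr Q seq_space (\<lambda>\<omega> k. e (Suc k) \<omega>) = PiM UNIV (\<lambda>_. density lborel (exponential_density 1))"
      "prob_space (density lborel (exponential_density 1))" "\<And>k. e (Suc k) \<in> borel_measurable Q"
    using iid_shifted_law[OF Q e(1)] e(2) by simp_all
  let ?P = "PiM {1 :: nat..} (\<lambda>_. borel :: real measure)"
  let ?b = "\<lambda>\<omega>. \<lambda>k\<in>{1..}. b k \<omega>" and ?R = "\<lambda>\<omega>. \<lambda>k\<in>{1..}. R \<omega> k"
  have bRm: "?b \<in> Q \<rightarrow>\<^sub>M ?P" "?R \<in> Q \<rightarrow>\<^sub>M ?P"
    and joint: "distr Q ?P ?b \<Otimes>\<^sub>M distr Q ?P ?R = distr Q (?P \<Otimes>\<^sub>M ?P) (\<lambda>\<omega>. (?b \<omega>, ?R \<omega>))"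
    using bR unfolding Q.indep_var_distribution_eq by auto
  define bs where "bs \<omega> = (\<lambda>k. b (Suc k) \<omega>)" for \<omega>
  define es where "es \<omega> = (\<lambda>k. e (Suc k) \<omega>)" for \<omega>
  have bsm[measurable]: "bs \<in> Q \<rightarrow>\<^sub>M seq_space" unfolding bs_def[abs_def] by (rule measurable_seq_spaceI, rule bl(3))
  have esm[measurable]: "es \<in> Q \<rightarrow>\<^sub>M seq_space" unfolding es_def[abs_def] by (rule measurable_seq_spaceI, rule el(3))
  (* the integrand as a function of the two independent sequences, the second being R *)
  define G where "G x y = (\<Prod>l<length \<phi>s. (\<phi>s ! l) (stick_breaking (W_seq x y) l))" for x y
  have Wm: "(\<lambda>q. W_seq (fst q) (snd q) k) \<in> borel_measurable (?P \<Otimes>\<^sub>M ?P)" if "0 < k" for k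
  proof -
    have [measurable]: "(\<lambda>q. fst q k) \<in> borel_measurable (?P \<Otimes>\<^sub>M ?P)" "(\<lambda>q. snd q k) \<in> borel_measurable (?P \<Otimes>\<^sub>M ?P)"
      using that by (auto intro!: measurable_compose[OF measurable_fst measurable_component_singleton] measurable_compose[OF measurable_snd measurable_component_singleton])
    show ?thesis unfolding W_seq_def by measurable
  qed
  have Gm: "(\<lambda>q. G (fst q) (snd q)) \<in> borel_measurable (?P \<Otimes>\<^sub>M ?P)"
  proof -
    have "(\<lambda>q. stick_breaking (W_seq (fst q) (snd q))) \<in> ?P \<Otimes>\<^sub>M ?P \<rightarrow>\<^sub>M seq_space"
      by (rule stick_breaking_measurable) (rule Wm)
    then show ?thesis unfolding G_def using \<phi>s
      by (intro borel_measurable_prod_ennreal) (auto intro!: measurable_compose[OF measurable_compose[OF _ measurable_component_singleton]])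
  qed
  have Geq: "G (?b \<omega>) (?R \<omega>') = stick_product \<alpha> \<phi>s (lam powr \<alpha>) 1 (bs \<omega>) (es \<omega>')" for \<omega> \<omega>'
  proof -
    have "stick_breaking (W_seq (?b \<omega>) (?R \<omega>')) l = stick_breaking (W_from \<alpha> (lam powr \<alpha>) (bs \<omega>) (es \<omega>')) l" for l
    proof (rule stick_breaking_cong)
      fix k :: nat assume k: "0 < k"
      have "W_seq (?b \<omega>) (?R \<omega>') k = W_seq (\<lambda>i. b i \<omega>) (R_seq \<alpha> lam (\<lambda>i. e i \<omega>')) k"
        using k by (simp add: W_seq_def R)
      then show "W_seq (?b \<omega>) (?R \<omega>') k = W_from \<alpha> (lam powr \<alpha>) (bs \<omega>) (es \<omega>') k"
        unfolding W_seq_eq_W_from[OF k] bs_def es_def .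
    qed
    then show ?thesis unfolding G_def prod_sticks_eq_stick_product[symmetric] by simp
  qed
  have stickW: "stick_breaking (W \<omega>) = stick_breaking (W_from \<alpha> (lam powr \<alpha>) (bs \<omega>) (es \<omega>))" for \<omega>
  proof
    fix l
    show "stick_breaking (W \<omega>) l = stick_breaking (W_from \<alpha> (lam powr \<alpha>) (bs \<omega>) (es \<omega>)) l"
    proof (rule stick_breaking_cong)
      fix k :: nat assume k: "0 < k"
      have "R \<omega> = R_seq \<alpha> lam (\<lambda>i. e i \<omega>)" using R by auto
      then show "W \<omega> k = W_from \<alpha> (lam powr \<alpha>) (bs \<omega>) (es \<omega>) k"
        unfolding W bs_def es_def by (simp add: W_seq_eq_W_from[OF k])
    qed
  qed
  show "(\<lambda>\<omega>. stick_breaking (W \<omega>)) \<in> Q \<rightarrow>\<^sub>M seq_space"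
    unfolding stickW by (intro stick_breaking_measurable W_from_measurable bsm esm)
  note SPm = stick_product_measurable[OF \<phi>s]
  have "(\<integral>\<^sup>+\<omega>. (\<Prod>l<length \<phi>s. (\<phi>s ! l) (stick_breaking (W \<omega>) l)) \<partial>Q) = (\<integral>\<^sup>+\<omega>. G (?b \<omega>) (?R \<omega>) \<partial>Q)"
    unfolding Geq prod_sticks_eq_stick_product[symmetric] stickW by simp
  also have "\<dots> = (\<integral>\<^sup>+q. G (fst q) (snd q) \<partial>distr Q (?P \<Otimes>\<^sub>M ?P) (\<lambda>\<omega>. (?b \<omega>, ?R \<omega>)))"
    using bRm Gm by (subst nn_integral_distr) simp_all
  also have "\<dots> = (\<integral>\<^sup>+x. \<integral>\<^sup>+y. G x y \<partial>distr Q ?P ?R \<partial>distr Q ?P ?b)"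
  proof -
    interpret R: prob_space "distr Q ?P ?R" by (rule Q.prob_space_distr[OF bRm(2)])
    have "(\<lambda>q. G (fst q) (snd q)) \<in> borel_measurable (distr Q ?P ?b \<Otimes>\<^sub>M distr Q ?P ?R)"
      using Gm by (simp cong: measurable_cong_sets)
    from R.nn_integral_fst[OF this] show ?thesis unfolding joint[symmetric] by simp
  qed
  also have "\<dots> = (\<integral>\<^sup>+\<omega>. \<integral>\<^sup>+\<omega>'. G (?b \<omega>) (?R \<omega>') \<partial>Q \<partial>Q)"
  proof -
    interpret R: prob_space "distr Q ?P ?R" by (rule Q.prob_space_distr[OF bRm(2)])
    have "(\<lambda>(x, y). G x y) \<in> borel_measurable (?P \<Otimes>\<^sub>M distr Q ?P ?R)"
      using Gm by (simp add: split_beta cong: measurable_cong_sets)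
    then have m: "(\<lambda>x. \<integral>\<^sup>+y. G x y \<partial>distr Q ?P ?R) \<in> borel_measurable ?P"
      by (rule R.borel_measurable_nn_integral)
    have "(\<integral>\<^sup>+x. \<integral>\<^sup>+y. G x y \<partial>distr Q ?P ?R \<partial>distr Q ?P ?b) = (\<integral>\<^sup>+\<omega>. \<integral>\<^sup>+y. G (?b \<omega>) y \<partial>distr Q ?P ?R \<partial>Q)"
      by (rule nn_integral_distr[OF bRm(1)]) (use m in simp)
    also have "\<dots> = (\<integral>\<^sup>+\<omega>. \<integral>\<^sup>+\<omega>'. G (?b \<omega>) (?R \<omega>') \<partial>Q \<partial>Q)"
    proof (intro nn_integral_cong nn_integral_distr bRm(2))
      fix \<omega> assume "\<omega> \<in> space Q"
      then have "?b \<omega> \<in> space ?P" using bRm(1) by (rule measurable_space[rotated])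
      from measurable_compose_Pair1[OF this Gm] show "G (?b \<omega>) \<in> borel_measurable (distr Q ?P ?R)" by simp
    qed
    finally show ?thesis .
  qed
  also have "\<dots> = (\<integral>\<^sup>+\<omega>. \<integral>\<^sup>+\<omega>'. stick_product \<alpha> \<phi>s (lam powr \<alpha>) 1 (bs \<omega>) (es \<omega>') \<partial>Q \<partial>Q)"
    unfolding Geq ..
  also have "\<dots> = (\<integral>\<^sup>+\<omega>. \<integral>\<^sup>+y. stick_product \<alpha> \<phi>s (lam powr \<alpha>) 1 (bs \<omega>) y \<partial>distr Q seq_space es \<partial>Q)"
    by (intro nn_integral_cong nn_integral_distr[symmetric] esm SPm) (auto simp: space_PiM)
  also have "\<dots> = (\<integral>\<^sup>+x. \<integral>\<^sup>+y. stick_product \<alpha> \<phi>s (lam powr \<alpha>) 1 x y \<partial>distr Q seq_space es \<partial>distr Q seq_space bs)"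
  proof (rule nn_integral_distr[symmetric, OF bsm])
    interpret E: prob_space "distr Q seq_space es" by (rule Q.prob_space_distr[OF esm])
    have "(\<lambda>(x, y). stick_product \<alpha> \<phi>s (lam powr \<alpha>) 1 x y) \<in> borel_measurable (seq_space \<Otimes>\<^sub>M distr Q seq_space es)"
      unfolding split_beta by (intro SPm) measurable
    then have "(\<lambda>x. \<integral>\<^sup>+y. stick_product \<alpha> \<phi>s (lam powr \<alpha>) 1 x y \<partial>distr Q seq_space es) \<in> borel_measurable seq_space"
      by (rule E.borel_measurable_nn_integral)
    then show "(\<lambda>x. \<integral>\<^sup>+y. stick_product \<alpha> \<phi>s (lam powr \<alpha>) 1 x y \<partial>distr Q seq_space es) \<in> borel_measurable (distr Q seq_space bs)"
      by simp
  qed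
  also have "\<dots> = sticks_expectation \<alpha> \<phi>s (lam powr \<alpha>) 1"
    unfolding bs_def[abs_def] es_def[abs_def] bl(1) el(1)
    by (rule stick_product_expectation[OF bl(2) refl el(2) refl \<phi>s])
  finally show "(\<integral>\<^sup>+\<omega>. (\<Prod>l<length \<phi>s. (\<phi>s ! l) (stick_breaking (W \<omega>) l)) \<partial>Q) = sticks_expectation \<alpha> \<phi>s (lam powr \<alpha>) 1" .
qed

lemma seq_law_unique:
  assumes N: "prob_space N" "X \<in> N \<rightarrow>\<^sub>M seq_space" and Q: "Y \<in> Q \<rightarrow>\<^sub>M seq_space"
    and eq: "\<And>\<phi>s. (\<And>\<phi>. \<phi> \<in> set \<phi>s \<Longrightarrow> \<phi> \<in> borel_measurable borel) \<Longrightarrow>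
      (\<integral>\<^sup>+\<omega>. (\<Prod>l<length \<phi>s. (\<phi>s ! l) (X \<omega> l)) \<partial>N) = (\<integral>\<^sup>+\<omega>. (\<Prod>l<length \<phi>s. (\<phi>s ! l) (Y \<omega> l)) \<partial>Q)"
  shows "distr N seq_space X = distr Q seq_space Y"
proof (rule measure_eqI_PiM_infinite)
  interpret N: prob_space N by fact
  show "finite_measure (distr N seq_space X)" by (rule N.finite_measure_distr) fact
  fix A :: "nat \<Rightarrow> real set" and J :: "nat set"
  assume J: "finite J" and A: "\<And>i. i \<in> J \<Longrightarrow> A i \<in> sets borel"
  define B where "B i = (if i \<in> J then A i else UNIV)" for i
  have B: "B i \<in> sets borel" for i using A by (auto simp: B_def)
  obtain n where n: "J \<subseteq> {..<n}" using finite_nat_bounded[OF J] by auto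
  define \<phi>s :: "(real \<Rightarrow> ennreal) list" where "\<phi>s = map (\<lambda>i. indicator (B i)) [0..<n]"
  let ?C = "prod_emb UNIV (\<lambda>_. borel) J (Pi\<^sub>E J A)"
  have C: "?C \<in> sets seq_space" using J A by (intro sets_PiM_I) auto
  have ind: "(\<Prod>l<length \<phi>s. (\<phi>s ! l) (x l)) = indicator ?C x" for x
  proof -
    have "(\<Prod>l<length \<phi>s. (\<phi>s ! l) (x l)) = (\<Prod>l<n. indicator (B l) (x l))" by (simp add: \<phi>s_def)
    also have "\<dots> = (if \<forall>i<n. x i \<in> B i then 1 else 0)" by (auto simp: indicator_def)
    also have "(\<forall>i<n. x i \<in> B i) \<longleftrightarrow> x \<in> ?C"
      using n by (auto simp: B_def prod_emb_def PiE_iff space_PiM)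
    finally show ?thesis by (auto simp: indicator_def)
  qed
  have em: "emeasure (distr K seq_space Z) ?C = (\<integral>\<^sup>+\<omega>. (\<Prod>l<length \<phi>s. (\<phi>s ! l) (Z \<omega> l)) \<partial>K)"
    if Z: "Z \<in> K \<rightarrow>\<^sub>M seq_space" for K Z
  proof -
    have "emeasure (distr K seq_space Z) ?C = (\<integral>\<^sup>+x. indicator ?C x \<partial>distr K seq_space Z)" using C by simp
    also have "\<dots> = (\<integral>\<^sup>+\<omega>. indicator ?C (Z \<omega>) \<partial>K)" using C by (intro nn_integral_distr Z) simp
    finally show ?thesis by (simp only: ind)
  qed
  have "\<phi> \<in> borel_measurable borel" if "\<phi> \<in> set \<phi>s" for \<phi> using that B by (auto simp: \<phi>s_def)
  then show "emeasure (distr N seq_space X) ?C = emeasure (distr Q seq_space Y) ?C"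
    unfolding em[OF N(2)] em[OF Q] by (rule eq)
qed simp_all

section \<open>The size-biased rearrangement\<close>

theorem theorem3p1:
  fixes \<alpha> lam :: real
    and M :: "'a measure" and X :: "real \<Rightarrow> 'a \<Rightarrow> real" and A :: "'a \<Rightarrow> nat \<Rightarrow> real"
    and f :: "real \<Rightarrow> real" and PD_given :: "real \<Rightarrow> (nat \<Rightarrow> real) measure"
    and N :: "'b measure" and P Pt :: "'b \<Rightarrow> nat \<Rightarrow> real"
    and Q :: "'c measure" and b e :: "nat \<Rightarrow> 'c \<Rightarrow> real"
    and R W :: "'c \<Rightarrow> nat \<Rightarrow> real"
  assumes \<alpha>: "0 < \<alpha>" "\<alpha> < 1" and lam: "0 < lam"
    and f: "stable_density \<alpha> f"
    and X: "subordinator M X (stable_levy_density \<alpha>)"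
    and A: "ranked_jumps_of M X A"
    and PD_given: "conditional_law M seq_space
                     (\<lambda>\<omega>. normalized (A \<omega>)) (\<lambda>\<omega>. total_mass (A \<omega>)) PD_given"
    and N: "prob_space N"
    and P: "P \<in> N \<rightarrow>\<^sub>M seq_space" "distr N seq_space P = tilted_PD \<alpha> lam f PD_given"
    and Pt: "size_biased_rearrangement N P Pt"
    and Q: "prob_space Q"
    and b: "prob_space.indep_vars Q (\<lambda>_. borel) b {1..}"
           "\<And>k. 1 \<le> k \<Longrightarrow> distributed Q lborel (b k) (beta_density (1 - \<alpha>) \<alpha>)"
    and e: "prob_space.indep_vars Q (\<lambda>_. borel) e {1..}"
           "\<And>k. 1 \<le> k \<Longrightarrow> distributed Q lborel (e k) (exponential_density 1)"
    and R: "\<And>\<omega> k. R \<omega> k = R_seq \<alpha> lam (\<lambda>i. e i \<omega>) k"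
    and bR: "prob_space.indep_var Q
               (PiM {1..} (\<lambda>_. borel)) (\<lambda>\<omega>. \<lambda>k\<in>{1..}. b k \<omega>)
               (PiM {1..} (\<lambda>_. borel)) (\<lambda>\<omega>. \<lambda>k\<in>{1..}. R \<omega> k)"
    and W: "\<And>\<omega> k. W \<omega> k = W_seq (\<lambda>i. b i \<omega>) (R \<omega>) k"
  shows "(\<forall>(M' :: 'd measure) Y A'.
            subordinator M' Y (gen_gamma_levy_density \<alpha> lam) \<and> ranked_jumps_of M' Y A' \<longrightarrow>
            distr N seq_space P = distr M' seq_space (\<lambda>\<omega>. normalized (A' \<omega>)))
       \<and> distr N seq_space Pt = distr Q seq_space (\<lambda>\<omega>. stick_breaking (W \<omega>))"
proof
  note M_prob = subordinator.axioms(1)[OF X]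
  interpret M: prob_space M by (rule M_prob)
  interpret N: prob_space N by (rule N)
  have J: "poisson_jumps M A (stable_levy_density \<alpha>)" by (rule subordinator.poisson_jumps[OF X A])
  have f': "f \<in> borel_measurable borel" "\<And>t. 0 \<le> f t" "\<And>t. t \<le> 0 \<Longrightarrow> f t = 0"
    using f by (auto simp: stable_density_def)
  note Am[measurable] = poisson_jumps.jumps_measurable[OF J]
  note f'(1)[measurable]
  have total: "distr M borel (\<lambda>\<omega>. suminf (A \<omega>)) = density lborel (\<lambda>t. ennreal (f t))"
    by (rule stable_total_mass_law[OF \<alpha> J f])
  have S_pos: "AE \<omega> in M. 0 < suminf (A \<omega>)"
  proof -
    have "0 < ennreal (f t) \<Longrightarrow> 0 < t" for t using f'(3)[of t] by (cases "t \<le> 0") auto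
    then have "AE t in density lborel (\<lambda>t. ennreal (f t)). 0 < t" by (subst AE_density) simp_all
    then show ?thesis unfolding total[symmetric] by (subst (asm) AE_distr_iff) simp_all
  qed
  interpret stable_jumps M A \<alpha>
    using J \<alpha> S_pos by (intro stable_jumps.intro stable_jumps_axioms.intro)
  (* Both claims are about the image under normalization of this tilted law of the jumps. *)
  let ?tilt = "density M (\<lambda>\<omega>. ennreal (exp (lam powr \<alpha> - lam * suminf (A \<omega>))))"
  have lawP: "distr N seq_space P = distr ?tilt seq_space (\<lambda>\<omega>. normalized (A \<omega>))"
    unfolding P(2) using tilted_PD_eq[OF M_prob Am f' _ PD_given] total by (simp add: total_mass_def)
  show "\<forall>(M' :: 'd measure) Y A'. subordinator M' Y (gen_gamma_levy_density \<alpha> lam) \<and> ranked_jumps_of M' Y A' \<longrightarrow>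
      distr N seq_space P = distr M' seq_space (\<lambda>\<omega>. normalized (A' \<omega>))"
  proof (intro allI impI, elim conjE)
    fix M' :: "'d measure" and Y A'
    assume Y: "subordinator M' Y (gen_gamma_levy_density \<alpha> lam)" "ranked_jumps_of M' Y A'"
    have J': "poisson_jumps M' A' (\<lambda>s. exp (- lam * s) * stable_levy_density \<alpha> s)"
      using subordinator.poisson_jumps[OF Y] by (simp add: gen_gamma_levy_density_def[abs_def])
    note [measurable] = poisson_jumps.jumps_measurable[OF J']
    have "distr M' seq_space A' = distr ?tilt seq_space A"
      using lam by (intro exponentially_tilted_jumps[OF J J'] stable_jumps_laplace_total[OF \<alpha> J]) simp_all
    then have "distr (distr M' seq_space A') seq_space normalized = distr (distr ?tilt seq_space A) seq_space normalized"
      by simp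
    then have "distr M' seq_space (\<lambda>\<omega>. normalized (A' \<omega>)) = distr ?tilt seq_space (\<lambda>\<omega>. normalized (A \<omega>))"
      by (simp add: distr_distr comp_def)
    then show "distr N seq_space P = distr M' seq_space (\<lambda>\<omega>. normalized (A' \<omega>))" unfolding lawP ..
  qed
  show "distr N seq_space Pt = distr Q seq_space (\<lambda>\<omega>. stick_breaking (W \<omega>))"
  proof (rule seq_law_unique[OF N])
    show "Pt \<in> N \<rightarrow>\<^sub>M seq_space" by (rule size_biased_rearrangement_measurable[OF P(1) Pt])
    show "(\<lambda>\<omega>. stick_breaking (W \<omega>)) \<in> Q \<rightarrow>\<^sub>M seq_space"
      by (rule stick_breaking_expectation(2)[OF Q b e R bR W, where \<phi>s = "[]"]) simp_all
    fix \<phi>s :: "(real \<Rightarrow> ennreal) list" assume \<phi>s: "\<And>\<phi>. \<phi> \<in> set \<phi>s \<Longrightarrow> \<phi> \<in> borel_measurable borel"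
    note pm[measurable] = picks_expectation_measurable[OF \<phi>s]
    note dm[measurable] = measurable_picks_of_deletion[OF \<phi>s]
    have "(\<integral>\<^sup>+\<omega>. (\<Prod>l<length \<phi>s. (\<phi>s ! l) (Pt \<omega> l)) \<partial>N) = (\<integral>\<^sup>+p. picks_expectation \<phi>s {} p \<partial>distr N seq_space P)"
      by (rule size_biased_picks_expectation[OF N P(1) Pt \<phi>s])
    also have "\<dots> = (\<integral>\<^sup>+\<omega>. ennreal (exp (lam powr \<alpha> - lam * suminf (A \<omega>))) * picks_expectation \<phi>s {} (normalized (A \<omega>)) \<partial>M)"
      unfolding lawP by (simp add: nn_integral_distr nn_integral_density)
    also have "\<dots> = (\<integral>\<^sup>+\<omega>. ennreal (exp (lam powr \<alpha>)) * (ennreal (exp (- (lam * suminf (A \<omega>)))) * deletion_expectation \<phi>s 1 (A \<omega>)) \<partial>M)"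
    proof (rule nn_integral_cong_AE)
      show "AE \<omega> in M. ennreal (exp (lam powr \<alpha> - lam * suminf (A \<omega>))) * picks_expectation \<phi>s {} (normalized (A \<omega>))
        = ennreal (exp (lam powr \<alpha>)) * (ennreal (exp (- (lam * suminf (A \<omega>)))) * deletion_expectation \<phi>s 1 (A \<omega>))"
        using S_pos AE_ranked
      proof eventually_elim
        case (elim \<omega>)
        have "ennreal (exp (lam powr \<alpha> - lam * suminf (A \<omega>))) = ennreal (exp (lam powr \<alpha>)) * ennreal (exp (- (lam * suminf (A \<omega>))))"
          by (simp add: ennreal_mult[symmetric] exp_add[symmetric])
        then show ?case using deletion_expectation_normalized[OF elim(2,1), of \<phi>s] by (simp add: mult.assoc)
      qed
    qed
    also have "\<dots> = ennreal (exp (lam powr \<alpha>)) * tilted_picks \<phi>s lam 1"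
      unfolding tilted_picks_def by (rule nn_integral_cmult) measurable
    also have "\<dots> = sticks_expectation \<alpha> \<phi>s (lam powr \<alpha>) 1"
      by (rule tilted_picks_eq_sticks[OF \<phi>s lam])
    also have "\<dots> = (\<integral>\<^sup>+\<omega>. (\<Prod>l<length \<phi>s. (\<phi>s ! l) (stick_breaking (W \<omega>) l)) \<partial>Q)"
      by (rule stick_breaking_expectation(1)[OF Q b e R bR W \<phi>s, symmetric])
    finally show "(\<integral>\<^sup>+\<omega>. (\<Prod>l<length \<phi>s. (\<phi>s ! l) (Pt \<omega> l)) \<partial>N) = (\<integral>\<^sup>+\<omega>. (\<Prod>l<length \<phi>s. (\<phi>s ! l) (stick_breaking (W \<omega>) l)) \<partial>Q)" .
  qed
qed

end
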